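(* Under the standing assumptions (A1)–(A6) of the context, suppose that $a$ is non-degenerate on $\Delta\cap(0,\infty)^2$, where $\Delta=\{x_1=\alpha x_2\}$, so that $q=n^\top a\,n>0$ there, with $n=(1,-\alpha)$. Then every interior diagonal point is a continuation point: $$\Delta\cap(0,\infty)^2\subseteq\mathcal C .$$
   Context: Let $\mathbb R^2_+=[0,\infty)^2$. Let $W$ be a two-dimensional Brownian motion on a filtered probability space satisfying the usual conditions. For $x\in\mathbb R^2_+$ the normally reflected diffusion $X$ started at $x$ solves $X_t=x+\int_0^t\mu(X_s)\,ds+\int_0^t\sigma(X_s)\,dW_s+L_t$ in $\mathbb R^2_+$, where $L=(L^1,L^2)$ with each $L^i$ continuous, non-decreasing, $L^i_0=0$, $\int_0^\infty\mathbf 1_{\{X^i_t>0\}}dL^i_t=0$. Put $a=\sigma\sigma^\top$; $\mathbb E_x$ is expectation for $X_0=x$; $r>0$ is the discount rate. Standing assumptions: (A1) $\mu,\sigma$ are locally Lipschitz on $\mathbb R^2_+$ with at most linear growth. (A2) $a$ is locally uniformly elliptic: for every compact $K\subset\mathbb R^2_+$ there is $\lambda_K>0$ with $\xi^\top a(x)\xi\ge\lambda_K|\xi|^2$ for $x\in K$, $\xi\in\mathbb R^2$. (A3) For each $x$ the reflected SDE has a unique strong solution and $(X^x)_x$ is strong Markov. (A4) For every $T>0$, compact $K$, and some $q_0\ge1$, $\lim_{y\to x}\mathbb E[\sup_{0\le t\le T}|X^y_t-X^x_t|^{q_0}]=0$ uniformly on $K$. (A5) $G(x_1,x_2)=x_1\vee\alpha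 x_2$ with $\alpha>0$, and $c:\mathbb R^2_+\to[0,\infty)$ is continuous. (A6) $V$ (below) is finite with $0\le V(x)\le C_V(1+|x|^p)$ for some $C_V,p$, and the payoff terms are integrable for the stopping times considered. The value function is $V(x)=\sup_\tau\mathbb E_x[e^{-r\tau}G(X_\tau)-\int_0^\tau e^{-rs}c(X_s)\,ds]$ over all stopping times $\tau\in[0,\infty]$, with $e^{-r\tau}G(X_\tau):=0$ on $\{\tau=\infty\}$. The stopping set is $\mathcal D=\{V=G\}$ and the continuation set is $\mathcal C=\{V>G\}$. *)

theory Defs
  imports "HOL-Probability.Probability"
begin

definition quadrant :: "(real^2) set" where
  "quadrant = {x. 0 \<le> x $ 1 \<and> 0 \<le> x $ 2}"

section \<open>Filtered probability space and Brownian motion\<close>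

text \<open>Processes are indexed by real times $t \ge 0$; their values at negative times are irrelevant.
  Filtrations are indexed by $[0,\infty]$, i.e. by \<^typ>\<open>ennreal\<close>, so that the library notions
  \<^const>\<open>filtration\<close>, \<^const>\<open>stopping_time\<close> and \<^const>\<open>filtration.pre_sigma\<close> apply directly to
  $[0,\infty]$-valued stopping times. The condition on \<^const>\<open>stopping_time\<close> at $t=\infty$ is void.\<close>

definition usual_conditions :: "'a measure \<Rightarrow> (ennreal \<Rightarrow> 'a measure) \<Rightarrow> bool" where
  "usual_conditions M F \<longleftrightarrow>
     prob_space M \<and> complete_measure M \<and>
     filtration (space M) F \<and> (\<forall>t. sets (F t) \<subseteq> sets M) \<and>
     null_sets M \<subseteq> sets (F 0) \<and>
     (\<forall>t<\<infinity>. sets (F t) = (\<Inter>s\<in>{t<..}. sets (F s)))"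

definition adapted :: "(ennreal \<Rightarrow> 'a measure) \<Rightarrow> (real \<Rightarrow> 'a \<Rightarrow> 'b::topological_space) \<Rightarrow> bool" where
  "adapted F Y \<longleftrightarrow> (\<forall>t\<ge>0. Y t \<in> borel_measurable (F (ennreal t)))"

definition continuous_paths :: "'a measure \<Rightarrow> (real \<Rightarrow> 'a \<Rightarrow> 'b::topological_space) \<Rightarrow> bool" where
  "continuous_paths M Y \<longleftrightarrow> (\<forall>\<omega>\<in>space M. continuous_on {0..} (\<lambda>t. Y t \<omega>))"

definition progressive :: "(ennreal \<Rightarrow> 'a measure) \<Rightarrow> (real \<Rightarrow> 'a \<Rightarrow> 'b::topological_space) \<Rightarrow> bool" where
  "progressive F H \<longleftrightarrow>
     (\<forall>T\<ge>0. (\<lambda>(s, \<omega>). H s \<omega>) \<in> borel_measurable (restrict_space borel {0..T} \<Otimes>\<^sub>M F (ennreal T)))"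

definition brownian_motion ::
  "'a measure \<Rightarrow> (ennreal \<Rightarrow> 'a measure) \<Rightarrow> (real \<Rightarrow> 'a \<Rightarrow> real^2) \<Rightarrow> bool" where
  "brownian_motion M F W \<longleftrightarrow>
     adapted F W \<and> continuous_paths M W \<and> (\<forall>\<omega>\<in>space M. W 0 \<omega> = 0) \<and>
     (\<forall>s t. 0 \<le> s \<and> s < t \<longrightarrow>
        distributed M lborel (\<lambda>\<omega>. W t \<omega> - W s \<omega>)
          (\<lambda>z. ennreal (\<Prod>i\<in>UNIV. normal_density 0 (sqrt (t - s)) (z $ i))) \<and>
        prob_space.indep_set M (sets (F (ennreal s)))
          {(\<lambda>\<omega>. W t \<omega> - W s \<omega>) -` B \<inter> space M | B. B \<in> sets borel})"

definition brownian_filtration ::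
  "'a measure \<Rightarrow> (real \<Rightarrow> 'a \<Rightarrow> real^2) \<Rightarrow> ennreal \<Rightarrow> 'a measure" where
  "brownian_filtration M W t =
     sigma (space M)
       ({W s -` B \<inter> space M | s B. 0 \<le> s \<and> ennreal s \<le> t \<and> B \<in> sets borel} \<union> null_sets M)"

section \<open>Ito integral\<close>

text \<open>A simple integrand is $\sum_{k<m} \xi_k \mathbf 1_{(t_k, t_{k+1}]}$ with each $\xi_k$ bounded
  and $\mathcal F_{t_k}$-measurable.\<close>

definition simple_integrand ::
  "'a measure \<Rightarrow> (ennreal \<Rightarrow> 'a measure) \<Rightarrow> nat \<Rightarrow> (nat \<Rightarrow> real) \<Rightarrow> (nat \<Rightarrow> 'a \<Rightarrow> real^2^2) \<Rightarrow> bool" where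
  "simple_integrand M F m t \<xi> \<longleftrightarrow>
     0 \<le> t 0 \<and> (\<forall>k<m. t k \<le> t (Suc k)) \<and>
     (\<forall>k<m. \<xi> k \<in> borel_measurable (F (ennreal (t k))) \<and> bounded (\<xi> k ` space M))"

definition simple_process ::
  "nat \<Rightarrow> (nat \<Rightarrow> real) \<Rightarrow> (nat \<Rightarrow> 'a \<Rightarrow> real^2^2) \<Rightarrow> real \<Rightarrow> 'a \<Rightarrow> real^2^2" where
  "simple_process m t \<xi> s \<omega> = (\<Sum>k<m. if t k < s \<and> s \<le> t (Suc k) then \<xi> k \<omega> else 0)"

definition simple_integral ::
  "(real \<Rightarrow> 'a \<Rightarrow> real^2) \<Rightarrow> nat \<Rightarrow> (nat \<Rightarrow> real) \<Rightarrow> (nat \<Rightarrow> 'a \<Rightarrow> real^2^2) \<Rightarrow> real \<Rightarrow> 'a \<Rightarrow> real^2" where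
  "simple_integral W m t \<xi> s \<omega> =
     (\<Sum>k<m. \<xi> k \<omega> *v (W (min s (t (Suc k))) \<omega> - W (min s (t k)) \<omega>))"

text \<open>\<open>ito_integral M F W H I\<close>: the continuous adapted process $I$ is (a version of)
  $\int_0^{\cdot} H_s\,dW_s$. That is, there are simple integrands $H^n$ such that for every $T$, in
  probability, $\int_0^T |H^n_s - H_s|^2\,ds \to 0$ and
  $\sup_{t \le T} |\int_0^t H^n_s\,dW_s - I_t| \to 0$. The first limit forces
  $\int_0^T |H_s|^2\,ds < \infty$ almost surely. Progressive measurability of $H$ and continuity of
  $I$ and $W$ make the events below measurable. The matrix norm is the Frobenius norm.\<close>

definition ito_integral ::
  "'a measure \<Rightarrow> (ennreal \<Rightarrow> 'a measure) \<Rightarrow> (real \<Rightarrow> 'a \<Rightarrow> real^2) \<Rightarrow>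
   (real \<Rightarrow> 'a \<Rightarrow> real^2^2) \<Rightarrow> (real \<Rightarrow> 'a \<Rightarrow> real^2) \<Rightarrow> bool" where
  "ito_integral M F W H I \<longleftrightarrow>
     progressive F H \<and> adapted F I \<and> continuous_paths M I \<and>
     (\<exists>m t \<xi>. (\<forall>n. simple_integrand M F (m n) (t n) (\<xi> n)) \<and>
        (\<forall>T>0. \<forall>\<epsilon>>0.
          (\<lambda>n. measure M {\<omega> \<in> space M.
             (\<integral>\<^sup>+ s\<in>{0..T}. ennreal ((norm (simple_process (m n) (t n) (\<xi> n) s \<omega> - H s \<omega>))\<^sup>2) \<partial>lborel)
               > ennreal \<epsilon>}) \<longlonglongrightarrow> 0 \<and>
          (\<lambda>n. measure M {\<omega> \<in> space M. \<exists>u\<in>{0..T}.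
             norm (simple_integral W (m n) (t n) (\<xi> n) u \<omega> - I u \<omega>) > \<epsilon>}) \<longlonglongrightarrow> 0))"

section \<open>Normally reflected diffusion\<close>

text \<open>\<open>reflection_term M F Y L\<close>: each $L^i$ is adapted, continuous, non-decreasing, starts at $0$ and
  satisfies $\int_0^\infty \mathbf 1_{\{Y^i_t>0\}}\,dL^i_t = 0$ almost surely. As
  \<^const>\<open>interval_measure\<close> needs a function on the whole line, $L^i$ is extended by $L^i_0 = 0$ to
  negative times.\<close>

definition reflection_term ::
  "'a measure \<Rightarrow> (ennreal \<Rightarrow> 'a measure) \<Rightarrow> (real \<Rightarrow> 'a \<Rightarrow> real^2) \<Rightarrow> (real \<Rightarrow> 'a \<Rightarrow> real^2) \<Rightarrow> bool" where
  "reflection_term M F Y L \<longleftrightarrow>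
     adapted F L \<and> continuous_paths M L \<and>
     (\<forall>\<omega>\<in>space M. L 0 \<omega> = 0 \<and> (\<forall>i. mono_on {0..} (\<lambda>t. L t \<omega> $ i))) \<and>
     (AE \<omega> in M. \<forall>i. (\<integral>\<^sup>+ t\<in>{0..}. indicator {t. Y t \<omega> $ i > 0} t
                          \<partial>interval_measure (\<lambda>t. L (max 0 t) \<omega> $ i)) = 0)"

definition reflected_solution ::
  "'a measure \<Rightarrow> (ennreal \<Rightarrow> 'a measure) \<Rightarrow> (real \<Rightarrow> 'a \<Rightarrow> real^2) \<Rightarrow>
   (real^2 \<Rightarrow> real^2) \<Rightarrow> (real^2 \<Rightarrow> real^2^2) \<Rightarrow> real^2 \<Rightarrow> (real \<Rightarrow> 'a \<Rightarrow> real^2) \<Rightarrow> bool" where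
  "reflected_solution M F W \<mu> \<sigma> x Y \<longleftrightarrow>
     adapted F Y \<and> continuous_paths M Y \<and> (\<forall>\<omega>\<in>space M. \<forall>t\<ge>0. Y t \<omega> \<in> quadrant) \<and>
     (\<exists>I L. ito_integral M F W (\<lambda>s \<omega>. \<sigma> (Y s \<omega>)) I \<and> reflection_term M F Y L \<and>
        (AE \<omega> in M. \<forall>t\<ge>0.
           Y t \<omega> = x + (LINT s:{0..t}|lborel. \<mu> (Y s \<omega>)) + I t \<omega> + L t \<omega>))"

text \<open>Strong solutions are adapted to the augmented filtration of $W$; uniqueness is pathwise, among
  all solutions adapted to the given filtration.\<close>

definition unique_strong_solution ::
  "'a measure \<Rightarrow> (ennreal \<Rightarrow> 'a measure) \<Rightarrow> (real \<Rightarrow> 'a \<Rightarrow> real^2) \<Rightarrow>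
   (real^2 \<Rightarrow> real^2) \<Rightarrow> (real^2 \<Rightarrow> real^2^2) \<Rightarrow> real^2 \<Rightarrow> (real \<Rightarrow> 'a \<Rightarrow> real^2) \<Rightarrow> bool" where
  "unique_strong_solution M F W \<mu> \<sigma> x Y \<longleftrightarrow>
     reflected_solution M F W \<mu> \<sigma> x Y \<and> adapted (brownian_filtration M W) Y \<and>
     (\<forall>Z. reflected_solution M F W \<mu> \<sigma> x Z \<longrightarrow> (AE \<omega> in M. \<forall>t\<ge>0. Z t \<omega> = Y t \<omega>))"

text \<open>In the remaining definitions \<open>X x\<close> is the diffusion $X^x$ started at $x$, and $\mathbb E_x$
  is the expectation under \<open>M\<close> of functionals of \<open>X x\<close>. The strong Markov property reads
  $\mathbb E[f(X^x_{\tau+t}) \mid \mathcal F_\tau] = \mathbb E_y[f(X_t)]|_{y = X^x_\tau}$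
  almost surely on $\{\tau < \infty\}$.\<close>

definition strong_markov ::
  "'a measure \<Rightarrow> (ennreal \<Rightarrow> 'a measure) \<Rightarrow> (real^2 \<Rightarrow> real \<Rightarrow> 'a \<Rightarrow> real^2) \<Rightarrow> bool" where
  "strong_markov M F X \<longleftrightarrow>
     (\<forall>f :: real^2 \<Rightarrow> real. \<forall>t\<ge>0. f \<in> borel_measurable borel \<and> bounded (range f) \<longrightarrow>
        (\<lambda>y. LINT \<omega>|M. f (X y t \<omega>)) \<in> borel_measurable (restrict_space borel quadrant) \<and>
        (\<forall>x\<in>quadrant. \<forall>\<tau>. stopping_time F \<tau> \<longrightarrow>
           (AE \<omega> in M. \<tau> \<omega> < \<infinity> \<longrightarrow>
              real_cond_exp M (filtration.pre_sigma (space M) F \<tau>)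
                (\<lambda>\<omega>'. if \<tau> \<omega>' < \<infinity> then f (X x (enn2real (\<tau> \<omega>') + t) \<omega>') else 0) \<omega>
              = (LINT \<omega>'|M. f (X (X x (enn2real (\<tau> \<omega>)) \<omega>) t \<omega>')))))"

section \<open>Conditions on the coefficients and on the flow\<close>

definition diffusion_matrix :: "(real^2 \<Rightarrow> real^2^2) \<Rightarrow> real^2 \<Rightarrow> real^2^2" where
  "diffusion_matrix \<sigma> x = \<sigma> x ** transpose (\<sigma> x)"

definition locally_lipschitz_on_quadrant :: "(real^2 \<Rightarrow> 'b::metric_space) \<Rightarrow> bool" where
  "locally_lipschitz_on_quadrant f \<longleftrightarrow>
     (\<forall>K. compact K \<and> K \<subseteq> quadrant \<longrightarrow> (\<exists>l. l-lipschitz_on K f))"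

definition linear_growth_on_quadrant :: "(real^2 \<Rightarrow> 'b::real_normed_vector) \<Rightarrow> bool" where
  "linear_growth_on_quadrant f \<longleftrightarrow> (\<exists>C. \<forall>x\<in>quadrant. norm (f x) \<le> C * (1 + norm x))"

definition locally_uniformly_elliptic :: "(real^2 \<Rightarrow> real^2^2) \<Rightarrow> bool" where
  "locally_uniformly_elliptic a \<longleftrightarrow>
     (\<forall>K. compact K \<and> K \<subseteq> quadrant \<longrightarrow>
        (\<exists>\<kappa>>0. \<forall>x\<in>K. \<forall>\<xi>. \<xi> \<bullet> (a x *v \<xi>) \<ge> \<kappa> * (norm \<xi>)\<^sup>2))"

definition locally_uniform_flow ::
  "'a measure \<Rightarrow> (real^2 \<Rightarrow> real \<Rightarrow> 'a \<Rightarrow> real^2) \<Rightarrow> bool" where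
  "locally_uniform_flow M X \<longleftrightarrow>
     (\<forall>T>0. \<forall>K. compact K \<and> K \<subseteq> quadrant \<longrightarrow>
        (\<exists>q\<ge>1. \<forall>\<epsilon>>0. \<exists>\<delta>>0. \<forall>x\<in>K. \<forall>y\<in>quadrant. dist y x < \<delta> \<longrightarrow>
           (\<integral>\<^sup>+ \<omega>. (SUP t\<in>{0..T}. ennreal (norm (X y t \<omega> - X x t \<omega>) powr q)) \<partial>M) < ennreal \<epsilon>))"

section \<open>Optimal stopping problem\<close>

definition gain :: "real \<Rightarrow> real^2 \<Rightarrow> real" where
  "gain \<alpha> x = max (x $ 1) (\<alpha> * x $ 2)"

definition terminal_payoff ::
  "real \<Rightarrow> real \<Rightarrow> (real \<Rightarrow> 'a \<Rightarrow> real^2) \<Rightarrow> ('a \<Rightarrow> ennreal) \<Rightarrow> 'a \<Rightarrow> real" where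
  "terminal_payoff \<alpha> r Y \<tau> \<omega> =
     (if \<tau> \<omega> = \<infinity> then 0
      else exp (- r * enn2real (\<tau> \<omega>)) * gain \<alpha> (Y (enn2real (\<tau> \<omega>)) \<omega>))"

definition running_cost ::
  "(real^2 \<Rightarrow> real) \<Rightarrow> real \<Rightarrow> (real \<Rightarrow> 'a \<Rightarrow> real^2) \<Rightarrow> ('a \<Rightarrow> ennreal) \<Rightarrow> 'a \<Rightarrow> ennreal" where
  "running_cost c r Y \<tau> \<omega> =
     (\<integral>\<^sup>+ s\<in>{s. 0 \<le> s \<and> ennreal s \<le> \<tau> \<omega>}. ennreal (exp (- r * s) * c (Y s \<omega>)) \<partial>lborel)"

definition payoff_integrable ::
  "'a measure \<Rightarrow> (real^2 \<Rightarrow> real) \<Rightarrow> real \<Rightarrow> real \<Rightarrow> (real \<Rightarrow> 'a \<Rightarrow> real^2) \<Rightarrow> ('a \<Rightarrow> ennreal) \<Rightarrow> bool" where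
  "payoff_integrable M c \<alpha> r Y \<tau> \<longleftrightarrow>
     integrable M (terminal_payoff \<alpha> r Y \<tau>) \<and>
     (AE \<omega> in M. running_cost c r Y \<tau> \<omega> < \<infinity>) \<and>
     integrable M (\<lambda>\<omega>. enn2real (running_cost c r Y \<tau> \<omega>))"

definition expected_payoff ::
  "'a measure \<Rightarrow> (real^2 \<Rightarrow> real) \<Rightarrow> real \<Rightarrow> real \<Rightarrow> (real \<Rightarrow> 'a \<Rightarrow> real^2) \<Rightarrow> ('a \<Rightarrow> ennreal) \<Rightarrow> real" where
  "expected_payoff M c \<alpha> r Y \<tau> =
     (LINT \<omega>|M. terminal_payoff \<alpha> r Y \<tau> \<omega> - enn2real (running_cost c r Y \<tau> \<omega>))"

definition value_function ::
  "'a measure \<Rightarrow> (ennreal \<Rightarrow> 'a measure) \<Rightarrow> (real^2 \<Rightarrow> real) \<Rightarrow> real \<Rightarrow> real \<Rightarrow>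
   (real^2 \<Rightarrow> real \<Rightarrow> 'a \<Rightarrow> real^2) \<Rightarrow> real^2 \<Rightarrow> ereal" where
  "value_function M F c \<alpha> r X x =
     (SUP \<tau>\<in>{\<tau>. stopping_time F \<tau>}. ereal (expected_payoff M c \<alpha> r (X x) \<tau>))"

definition continuation_set ::
  "'a measure \<Rightarrow> (ennreal \<Rightarrow> 'a measure) \<Rightarrow> (real^2 \<Rightarrow> real) \<Rightarrow> real \<Rightarrow> real \<Rightarrow>
   (real^2 \<Rightarrow> real \<Rightarrow> 'a \<Rightarrow> real^2) \<Rightarrow> (real^2) set" where
  "continuation_set M F c \<alpha> r X =
     {x \<in> quadrant. value_function M F c \<alpha> r X x > ereal (gain \<alpha> x)}"

definition diagonal :: "real \<Rightarrow> (real^2) set" where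
  "diagonal \<alpha> = {x \<in> quadrant. x $ 1 = \<alpha> * x $ 2}"

definition open_quadrant :: "(real^2) set" where
  "open_quadrant = {x. 0 < x $ 1 \<and> 0 < x $ 2}"

end

theory Submission
  imports Defs
begin

text \<open>Stop at the exit time \<open>\<tau>\<close> of a small ball around the diagonal point \<open>x\<close>, capped at a
  small time \<open>h\<close>. Up to \<open>\<tau>\<close> there is no reflection, the drift contributes \<open>O(h)\<close>, and the
  stochastic integral differs from \<open>\<sigma> x *v W\<close> by at most \<open>O(\<epsilon> \<surd>h)\<close> in mean square norm, where \<open>\<epsilon>\<close>
  is the oscillation of \<open>\<sigma>\<close> on the ball. At a diagonal point the increment of the gain is the gain
  of the displacement, so its kink yields the expected increment \<open>\<surd>h E\<bar>n \<bullet> (\<sigma> x *v Z)\<bar> / 2\<close> with \<open>Z\<close> standard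
  Gaussian, which is positive by non-degeneracy. Discounting, running cost and the event of leaving
  the ball before \<open>h\<close> cost only \<open>O(h)\<close>, so stopping at \<open>\<tau>\<close> beats stopping at once for
  small \<open>h\<close>.\<close>

section \<open>Standard Gaussian vectors in the plane\<close>

text \<open>\<open>ito_integral\<close> prescribes limits in probability only, and these carry no
  moments. The mean square estimate at a random time is therefore built by hand: independence of
  Brownian increments bounds sums over deterministic grids, and Fatou passes the bound to the limit.
  The obstacle is that \<open>\<sigma>\<close> is close to \<open>\<sigma> x\<close> only up to
  \<open>\<tau>\<close>, so the approximating sums must be cut off there without looking ahead. The
  expected gain is evaluated at \<open>W h\<close>, at the deterministic time h where the law is
  explicit, and not at \<open>\<tau>\<close>. The two times differ only if the path leaves the ball
  early; this has probability O(h) by Chebyshev, and on that event it is enough that the gain is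
  nonnegative. Neither Tanaka's formula nor local time enters. The constants are fixed in the order
  \<open>\<epsilon>\<close>, radius, coefficient of h, and h last: \<open>\<epsilon>\<close> spends
  half of the expected kink, the terms of order h less than the other half.\<close>

lemma le_one_plus_square: "x \<le> 1 + x\<^sup>2" for x :: real
  using zero_le_power2[of "x - 1"] zero_le_power2[of x]
  unfolding power2_diff power_one by linarith

text \<open>The law of a Brownian increment over unit time, with the density from
  \<open>brownian_motion\<close>; increments over other times are scaled copies of it.\<close>

definition std_gaussian :: "(real^2) measure" where
  "std_gaussian = density lborel (\<lambda>z. ennreal (\<Prod>i\<in>UNIV. std_normal_density (z $ i)))"

lemma sets_std_gaussian [measurable_cong, simp]: "sets std_gaussian = sets borel"
  and space_std_gaussian [simp]: "space std_gaussian = UNIV"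
  by (simp_all add: std_gaussian_def)

text \<open>Tonelli in coordinates. \<open>nn_integral_lborel_prod\<close> is indexed by
  \<open>Basis\<close>, which here is the image of the index type under the injection i ->
  \<open>axis i 1\<close>; the product is reindexed along it.\<close>

lemma nn_integral_lborel_vec2:
  fixes f :: "2 \<Rightarrow> real \<Rightarrow> ennreal"
  assumes [measurable]: "\<And>i. f i \<in> borel_measurable borel"
  shows "(\<integral>\<^sup>+z. (\<Prod>i\<in>UNIV. f i ((z::real^2) $ i)) \<partial>lborel) = (\<Prod>i\<in>UNIV. \<integral>\<^sup>+x. f i x \<partial>lborel)"
proof -
  define e where "e = (\<lambda>i::2. axis i (1::real))"
  have inj: "inj e"
    by (auto simp: e_def inj_on_def axis_eq_axis)
  have Basis: "Basis = e ` UNIV"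
    by (auto simp: e_def Basis_vec_def)
  have inv: "inv e (e i) = i" for i
    using inj by simp
  have "(\<integral>\<^sup>+z. (\<Prod>b\<in>Basis. f (inv e b) (z \<bullet> b)) \<partial>lborel) = (\<Prod>b\<in>Basis. \<integral>\<^sup>+x. f (inv e b) x \<partial>lborel)"
    by (rule nn_integral_lborel_prod) auto
  then show ?thesis
    by (simp add: Basis prod.reindex inj inv) (simp add: e_def inner_axis)
qed

lemma nn_integral_std_gaussian_prod:
  fixes f :: "2 \<Rightarrow> real \<Rightarrow> ennreal"
  assumes [measurable]: "\<And>i. f i \<in> borel_measurable borel"
  shows "(\<integral>\<^sup>+z. (\<Prod>i\<in>UNIV. f i (z $ i)) \<partial>std_gaussian)
    = (\<Prod>i\<in>UNIV. \<integral>\<^sup>+x. std_normal_density x * f i x \<partial>lborel)"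
proof -
  have "(\<integral>\<^sup>+z. (\<Prod>i\<in>UNIV. f i (z $ i)) \<partial>std_gaussian)
     = (\<integral>\<^sup>+z. (\<Prod>i\<in>UNIV. std_normal_density (z $ i) * f i (z $ i)) \<partial>lborel)"
    unfolding std_gaussian_def
    by (subst nn_integral_density) (auto simp: prod.distrib prod_ennreal)
  also have "\<dots> = (\<Prod>i\<in>UNIV. \<integral>\<^sup>+x. std_normal_density x * f i x \<partial>lborel)"
    by (rule nn_integral_lborel_vec2) auto
  finally show ?thesis .
qed

lemma nn_integral_std_normal_density: "(\<integral>\<^sup>+x. ennreal (std_normal_density x) \<partial>lborel) = 1"
  by (subst nn_integral_eq_integral) auto

lemma nn_integral_std_normal_second_moment:
  "(\<integral>\<^sup>+x. ennreal (std_normal_density x) * ennreal (x\<^sup>2) \<partial>lborel) = 1"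
proof -
  have "has_bochner_integral lborel (\<lambda>x. std_normal_density x * x\<^sup>2) 1"
    using std_normal_moment_even[of 1] by simp
  then show ?thesis
    by (subst ennreal_mult[symmetric])
       (auto simp: has_bochner_integral_iff nn_integral_eq_integral)
qed

lemma prob_space_std_gaussian: "prob_space std_gaussian"
proof
  show "emeasure std_gaussian (space std_gaussian) = 1"
    using nn_integral_std_gaussian_prod[of "\<lambda>_ _. 1"]
    by (simp add: nn_integral_std_normal_density)
qed

lemma norm_vec2_sq: "(norm (z::real^2))\<^sup>2 = (z$1)\<^sup>2 + (z$2)\<^sup>2"
  by (simp add: norm_vec_def L2_set_def UNIV_2)

lemma std_gaussian_norm_sq:
  "has_bochner_integral std_gaussian (\<lambda>z. (norm z)\<^sup>2) 2"
proof -
  have one: "(\<integral>\<^sup>+z. ennreal ((z $ k)\<^sup>2) \<partial>std_gaussian) = 1" for k :: 2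
  proof -
    \<comment> \<open>One squared coordinate is a product whose other factor is 1, so the product
      formula yields a second moment times a total mass.\<close>
    have "(\<integral>\<^sup>+z. (\<Prod>i\<in>UNIV. (if i = k then \<lambda>x. ennreal (x\<^sup>2) else (\<lambda>x. 1)) (z $ i)) \<partial>std_gaussian)
        = (\<Prod>i\<in>UNIV. if i = k then \<integral>\<^sup>+x. std_normal_density x * ennreal (x\<^sup>2) \<partial>lborel
             else \<integral>\<^sup>+x. std_normal_density x * 1 \<partial>lborel)"
      by (subst nn_integral_std_gaussian_prod) (auto intro!: prod.cong)
    also have "\<dots> = 1"
      by (simp only: nn_integral_std_normal_second_moment mult_1_right nn_integral_std_normal_density) simp
    also have "(\<lambda>z::real^2. (\<Prod>i\<in>UNIV. (if i = k then \<lambda>x. ennreal (x\<^sup>2) else (\<lambda>x. 1)) (z $ i)))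
        = (\<lambda>z. ennreal ((z $ k)\<^sup>2))"
      by (auto simp: fun_eq_iff if_distrib if_distribR)
    finally show ?thesis .
  qed
  have "(\<integral>\<^sup>+z. ennreal ((norm z)\<^sup>2) \<partial>std_gaussian)
      = (\<integral>\<^sup>+z. ennreal ((z $ 1)\<^sup>2) + ennreal ((z $ 2)\<^sup>2) \<partial>std_gaussian)"
    by (intro nn_integral_cong) (simp add: norm_vec2_sq)
  also have "\<dots> = 1 + 1"
    by (subst nn_integral_add) (auto simp: one)
  finally show ?thesis
    by (intro has_bochner_integral_nn_integral) auto
qed

text \<open>The density is even, and \<open>lborel\<close> is invariant under the affine map with
  factor -1. This symmetry yields both the vanishing mean and the value of the expected
  gain.\<close>

lemma distr_std_gaussian_uminus: "distr std_gaussian borel uminus = std_gaussian"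
proof (rule measure_eqI)
  fix A assume "A \<in> sets (distr std_gaussian borel uminus)"
  then have A[measurable]: "A \<in> sets borel" by simp
  have refl: "std_normal_density (- x) = std_normal_density x" for x
    by (simp add: normal_density_def)
  have "(lborel :: (real^2) measure) = density (distr lborel borel (\<lambda>x. 0 + (-1) *\<^sub>R x)) (\<lambda>_. ennreal (\<bar>-1\<bar>^DIM(real^2)))"
    by (rule lborel_affine) simp
  then have lb: "(lborel :: (real^2) measure) = distr lborel borel uminus"
    by (simp add: density_1)
  have "emeasure std_gaussian A
     = (\<integral>\<^sup>+z. ennreal (\<Prod>i\<in>UNIV. std_normal_density (z $ i)) * indicator A z \<partial>lborel)"
    unfolding std_gaussian_def by (subst emeasure_density) auto
  also have "\<dots> = (\<integral>\<^sup>+z. ennreal (\<Prod>i\<in>UNIV. std_normal_density (z $ i)) * indicator (uminus -` A) z \<partial>lborel)"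
    by (subst lb, subst nn_integral_distr) (auto simp: refl indicator_def)
  also have "\<dots> = emeasure std_gaussian (uminus -` A)"
    unfolding std_gaussian_def
    by (subst emeasure_density) (auto simp: measurable_sets_borel[of uminus borel])
  also have "\<dots> = emeasure (distr std_gaussian borel uminus) A"
    by (subst emeasure_distr) auto
  finally show "emeasure (distr std_gaussian borel uminus) A = emeasure std_gaussian A" by simp
qed simp

text \<open>Symmetry makes the mean equal to its own negative; integrability comes from the second
  moment through x <= 1 + x^2.\<close>

lemma std_gaussian_mean_component:
  "integrable std_gaussian (\<lambda>z. z $ k)" "(\<integral>z. z $ k \<partial>std_gaussian) = 0"
proof -
  interpret prob_space std_gaussian by (rule prob_space_std_gaussian)
  have "integrable std_gaussian (\<lambda>z. 1 + (norm z)\<^sup>2)"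
    using std_gaussian_norm_sq by (auto simp: has_bochner_integral_iff)
  moreover have "\<bar>z $ k\<bar> \<le> 1 + (norm z)\<^sup>2" for z :: "real^2"
  proof -
    have "\<bar>z $ k\<bar> \<le> norm z" by (rule component_le_norm_cart)
    also have "\<dots> \<le> 1 + (norm z)\<^sup>2" by (rule le_one_plus_square)
    finally show ?thesis .
  qed
  ultimately show int: "integrable std_gaussian (\<lambda>z. z $ k)"
    by (intro Bochner_Integration.integrable_bound[of _ "\<lambda>z. 1 + (norm z)\<^sup>2" "\<lambda>z. z $ k"]) auto
  have "(\<integral>z. z $ k \<partial>std_gaussian) = (\<integral>z. z $ k \<partial>(distr std_gaussian borel uminus))"
    by (simp add: distr_std_gaussian_uminus)
  also have "\<dots> = - (\<integral>z. z $ k \<partial>std_gaussian)"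
    by (subst integral_distr) auto
  finally show "(\<integral>z. z $ k \<partial>std_gaussian) = 0" by simp
qed

text \<open>For positivity: the integrand vanishes only on a hyperplane, which is Lebesgue null,
  while the density is strictly positive. This turns non-degeneracy into a positive expected
  gain.\<close>

lemma std_gaussian_abs_inner:
  fixes v :: "real^2"
  shows "integrable std_gaussian (\<lambda>z. \<bar>v \<bullet> z\<bar>)"
    and "v \<noteq> 0 \<Longrightarrow> (\<integral>z. \<bar>v \<bullet> z\<bar> \<partial>std_gaussian) > 0"
proof -
  have "(\<lambda>z. v \<bullet> z) = (\<lambda>z. v$1 * z$1 + v$2 * z$2)"
    by (simp add: inner_vec_def UNIV_2)
  then show int: "integrable std_gaussian (\<lambda>z. \<bar>v \<bullet> z\<bar>)"
    using std_gaussian_mean_component by auto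
  assume v: "v \<noteq> 0"
  have "\<not> (AE z in std_gaussian. \<bar>v \<bullet> z\<bar> = 0)"
  proof
    assume "AE z in std_gaussian. \<bar>v \<bullet> z\<bar> = 0"
    then have "AE z in lborel. 0 < ennreal (\<Prod>i\<in>UNIV. std_normal_density (z $ i)) \<longrightarrow> v \<bullet> z = 0"
      unfolding std_gaussian_def by (subst (asm) AE_density) auto
    then have ae: "AE z in lborel. v \<bullet> z = 0"
      by eventually_elim (auto intro!: prod_pos normal_density_pos)
    have "negligible {z. v \<bullet> z = 0}"
      using v by (intro negligible_hyperplane) auto
    moreover have "{z. v \<bullet> z = 0} \<in> sets lborel"
      by simp
    ultimately have "{z. v \<bullet> z = 0} \<in> null_sets lborel"
      by (simp add: negligible_iff_null_sets null_sets_completion_iff)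
    then have "AE z in lborel. v \<bullet> z \<noteq> 0"
      by (auto dest: AE_not_in)
    with ae have "AE z in (lborel :: (real^2) measure). False"
      by eventually_elim auto
    then show False
      by (simp add: AE_iff_null null_sets_def)
  qed
  then have "(\<integral>z. \<bar>v \<bullet> z\<bar> \<partial>std_gaussian) \<noteq> 0"
    by (subst integral_nonneg_eq_0_iff_AE[OF int]) auto
  then show "(\<integral>z. \<bar>v \<bullet> z\<bar> \<partial>std_gaussian) > 0"
    by (metis Bochner_Integration.integral_nonneg abs_ge_zero less_le)
qed

text \<open>Substitution z -> sqrt d z in the plane: the Jacobian (sqrt d)^2 cancels the factors 1 /
  sqrt d of the two one-dimensional densities.\<close>

lemma gaussian_density_scale:
  assumes "d > 0"
  shows "density lborel (\<lambda>z. ennreal (\<Prod>i\<in>UNIV. normal_density 0 (sqrt d) ((z::real^2) $ i)))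
     = distr std_gaussian borel (\<lambda>z. sqrt d *\<^sub>R z)"
proof (rule measure_eqI)
  fix A assume "A \<in> sets (density lborel (\<lambda>z. ennreal (\<Prod>i\<in>UNIV. normal_density 0 (sqrt d) ((z::real^2) $ i))))"
  then have A[measurable]: "A \<in> sets borel" by simp
  let ?c = "sqrt d"
  have c: "?c > 0" using assms by simp
  have sc: "normal_density 0 ?c (?c * x) = std_normal_density x / ?c" for x
    using assms by (simp add: normal_density_def field_simps real_sqrt_mult)
  have lb: "(lborel :: (real^2) measure) = density (distr lborel borel (\<lambda>x. 0 + ?c *\<^sub>R x)) (\<lambda>_. \<bar>?c\<bar>^DIM(real^2))"
    by (rule lborel_affine) (use c in simp)
  have "emeasure (density lborel (\<lambda>z. ennreal (\<Prod>i\<in>UNIV. normal_density 0 ?c ((z::real^2) $ i)))) A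
     = (\<integral>\<^sup>+z. ennreal (\<Prod>i\<in>UNIV. normal_density 0 ?c (z $ i)) * indicator A z \<partial>lborel)"
    by (subst emeasure_density) auto
  also have "\<dots> = (\<integral>\<^sup>+z. \<bar>?c\<bar>^DIM(real^2) * (ennreal (\<Prod>i\<in>UNIV. normal_density 0 ?c ((?c *\<^sub>R z) $ i)) * indicator A (?c *\<^sub>R z)) \<partial>lborel)"
    by (subst lb, subst nn_integral_density) (auto simp: nn_integral_distr)
  also have "\<dots> = (\<integral>\<^sup>+z. ennreal (\<Prod>i\<in>UNIV. std_normal_density (z $ i)) * indicator ((\<lambda>z. ?c *\<^sub>R z) -` A) z \<partial>lborel)"
    using c assms
    by (intro nn_integral_cong)
       (auto simp: sc indicator_def UNIV_2 ennreal_mult[symmetric] power2_eq_square field_simps)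
  also have "\<dots> = emeasure std_gaussian ((\<lambda>z. ?c *\<^sub>R z) -` A)"
    unfolding std_gaussian_def
    by (subst emeasure_density) (auto simp: measurable_sets_borel[of "\<lambda>z. ?c *\<^sub>R z" borel])
  also have "\<dots> = emeasure (distr std_gaussian borel (\<lambda>z. ?c *\<^sub>R z)) A"
    by (subst emeasure_distr) auto
  finally show "emeasure (density lborel (\<lambda>z. ennreal (\<Prod>i\<in>UNIV. normal_density 0 (sqrt d) ((z::real^2) $ i)))) A
     = emeasure (distr std_gaussian borel (\<lambda>z. sqrt d *\<^sub>R z)) A" .
qed simp

section \<open>Brownian increments and martingale transforms\<close>

text \<open>The norm of a matrix is the Frobenius norm here, so Cauchy-Schwarz row by row gives the
  constant 1.\<close>

lemma norm_matrix_vector_mult_le: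
  fixes A :: "real^'n^'m" and x :: "real^'n"
  shows "norm (A *v x) \<le> norm A * norm x"
proof -
  have "norm (A *v x) = L2_set (\<lambda>i. \<bar>A $ i \<bullet> x\<bar>) UNIV"
    by (simp add: norm_vec_def matrix_vector_mult_def inner_vec_def)
  also have "\<dots> \<le> L2_set (\<lambda>i. norm (A $ i) * norm x) UNIV"
    by (intro L2_set_mono Cauchy_Schwarz_ineq2) auto
  also have "\<dots> = norm A * norm x"
    by (simp add: L2_set_left_distrib[symmetric] norm_vec_def)
  finally show ?thesis .
qed

lemma bounded_bilinear_matrix_vector_mult:
  "bounded_bilinear ((*v) :: real^'n^'m \<Rightarrow> real^'n \<Rightarrow> real^'m)"
proof
  show "\<exists>K. \<forall>a b. norm ((a :: real^'n^'m) *v b) \<le> norm a * norm b * K"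
    by (rule exI[of _ 1]) (simp add: norm_matrix_vector_mult_le)
qed (auto simp: matrix_vector_mult_add_rdistrib matrix_vector_right_distrib scaleR_matrix_vector_assoc
      matrix_vector_mult_scaleR)

lemma borel_measurable_matrix_vector_mult [measurable (raw)]:
  fixes f :: "'a \<Rightarrow> real^'n^'m"
  assumes "f \<in> borel_measurable N" "g \<in> borel_measurable N"
  shows "(\<lambda>\<omega>. f \<omega> *v g \<omega>) \<in> borel_measurable N"
  using assms
  by (rule borel_measurable_continuous_Pair)
     (intro bounded_bilinear.continuous_on[OF bounded_bilinear_matrix_vector_mult] continuous_intros)

lemma borel_measurable_vec_nth [measurable (raw)]:
  fixes f :: "'a \<Rightarrow> ('b::topological_space)^'n"
  assumes "f \<in> borel_measurable N"
  shows "(\<lambda>\<omega>. f \<omega> $ i) \<in> borel_measurable N"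
  by (rule measurable_compose[OF assms borel_measurable_continuous_onI]) (intro continuous_intros)

lemma norm_add_sq: "(norm (a + b))\<^sup>2 = (norm a)\<^sup>2 + 2 * (a \<bullet> b) + (norm b)\<^sup>2" for a b :: "'b::real_inner"
  unfolding power2_norm_eq_inner by (simp add: inner_add_left inner_add_right inner_commute)

locale filtered_brownian_motion =
  fixes M :: "'a measure" and F :: "ennreal \<Rightarrow> 'a measure" and W :: "real \<Rightarrow> 'a \<Rightarrow> real^2"
  assumes usual: "usual_conditions M F" and brownian: "brownian_motion M F W"

sublocale filtered_brownian_motion \<subseteq> prob_space M
  using usual by (simp add: usual_conditions_def)

context filtered_brownian_motion
begin

lemma space_F: "space (F t) = space M"
  using usual by (auto simp: usual_conditions_def filtration_def)

lemma subalgebra_F: "subalgebra M (F t)"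
  using usual by (auto simp: usual_conditions_def subalgebra_def space_F)

lemma sets_F_mono: "s \<le> t \<Longrightarrow> sets (F s) \<subseteq> sets (F t)"
  using usual by (auto simp: usual_conditions_def filtration_def)

lemma subalgebra_F_mono: "s \<le> t \<Longrightarrow> subalgebra (F t) (F s)"
  by (auto simp: subalgebra_def space_F dest: sets_F_mono)

lemma measurable_F_M: "f \<in> measurable (F t) N \<Longrightarrow> f \<in> measurable M N"
  by (rule measurable_from_subalg[OF subalgebra_F])

lemma measurable_F_mono: "s \<le> t \<Longrightarrow> f \<in> measurable (F s) N \<Longrightarrow> f \<in> measurable (F t) N"
  by (rule measurable_from_subalg[OF subalgebra_F_mono])

lemma adapted_measurable: "adapted F Y \<Longrightarrow> 0 \<le> t \<Longrightarrow> Y t \<in> borel_measurable (F (ennreal t))"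
  by (simp add: adapted_def)

lemma adapted_measurable_M: "adapted F Y \<Longrightarrow> 0 \<le> t \<Longrightarrow> Y t \<in> borel_measurable M"
  by (rule measurable_F_M[OF adapted_measurable])

lemma W_adapted: "adapted F W" and W_paths: "continuous_paths M W"
  and W_0: "\<omega> \<in> space M \<Longrightarrow> W 0 \<omega> = 0"
  using brownian by (auto simp: brownian_motion_def)

lemma W_measurable [measurable]: "0 \<le> t \<Longrightarrow> W t \<in> borel_measurable M"
  by (rule adapted_measurable_M[OF W_adapted])

lemma distr_increment:
  assumes "0 \<le> s" "s < t"
  shows "distr M borel (\<lambda>\<omega>. W t \<omega> - W s \<omega>) = distr std_gaussian borel (\<lambda>z. sqrt (t - s) *\<^sub>R z)"
proof -
  have "distributed M lborel (\<lambda>\<omega>. W t \<omega> - W s \<omega>)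
      (\<lambda>z. ennreal (\<Prod>i\<in>UNIV. normal_density 0 (sqrt (t - s)) (z $ i)))"
    using brownian assms unfolding brownian_motion_def by blast
  then have "distr M lborel (\<lambda>\<omega>. W t \<omega> - W s \<omega>)
      = density lborel (\<lambda>z. ennreal (\<Prod>i\<in>UNIV. normal_density 0 (sqrt (t - s)) (z $ i)))"
    by (simp add: distributed_def)
  also have "distr M lborel (\<lambda>\<omega>. W t \<omega> - W s \<omega>) = distr M borel (\<lambda>\<omega>. W t \<omega> - W s \<omega>)"
    by (intro distr_cong) auto
  finally show ?thesis
    using assms by (simp add: gaussian_density_scale)
qed

lemma
  fixes f :: "real^2 \<Rightarrow> real"
  assumes "0 \<le> s" "s < t" and [measurable]: "f \<in> borel_measurable borel"
  shows integrable_increment_iff: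
      "integrable M (\<lambda>\<omega>. f (W t \<omega> - W s \<omega>)) \<longleftrightarrow> integrable std_gaussian (\<lambda>z. f (sqrt (t - s) *\<^sub>R z))"
    and integral_increment:
      "(\<integral>\<omega>. f (W t \<omega> - W s \<omega>) \<partial>M) = (\<integral>z. f (sqrt (t - s) *\<^sub>R z) \<partial>std_gaussian)"
proof -
  have [measurable]: "(\<lambda>\<omega>. W t \<omega> - W s \<omega>) \<in> borel_measurable M"
    using assms by auto
  have 1: "integrable (distr M borel (\<lambda>\<omega>. W t \<omega> - W s \<omega>)) f
     \<longleftrightarrow> integrable (distr std_gaussian borel (\<lambda>z. sqrt (t - s) *\<^sub>R z)) f"
    and 2: "integral\<^sup>L (distr M borel (\<lambda>\<omega>. W t \<omega> - W s \<omega>)) f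
     = integral\<^sup>L (distr std_gaussian borel (\<lambda>z. sqrt (t - s) *\<^sub>R z)) f"
    by (simp_all add: distr_increment[OF assms(1,2)])
  show "integrable M (\<lambda>\<omega>. f (W t \<omega> - W s \<omega>)) \<longleftrightarrow> integrable std_gaussian (\<lambda>z. f (sqrt (t - s) *\<^sub>R z))"
    using 1 by (subst (asm) (1 2) integrable_distr_eq) auto
  show "(\<integral>\<omega>. f (W t \<omega> - W s \<omega>) \<partial>M) = (\<integral>z. f (sqrt (t - s) *\<^sub>R z) \<partial>std_gaussian)"
    using 2 by (subst (asm) (1 2) integral_distr) auto
qed

lemma increment_norm_sq:
  assumes "0 \<le> s" "s \<le> t"
  shows "has_bochner_integral M (\<lambda>\<omega>. (norm (W t \<omega> - W s \<omega>))\<^sup>2) (2 * (t - s))"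
\<comment> \<open>\<open>brownian_motion\<close> prescribes the law for s < t only, so equal times
  are treated apart.\<close>
proof (cases "s = t")
  case False
  then have st: "s < t" using assms by simp
  show ?thesis
    using std_gaussian_norm_sq st
      integrable_increment_iff[OF assms(1) st, of "\<lambda>z. (norm z)\<^sup>2"]
      integral_increment[OF assms(1) st, of "\<lambda>z. (norm z)\<^sup>2"]
    by (auto simp: has_bochner_integral_iff power_mult_distrib)
qed (simp add: has_bochner_integral_zero)

lemma increment_mean:
  assumes "0 \<le> s" "s \<le> t"
  shows "has_bochner_integral M (\<lambda>\<omega>. (W t \<omega> - W s \<omega>) $ k) 0"
proof (cases "s = t")
  case False
  then have st: "s < t" using assms by simp
  show ?thesis
    using std_gaussian_mean_component[of k]
      integrable_increment_iff[OF assms(1) st, of "\<lambda>z. z $ k"]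
      integral_increment[OF assms(1) st, of "\<lambda>z. z $ k"]
    by (auto simp: has_bochner_integral_iff)
qed (simp add: has_bochner_integral_zero)

text \<open>Preimages under \<open>Y\<close> lie in \<open>F s\<close>, and preimages under f of the
  increment are preimages under the increment itself; so the assumed independence covers the
  generators, which are stable under intersection and pass it on to the generated
  sigma-algebras.\<close>

lemma indep_var_increment:
  fixes Y :: "'a \<Rightarrow> real" and f :: "real^2 \<Rightarrow> real"
  assumes st: "0 \<le> s" "s < t" and Y: "Y \<in> borel_measurable (F (ennreal s))"
    and f[measurable]: "f \<in> borel_measurable borel"
  shows "indep_var borel Y borel (\<lambda>\<omega>. f (W t \<omega> - W s \<omega>))"
proof -
  let ?D = "\<lambda>\<omega>. W t \<omega> - W s \<omega>"
  let ?B = "{?D -` B \<inter> space M | B. B \<in> sets borel}"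
  have [measurable]: "?D \<in> borel_measurable M"
    using st by auto
  have YM[measurable]: "Y \<in> borel_measurable M"
    using Y by (rule measurable_F_M)
  have ind: "indep_set (sets (F (ennreal s))) ?B"
    using brownian st unfolding brownian_motion_def by blast
  have "indep_set {Y -` A \<inter> space M | A. A \<in> sets borel} {(\<lambda>\<omega>. f (?D \<omega>)) -` A \<inter> space M | A. A \<in> sets borel}"
  proof (rule indep_setI)
    fix a b
    assume "a \<in> {Y -` A \<inter> space M | A. A \<in> sets borel}"
      and "b \<in> {(\<lambda>\<omega>. f (?D \<omega>)) -` A \<inter> space M | A. A \<in> sets borel}"
    then obtain A A' where A: "A \<in> sets borel" "a = Y -` A \<inter> space M"
      and A': "A' \<in> sets borel" "b = (\<lambda>\<omega>. f (?D \<omega>)) -` A' \<inter> space M"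
      by blast
    have "a \<in> sets (F (ennreal s))"
      using measurable_sets[OF Y A(1)] A(2) by (simp add: space_F)
    moreover have "f -` A' \<in> sets borel"
      using measurable_sets[OF f A'(1)] by simp
    then have "b \<in> ?B"
      unfolding A'(2) by (intro CollectI exI[of _ "f -` A'"]) auto
    ultimately show "prob (a \<inter> b) = prob a * prob b"
      using indep_setD[OF ind] by blast
  qed (auto intro!: measurable_sets)
  then have "indep_set (sigma_sets (space M) {Y -` A \<inter> space M | A. A \<in> sets borel})
     (sigma_sets (space M) {(\<lambda>\<omega>. f (?D \<omega>)) -` A \<inter> space M | A. A \<in> sets borel})"
  proof (rule indep_set_sigma_sets)
    have st_gen: "Int_stable {h -` A \<inter> space M | A. A \<in> sets borel}" for h :: "'a \<Rightarrow> real"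
    proof (rule Int_stableI)
      fix a b assume "a \<in> {h -` A \<inter> space M | A. A \<in> sets borel}" "b \<in> {h -` A \<inter> space M | A. A \<in> sets borel}"
      then obtain A B where "A \<in> sets borel" "B \<in> sets borel" "a = h -` A \<inter> space M" "b = h -` B \<inter> space M"
        by blast
      then show "a \<inter> b \<in> {h -` A \<inter> space M | A. A \<in> sets borel}"
        by (intro CollectI exI[of _ "A \<inter> B"]) auto
    qed
    show "Int_stable {Y -` A \<inter> space M | A. A \<in> sets borel}"
      "Int_stable {(\<lambda>\<omega>. f (?D \<omega>)) -` A \<inter> space M | A. A \<in> sets borel}"
      by (rule st_gen)+
  qed
  then show ?thesis
    unfolding indep_var_eq by auto
qed

text \<open>All orthogonality below rests on this factorization: with \<open>I = 0\<close> it
  removes cross terms, with \<open>I = 2 * (t - s)\<close> it evaluates quadratic ones.\<close>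

lemma integral_mult_increment:
  fixes Y :: "'a \<Rightarrow> real" and f :: "real^2 \<Rightarrow> real"
  assumes st: "0 \<le> s" "s < t" and Y: "Y \<in> borel_measurable (F (ennreal s))" "integrable M Y"
    and f: "f \<in> borel_measurable borel" "has_bochner_integral M (\<lambda>\<omega>. f (W t \<omega> - W s \<omega>)) I"
  shows "has_bochner_integral M (\<lambda>\<omega>. Y \<omega> * f (W t \<omega> - W s \<omega>)) ((\<integral>\<omega>. Y \<omega> \<partial>M) * I)"
  using indep_var_integrable[OF indep_var_increment[OF st Y(1) f(1)] Y(2)]
    indep_var_lebesgue_integral[OF indep_var_increment[OF st Y(1) f(1)] Y(2)] f(2)
  by (auto simp: has_bochner_integral_iff)

lemma integrable_norm_of_norm_sq:
  fixes f :: "'a \<Rightarrow> 'b::{banach, second_countable_topology}"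
  assumes [measurable]: "f \<in> borel_measurable M" and "integrable M (\<lambda>\<omega>. (norm (f \<omega>))\<^sup>2)"
  shows "integrable M f"
proof (rule Bochner_Integration.integrable_bound[of _ "\<lambda>\<omega>. 1 + (norm (f \<omega>))\<^sup>2"])
  show "AE \<omega> in M. norm (f \<omega>) \<le> norm (1 + (norm (f \<omega>))\<^sup>2)"
    using le_one_plus_square[of "norm (f _)"] by (intro AE_I2) simp
qed (use assms in auto)

text \<open>Pythagoras: the new increment is centred and independent of \<open>F s\<close>, so the
  cross term has mean 0. The quadratic term is estimated by the Frobenius norm; this gives the
  factor \<open>2 * (t - s)\<close>, where the exact isometry would have
  \<open>t - s\<close>.\<close>

lemma martingale_transform_step:
  fixes S :: "'a \<Rightarrow> real^2" and \<eta> :: "'a \<Rightarrow> real^2^2"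
  assumes st: "0 \<le> s" "s \<le> t"
    and S: "S \<in> borel_measurable (F (ennreal s))" "integrable M (\<lambda>\<omega>. (norm (S \<omega>))\<^sup>2)"
    and \<eta>: "\<eta> \<in> borel_measurable (F (ennreal s))" "bounded (\<eta> ` space M)"
  defines "S' \<equiv> \<lambda>\<omega>. S \<omega> + \<eta> \<omega> *v (W t \<omega> - W s \<omega>)"
  shows "S' \<in> borel_measurable (F (ennreal t))"
    and "integrable M (\<lambda>\<omega>. (norm (S' \<omega>))\<^sup>2)"
    and "(\<integral>\<omega>. (norm (S' \<omega>))\<^sup>2 \<partial>M) \<le> (\<integral>\<omega>. (norm (S \<omega>))\<^sup>2 \<partial>M) + (\<integral>\<omega>. 2 * (t - s) * (norm (\<eta> \<omega>))\<^sup>2 \<partial>M)"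
proof -
  let ?D = "\<lambda>\<omega>. W t \<omega> - W s \<omega>"
  have le: "ennreal s \<le> ennreal t" using st by simp
  have m: "?D \<in> borel_measurable (F (ennreal t))"
    using st by (intro borel_measurable_diff measurable_F_mono[OF le] adapted_measurable[OF W_adapted]
        adapted_measurable[OF W_adapted, of t]) auto
  show meas: "S' \<in> borel_measurable (F (ennreal t))"
    unfolding S'_def
    by (intro borel_measurable_add borel_measurable_matrix_vector_mult measurable_F_mono[OF le] S(1) \<eta>(1) m)
  have Sm[measurable]: "S \<in> borel_measurable M" and \<eta>m[measurable]: "\<eta> \<in> borel_measurable M"
    and S'm[measurable]: "S' \<in> borel_measurable M" and Dm[measurable]: "?D \<in> borel_measurable M"
    using S(1) \<eta>(1) meas m by (auto intro: measurable_F_M)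
  obtain B where B: "\<And>\<omega>. \<omega> \<in> space M \<Longrightarrow> norm (\<eta> \<omega>) \<le> B"
    using \<eta>(2) by (auto simp: bounded_iff)
  have \<eta>_int: "integrable M (\<lambda>\<omega>. (norm (\<eta> \<omega>))\<^sup>2)"
  proof (rule integrable_const_bound[of _ "B\<^sup>2"])
    show "AE \<omega> in M. norm ((norm (\<eta> \<omega>))\<^sup>2) \<le> B\<^sup>2"
      using B by (auto intro!: power_mono)
  qed simp
  have sq: "(norm (S' \<omega>))\<^sup>2 = (norm (S \<omega>))\<^sup>2 + 2 * (S \<omega> \<bullet> (\<eta> \<omega> *v ?D \<omega>)) + (norm (\<eta> \<omega> *v ?D \<omega>))\<^sup>2" for \<omega>
    unfolding S'_def by (rule norm_add_sq)
  consider "s = t" | "s < t" using st by linarith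
  then have main: "integrable M (\<lambda>\<omega>. (norm (S' \<omega>))\<^sup>2) \<and>
    (\<integral>\<omega>. (norm (S' \<omega>))\<^sup>2 \<partial>M) \<le> (\<integral>\<omega>. (norm (S \<omega>))\<^sup>2 \<partial>M) + (\<integral>\<omega>. 2 * (t - s) * (norm (\<eta> \<omega>))\<^sup>2 \<partial>M)"
  proof cases
    case 1
    then show ?thesis using S(2) by (simp add: S'_def)
  next
    case 2
    \<comment> \<open>Entry k of the transpose of \<open>\<eta>\<close> applied to \<open>S\<close>.
      With it the cross term is linear in the increment, with coefficients known at time s; they are
      integrable because \<open>S\<close> is square integrable and \<open>\<eta>\<close>
      bounded.\<close>
    define c where "c k \<omega> = (\<Sum>i\<in>UNIV. S \<omega> $ i * \<eta> \<omega> $ i $ k)" for k \<omega>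
    have inner_eq: "S \<omega> \<bullet> (\<eta> \<omega> *v ?D \<omega>) = (\<Sum>k\<in>UNIV. c k \<omega> * ?D \<omega> $ k)" for \<omega>
      unfolding c_def inner_vec_def matrix_vector_mult_def
      by (simp add: sum_distrib_left sum_distrib_right UNIV_2 algebra_simps)
    have cm: "c k \<in> borel_measurable (F (ennreal s))" for k
      unfolding c_def using S(1) \<eta>(1) by (auto intro!: borel_measurable_sum borel_measurable_times borel_measurable_vec_nth)
    have S_int: "integrable M S"
      by (rule integrable_norm_of_norm_sq[OF Sm S(2)])
    have c_int: "integrable M (c k)" for k
    proof -
      have "integrable M (\<lambda>\<omega>. S \<omega> $ i * \<eta> \<omega> $ i $ k)" for i
      proof (rule Bochner_Integration.integrable_bound[of _ "\<lambda>\<omega>. norm (S \<omega>) * B"])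
        show "integrable M (\<lambda>\<omega>. norm (S \<omega>) * B)"
          using S_int by auto
        show "AE \<omega> in M. norm (S \<omega> $ i * \<eta> \<omega> $ i $ k) \<le> norm (norm (S \<omega>) * B)"
        proof (rule AE_I2)
          fix \<omega> assume \<omega>: "\<omega> \<in> space M"
          have "\<bar>\<eta> \<omega> $ i $ k\<bar> \<le> norm (\<eta> \<omega>)"
            using component_le_norm_cart[of "\<eta> \<omega> $ i" k] Finite_Cartesian_Product.norm_nth_le[of "\<eta> \<omega>" i] by linarith
          then have "\<bar>\<eta> \<omega> $ i $ k\<bar> \<le> \<bar>B\<bar>"
            using B[OF \<omega>] by linarith
          then have "\<bar>S \<omega> $ i\<bar> * \<bar>\<eta> \<omega> $ i $ k\<bar> \<le> norm (S \<omega>) * \<bar>B\<bar>"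
            by (intro mult_mono component_le_norm_cart) auto
          then show "norm (S \<omega> $ i * \<eta> \<omega> $ i $ k) \<le> norm (norm (S \<omega>) * B)"
            by (simp add: abs_mult)
        qed
      qed auto
      then show ?thesis unfolding c_def by auto
    qed
    have cross: "has_bochner_integral M (\<lambda>\<omega>. S \<omega> \<bullet> (\<eta> \<omega> *v ?D \<omega>)) 0"
    proof -
      have "has_bochner_integral M (\<lambda>\<omega>. c k \<omega> * ?D \<omega> $ k) 0" for k
        using integral_mult_increment[OF st(1) 2 cm c_int _ increment_mean[OF st]] by simp
      then have "has_bochner_integral M (\<lambda>\<omega>. \<Sum>k\<in>UNIV. c k \<omega> * ?D \<omega> $ k) (\<Sum>k\<in>(UNIV::2 set). 0)"
        by (intro has_bochner_integral_sum)
      then show ?thesis by (simp add: inner_eq)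
    qed
    have quad: "has_bochner_integral M (\<lambda>\<omega>. (norm (\<eta> \<omega>))\<^sup>2 * (norm (?D \<omega>))\<^sup>2)
        ((\<integral>\<omega>. (norm (\<eta> \<omega>))\<^sup>2 \<partial>M) * (2 * (t - s)))"
      using \<eta>(1) by (intro integral_mult_increment[OF st(1) 2 _ \<eta>_int] increment_norm_sq st) auto
    have le2: "(norm (\<eta> \<omega> *v ?D \<omega>))\<^sup>2 \<le> (norm (\<eta> \<omega>))\<^sup>2 * (norm (?D \<omega>))\<^sup>2" for \<omega>
      using power_mono[OF norm_matrix_vector_mult_le[of "\<eta> \<omega>" "?D \<omega>"] norm_ge_zero, of 2]
      by (simp add: power_mult_distrib)
    have int2: "integrable M (\<lambda>\<omega>. (norm (\<eta> \<omega> *v ?D \<omega>))\<^sup>2)"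
    proof (rule Bochner_Integration.integrable_bound)
      show "integrable M (\<lambda>\<omega>. (norm (\<eta> \<omega>))\<^sup>2 * (norm (?D \<omega>))\<^sup>2)"
        using quad by (simp add: has_bochner_integral_iff)
    qed (use le2 in auto)
    have "(\<integral>\<omega>. (norm (\<eta> \<omega> *v ?D \<omega>))\<^sup>2 \<partial>M) \<le> (\<integral>\<omega>. (norm (\<eta> \<omega>))\<^sup>2 * (norm (?D \<omega>))\<^sup>2 \<partial>M)"
      using quad le2 int2 by (intro integral_mono) (simp_all add: has_bochner_integral_iff)
    also have "\<dots> = (\<integral>\<omega>. (norm (\<eta> \<omega>))\<^sup>2 \<partial>M) * (2 * (t - s))"
      by (rule has_bochner_integral_integral_eq[OF quad])
    finally have le3: "(\<integral>\<omega>. (norm (\<eta> \<omega> *v ?D \<omega>))\<^sup>2 \<partial>M) \<le> (\<integral>\<omega>. (norm (\<eta> \<omega>))\<^sup>2 \<partial>M) * (2 * (t - s))" .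
    have "integrable M (\<lambda>\<omega>. (norm (S' \<omega>))\<^sup>2)"
      unfolding sq using S(2) cross int2 by (auto simp: has_bochner_integral_iff)
    moreover have "(\<integral>\<omega>. (norm (S' \<omega>))\<^sup>2 \<partial>M) =
       (\<integral>\<omega>. (norm (S \<omega>))\<^sup>2 \<partial>M) + (\<integral>\<omega>. (norm (\<eta> \<omega> *v ?D \<omega>))\<^sup>2 \<partial>M)"
      unfolding sq using S(2) cross int2 by (auto simp: has_bochner_integral_iff)
    ultimately show ?thesis
      using le3 by (simp add: mult.commute)
  qed
  then show "integrable M (\<lambda>\<omega>. (norm (S' \<omega>))\<^sup>2)"
    and "(\<integral>\<omega>. (norm (S' \<omega>))\<^sup>2 \<partial>M) \<le> (\<integral>\<omega>. (norm (S \<omega>))\<^sup>2 \<partial>M) + (\<integral>\<omega>. 2 * (t - s) * (norm (\<eta> \<omega>))\<^sup>2 \<partial>M)"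
    by auto
qed

text \<open>Pythagoras iterated: the induction keeps each partial sum measurable at its grid time,
  so the next step is orthogonal to it. The budget \<open>c\<close> bounds the accumulated squares
  path by path and hence in the mean; the factor 2 is that of the single step.\<close>

lemma martingale_transform_second_moment:
  fixes g :: "nat \<Rightarrow> real" and \<eta> :: "nat \<Rightarrow> 'a \<Rightarrow> real^2^2"
  assumes g: "0 \<le> g 0" "\<And>j. j < N \<Longrightarrow> g j \<le> g (Suc j)"
    and \<eta>: "\<And>j. j < N \<Longrightarrow> \<eta> j \<in> borel_measurable (F (ennreal (g j)))"
      "\<And>j. j < N \<Longrightarrow> bounded (\<eta> j ` space M)"
    and c: "\<And>\<omega>. \<omega> \<in> space M \<Longrightarrow> (\<Sum>j<N. (g (Suc j) - g j) * (norm (\<eta> j \<omega>))\<^sup>2) \<le> c"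
  defines "S \<equiv> \<lambda>i \<omega>. \<Sum>j<i. \<eta> j \<omega> *v (W (g (Suc j)) \<omega> - W (g j) \<omega>)"
  shows "S N \<in> borel_measurable M" "integrable M (\<lambda>\<omega>. (norm (S N \<omega>))\<^sup>2)"
    "(\<integral>\<omega>. (norm (S N \<omega>))\<^sup>2 \<partial>M) \<le> 2 * c"
proof -
  have g0: "0 \<le> g j" if "j \<le> N" for j
    using that
  proof (induction j)
    case (Suc j)
    then show ?case using g(2)[of j] by auto
  qed (use g in auto)
  have ind: "S i \<in> borel_measurable (F (ennreal (g i))) \<and> integrable M (\<lambda>\<omega>. (norm (S i \<omega>))\<^sup>2) \<and>
     (\<integral>\<omega>. (norm (S i \<omega>))\<^sup>2 \<partial>M) \<le> (\<Sum>j<i. \<integral>\<omega>. 2 * (g (Suc j) - g j) * (norm (\<eta> j \<omega>))\<^sup>2 \<partial>M)"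
    if "i \<le> N" for i
    using that
  proof (induction i)
    case 0
    then show ?case by (simp add: S_def)
  next
    case (Suc i)
    then have i: "i < N" by simp
    have S: "S (Suc i) = (\<lambda>\<omega>. S i \<omega> + \<eta> i \<omega> *v (W (g (Suc i)) \<omega> - W (g i) \<omega>))"
      by (simp add: S_def)
    from Suc have IH: "S i \<in> borel_measurable (F (ennreal (g i)))" "integrable M (\<lambda>\<omega>. (norm (S i \<omega>))\<^sup>2)"
     "(\<integral>\<omega>. (norm (S i \<omega>))\<^sup>2 \<partial>M) \<le> (\<Sum>j<i. \<integral>\<omega>. 2 * (g (Suc j) - g j) * (norm (\<eta> j \<omega>))\<^sup>2 \<partial>M)"
      by auto
    from martingale_transform_step[OF g0[of i] g(2)[OF i] IH(1,2) \<eta>(1)[OF i] \<eta>(2)[OF i]] IH(3) i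
    show ?case unfolding S by auto
  qed
  from ind[of N] show "S N \<in> borel_measurable M" "integrable M (\<lambda>\<omega>. (norm (S N \<omega>))\<^sup>2)"
    by (auto intro: measurable_F_M)
  have \<eta>int: "integrable M (\<lambda>\<omega>. 2 * (g (Suc j) - g j) * (norm (\<eta> j \<omega>))\<^sup>2)" if j: "j < N" for j
  proof -
    obtain B where B: "\<And>\<omega>. \<omega> \<in> space M \<Longrightarrow> norm (\<eta> j \<omega>) \<le> B"
      using \<eta>(2)[OF j] by (auto simp: bounded_iff)
    have [measurable]: "\<eta> j \<in> borel_measurable M"
      using \<eta>(1)[OF j] by (rule measurable_F_M)
    have "integrable M (\<lambda>\<omega>. (norm (\<eta> j \<omega>))\<^sup>2)"
    proof (rule integrable_const_bound[of _ "B\<^sup>2"])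
      show "AE \<omega> in M. norm ((norm (\<eta> j \<omega>))\<^sup>2) \<le> B\<^sup>2"
        using B by (auto intro!: power_mono)
    qed simp
    then show ?thesis by simp
  qed
  have "(\<integral>\<omega>. (norm (S N \<omega>))\<^sup>2 \<partial>M) \<le> (\<Sum>j<N. \<integral>\<omega>. 2 * (g (Suc j) - g j) * (norm (\<eta> j \<omega>))\<^sup>2 \<partial>M)"
    using ind[of N] by simp
  also have "\<dots> = (\<integral>\<omega>. (\<Sum>j<N. 2 * (g (Suc j) - g j) * (norm (\<eta> j \<omega>))\<^sup>2) \<partial>M)"
    using \<eta>int by (subst Bochner_Integration.integral_sum) auto
  also have "\<dots> \<le> (\<integral>\<omega>. 2 * c \<partial>M)"
  proof (rule integral_mono)
    show "(\<Sum>j<N. 2 * (g (Suc j) - g j) * (norm (\<eta> j \<omega>))\<^sup>2) \<le> 2 * c" if "\<omega> \<in> space M" for \<omega>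
      using mult_left_mono[OF c[OF that], of 2] by (simp only: sum_distrib_left mult.assoc)
  qed (use \<eta>int in auto)
  finally show "(\<integral>\<omega>. (norm (S N \<omega>))\<^sup>2 \<partial>M) \<le> 2 * c"
    by (simp add: prob_space)
qed

end

section \<open>Continuous paths and grids\<close>

text \<open>A strict excess is visible on a countable dense set of times, since a bound on that set
  extends to its closure. A weak excess is a strict excess of \<open>e - 1 / Suc n\<close> for every
  n, because the maximum over the compact interval is attained. The measure \<open>N\<close> is left
  open, as it will be \<open>M\<close> for deviations and \<open>F t\<close> for exit times.\<close>

lemma sets_path_exceeds:
  fixes Y :: "real \<Rightarrow> 'a \<Rightarrow> real"
  assumes Y: "\<And>t. t \<in> {0..T} \<Longrightarrow> Y t \<in> borel_measurable N"
    and cont: "\<And>\<omega>. \<omega> \<in> space N \<Longrightarrow> continuous_on {0..T} (\<lambda>t. Y t \<omega>)"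
  shows "{\<omega> \<in> space N. \<exists>u\<in>{0..T}. Y u \<omega> > e} \<in> sets N"
    and "{\<omega> \<in> space N. \<exists>u\<in>{0..T}. Y u \<omega> \<ge> e} \<in> sets N"
proof -
  obtain D where D: "countable D" "D \<subseteq> {0..T}" "{0..T} \<subseteq> closure D"
    by (rule separable)
  have gt: "{\<omega> \<in> space N. \<exists>u\<in>{0..T}. Y u \<omega> > e} \<in> sets N" for e
  proof -
    have "(\<exists>u\<in>{0..T}. Y u \<omega> > e) \<longleftrightarrow> (\<exists>u\<in>D. Y u \<omega> > e)" if \<omega>: "\<omega> \<in> space N" for \<omega>
    proof
      assume "\<exists>u\<in>{0..T}. Y u \<omega> > e"
      then obtain u where u: "u \<in> {0..T}" "Y u \<omega> > e" by blast
      show "\<exists>u\<in>D. Y u \<omega> > e"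
      proof (rule ccontr)
        assume "\<not> ?thesis"
        then have "(\<lambda>t. Y t \<omega>) ` D \<subseteq> {..e}" by (auto simp: not_less)
        moreover have "continuous_on (closure D) (\<lambda>t. Y t \<omega>)"
          using cont[OF \<omega>] closure_minimal[OF D(2)] by (auto intro: continuous_on_subset)
        ultimately have "(\<lambda>t. Y t \<omega>) ` closure D \<subseteq> {..e}"
          by (intro image_closure_subset) auto
        then show False using u D(3) by (auto simp: image_subset_iff subset_iff not_le[symmetric])
      qed
    qed (use D in auto)
    then have "{\<omega> \<in> space N. \<exists>u\<in>{0..T}. Y u \<omega> > e} = (\<Union>u\<in>D. {\<omega> \<in> space N. Y u \<omega> > e})"
      by auto
    also have "\<dots> \<in> sets N"
      using D Y by (intro sets.countable_UN'') auto
    finally show ?thesis .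
  qed
  show "{\<omega> \<in> space N. \<exists>u\<in>{0..T}. Y u \<omega> > e} \<in> sets N" by (rule gt)
  have "(\<exists>u\<in>{0..T}. Y u \<omega> \<ge> e) \<longleftrightarrow> (\<forall>n::nat. \<exists>u\<in>{0..T}. Y u \<omega> > e - 1 / Suc n)"
    if \<omega>: "\<omega> \<in> space N" for \<omega>
  proof
    assume "\<exists>u\<in>{0..T}. Y u \<omega> \<ge> e"
    then obtain u where "u \<in> {0..T}" "Y u \<omega> \<ge> e" by blast
    then have "Y u \<omega> > e - 1 / Suc n" for n
      by (smt (verit) of_nat_0_less_iff zero_less_Suc zero_less_divide_1_iff)
    then show "\<forall>n::nat. \<exists>u\<in>{0..T}. Y u \<omega> > e - 1 / Suc n"
      using \<open>u \<in> {0..T}\<close> by blast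
  next
    assume *: "\<forall>n::nat. \<exists>u\<in>{0..T}. Y u \<omega> > e - 1 / Suc n"
    then have "{0..T} \<noteq> {}" by auto
    then obtain v where v: "v \<in> {0..T}" "\<And>u. u \<in> {0..T} \<Longrightarrow> Y u \<omega> \<le> Y v \<omega>"
      using continuous_attains_sup[OF compact_Icc _ cont[OF \<omega>]] by blast
    have "Y v \<omega> \<ge> e"
    proof (rule ccontr)
      assume "\<not> e \<le> Y v \<omega>"
      then obtain n where "1 / Suc n < e - Y v \<omega>"
        using nat_approx_posE[of "e - Y v \<omega>"] by auto
      moreover obtain u where "u \<in> {0..T}" "Y u \<omega> > e - 1 / Suc n" using * by blast
      ultimately show False using v(2)[of u] by linarith
    qed
    then show "\<exists>u\<in>{0..T}. Y u \<omega> \<ge> e" using v by blast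
  qed
  then have "{\<omega> \<in> space N. \<exists>u\<in>{0..T}. Y u \<omega> \<ge> e}
     = {\<omega> \<in> space N. \<forall>n::nat. \<exists>u\<in>{0..T}. Y u \<omega> > e - 1 / Suc n}"
    by blast
  also have "\<dots> \<in> sets N"
    by (intro sets.sets_Collect_countable_All gt)
  finally show "{\<omega> \<in> space N. \<exists>u\<in>{0..T}. Y u \<omega> \<ge> e} \<in> sets N" .
qed

text \<open>Round the random time down to multiples of \<open>1 / Suc n\<close>. The rounded time
  has countably many values, and continuity of the path gives the limit.\<close>

lemma borel_measurable_path_at_random_time:
  fixes Y :: "real \<Rightarrow> 'a \<Rightarrow> 'b::metric_space"
  assumes Y: "\<And>t. 0 \<le> t \<Longrightarrow> Y t \<in> borel_measurable N"
    and cont: "\<And>\<omega>. \<omega> \<in> space N \<Longrightarrow> continuous_on {0..} (\<lambda>t. Y t \<omega>)"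
    and \<tau>[measurable]: "\<tau> \<in> borel_measurable N" and pos: "\<And>\<omega>. \<omega> \<in> space N \<Longrightarrow> 0 \<le> \<tau> \<omega>"
  shows "(\<lambda>\<omega>. Y (\<tau> \<omega>) \<omega>) \<in> borel_measurable N"
proof (rule borel_measurable_LIMSEQ_metric)
  define q where "q n x = nat \<lfloor>real (Suc n) * x\<rfloor>" for n and x :: real
  show "(\<lambda>\<omega>. Y (real (q n (\<tau> \<omega>)) / real (Suc n)) \<omega>) \<in> borel_measurable N" for n
  proof (rule measurable_compose_countable[where f="\<lambda>i \<omega>. Y (real i / real (Suc n)) \<omega>"])
    show "(\<lambda>\<omega>. Y (real i / real (Suc n)) \<omega>) \<in> borel_measurable N" for i :: nat
      by (intro Y) simp
    show "(\<lambda>\<omega>. q n (\<tau> \<omega>)) \<in> measurable N (count_space UNIV)"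
      unfolding q_def by measurable
  qed
  fix \<omega> assume \<omega>: "\<omega> \<in> space N"
  have "(\<lambda>n. real (q n (\<tau> \<omega>)) / real (Suc n)) \<longlonglongrightarrow> \<tau> \<omega>"
  proof (rule LIMSEQ_I)
    fix r :: real assume "r > 0"
    then obtain k where k: "1 / Suc k < r" using nat_approx_posE by blast
    show "\<exists>no. \<forall>n\<ge>no. norm (real (q n (\<tau> \<omega>)) / real (Suc n) - \<tau> \<omega>) < r"
    proof (intro exI allI impI)
      fix n assume "n \<ge> k"
      then have n: "1 / Suc n < r"
        using k by (meson Suc_le_mono frac_le le_less_trans of_nat_0_less_iff of_nat_le_iff order_refl zero_le_one zero_less_Suc)
      have "real (q n (\<tau> \<omega>)) = of_int \<lfloor>real (Suc n) * \<tau> \<omega>\<rfloor>"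
        using pos[OF \<omega>] by (simp add: q_def)
      then have "\<bar>real (q n (\<tau> \<omega>)) - real (Suc n) * \<tau> \<omega>\<bar> \<le> 1"
        by linarith
      then have "\<bar>real (q n (\<tau> \<omega>)) - real (Suc n) * \<tau> \<omega>\<bar> / real (Suc n) \<le> 1 / Suc n"
        by (intro divide_right_mono) auto
      moreover have "real (q n (\<tau> \<omega>)) / real (Suc n) - \<tau> \<omega> = (real (q n (\<tau> \<omega>)) - real (Suc n) * \<tau> \<omega>) / real (Suc n)"
        by (subst diff_divide_distrib) simp
      ultimately have "\<bar>real (q n (\<tau> \<omega>)) / real (Suc n) - \<tau> \<omega>\<bar> \<le> 1 / Suc n"
        by (simp only: abs_divide abs_of_nat)
      then show "norm (real (q n (\<tau> \<omega>)) / real (Suc n) - \<tau> \<omega>) < r"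
        using n by simp
    qed
  qed
  then show "(\<lambda>n. Y (real (q n (\<tau> \<omega>)) / real (Suc n)) \<omega>) \<longlonglongrightarrow> Y (\<tau> \<omega>) \<omega>"
    by (intro continuous_on_tendsto_compose[OF cont[OF \<omega>]]) (use pos[OF \<omega>] in auto)
qed

text \<open>The grid is the sorted list of 0, h, and those points of \<open>S\<close> and multiples
  of \<open>\<delta>\<close> that lie in [0, h]. No listed point lies strictly between neighbours,
  which yields both the mesh bound and the refinement of \<open>S\<close>, later the jump times of a
  simple integrand.\<close>

lemma fine_grid:
  fixes S :: "real set"
  assumes "finite S" "h > 0" "\<delta> > 0"
  obtains N and g :: "nat \<Rightarrow> real" where
    "g 0 = 0" "g N = h" "\<And>j. j < N \<Longrightarrow> g j < g (Suc j)" "\<And>j. j < N \<Longrightarrow> g (Suc j) \<le> g j + \<delta>"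
    "\<And>j s. j < N \<Longrightarrow> s \<in> S \<Longrightarrow> s \<le> g j \<or> g (Suc j) \<le> s"
proof -
  define P where "P = {0, h} \<union> ((S \<union> (\<lambda>i. real i * \<delta>) ` {..nat \<lceil>h / \<delta>\<rceil>}) \<inter> {0..h})"
  define xs where "xs = sorted_list_of_set P"
  define N where "N = length xs - 1"
  have fin: "finite P" using assms by (simp add: P_def)
  have set_xs: "set xs = P" using fin by (simp add: xs_def)
  have sorted: "sorted_wrt (<) xs" unfolding xs_def by (rule sorted_list_of_set.strict_sorted_key_list_of_set)
  have P: "p \<in> {0..h}" if "p \<in> P" for p using that assms by (auto simp: P_def)
  have "P \<noteq> {}" by (simp add: P_def)
  then have len: "length xs > 0" using set_xs by auto
  have mono: "xs ! i < xs ! j \<longleftrightarrow> i < j" if "i < length xs" "j < length xs" for i j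
    using sorted_wrt_nth_less[OF sorted] that by (metis less_asym linorder_neqE_nat less_irrefl)
  have gap: "p \<le> xs ! j \<or> xs ! Suc j \<le> p" if p: "p \<in> P" and j: "j < N" for p j
  proof -
    obtain i where i: "i < length xs" "xs ! i = p" using p set_xs by (metis in_set_conv_nth)
    show ?thesis
    proof (rule ccontr)
      assume "\<not> ?thesis"
      then have "xs ! j < xs ! i" "xs ! i < xs ! Suc j" using i by auto
      then have "j < i" "i < Suc j" using mono i j by (auto simp: N_def)
      then show False by simp
    qed
  qed
  have in_P: "xs ! i \<in> P" if "i < length xs" for i using that set_xs nth_mem by blast
  show ?thesis
  proof (rule that[of "(!) xs" N])
    obtain i where i: "i < length xs" "xs ! i = 0" using set_xs by (metis P_def UnI1 in_set_conv_nth insertI1)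
    then have "\<not> xs ! 0 > 0" using mono[OF i(1) len] by auto
    then show "xs ! 0 = 0" using P[OF in_P[OF len]] by auto
    obtain i where i: "i < length xs" "xs ! i = h"
      using set_xs by (metis P_def UnI1 in_set_conv_nth insertI1 insert_commute)
    have N: "N < length xs" using len by (simp add: N_def)
    have "\<not> xs ! N < xs ! i" using mono[OF N i(1)] i(1) by (auto simp: N_def)
    then show "xs ! N = h" using P[OF in_P[OF N]] i by auto
  next
    fix j assume j: "j < N"
    then have j': "j < length xs" "Suc j < length xs" by (auto simp: N_def)
    show lt: "xs ! j < xs ! Suc j" using mono[OF j'] by simp
    show "xs ! Suc j \<le> xs ! j + \<delta>"
    proof (rule ccontr)
      assume c: "\<not> ?thesis"
      \<comment> \<open>The first multiple of \<open>\<delta>\<close> strictly beyond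
        \<open>xs ! j\<close>. In a gap longer than \<open>\<delta>\<close> it would be a listed
        point strictly inside.\<close>
      define i where "i = nat \<lfloor>xs ! j / \<delta>\<rfloor> + 1"
      have pos: "0 \<le> xs ! j / \<delta>" using P[OF in_P[OF j'(1)]] assms by auto
      have "real i = of_int \<lfloor>xs ! j / \<delta>\<rfloor> + 1" using pos by (simp add: i_def)
      then have "xs ! j / \<delta> < real i" "real i \<le> xs ! j / \<delta> + 1" by linarith+
      then have i: "xs ! j < real i * \<delta>" "real i * \<delta> \<le> xs ! j + \<delta>"
        using assms by (auto simp: field_simps)
      have ih: "real i * \<delta> < h" using i c P[OF in_P[OF j'(2)]] by auto
      then have "real i \<le> h / \<delta>" using assms by (simp add: field_simps)
      then have "i \<le> nat \<lceil>h / \<delta>\<rceil>" by linarith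
      then have "real i * \<delta> \<in> P" using ih assms by (auto simp: P_def)
      from gap[OF this j] show False using i c by auto
    qed
    fix s assume s: "s \<in> S"
    show "s \<le> xs ! j \<or> xs ! Suc j \<le> s"
    proof (cases "s \<in> {0..h}")
      case True
      then show ?thesis using gap[OF _ j, of s] s by (auto simp: P_def)
    next
      case False
      then show ?thesis using P[OF in_P[OF j'(1)]] P[OF in_P[OF j'(2)]] by auto
    qed
  qed
qed

text \<open>The test for \<open>j\<close> includes the term \<open>a j\<close> itself. So at the
  last accepted index the full partial sum is at most \<open>c\<close>, and it dominates everything
  accepted so far.\<close>

lemma sum_truncated_le:
  fixes a :: "nat \<Rightarrow> real"
  assumes "\<And>j. 0 \<le> a j" "0 \<le> c"
  shows "(\<Sum>j<N. if P j \<and> (\<Sum>l\<le>j. a l) \<le> c then a j else 0) \<le> c"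
proof (induction N)
  case (Suc N)
  show ?case
  proof (cases "P N \<and> (\<Sum>l\<le>N. a l) \<le> c")
    case True
    have "(\<Sum>j<Suc N. if P j \<and> (\<Sum>l\<le>j. a l) \<le> c then a j else 0) \<le> (\<Sum>j<Suc N. a j)"
      using assms by (intro sum_mono) auto
    then show ?thesis using True by (simp add: lessThan_Suc_atMost)
  next
    case False
    then show ?thesis using Suc by auto
  qed
qed (use assms in simp)

text \<open>The constant value of the simple process on the cell (g j, g (Suc j)] of a grid that
  refines the jump times. The condition \<open>t k \<le> g j\<close> makes it known at the left end
  of the cell.\<close>

definition grid_coeff :: "nat \<Rightarrow> (nat \<Rightarrow> real) \<Rightarrow> (nat \<Rightarrow> 'a \<Rightarrow> real^2^2) \<Rightarrow> (nat \<Rightarrow> real) \<Rightarrow> nat \<Rightarrow> 'a \<Rightarrow> real^2^2" where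
  "grid_coeff m t \<xi> g j \<omega> = (\<Sum>k<m. if t k \<le> g j \<and> g (Suc j) \<le> t (Suc k) then \<xi> k \<omega> else 0)"

text \<open>A cell without a jump time in its interior lies either inside or outside each interval
  (t k, t (Suc k)], so every summand of the process and of the integral is all or nothing on
  it.\<close>

lemma
  assumes lt: "g j < g (Suc j)"
    and fine: "\<And>k. k \<le> m \<Longrightarrow> t k \<le> g j \<or> g (Suc j) \<le> t k"
  shows simple_process_on_grid:
      "g j < s \<Longrightarrow> s \<le> g (Suc j) \<Longrightarrow> simple_process m t \<xi> s \<omega> = grid_coeff m t \<xi> g j \<omega>"
    and simple_integral_on_grid:
      "(\<And>k. k < m \<Longrightarrow> t k \<le> t (Suc k)) \<Longrightarrow>
       simple_integral W m t \<xi> (g (Suc j)) \<omega> - simple_integral W m t \<xi> (g j) \<omega>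
         = grid_coeff m t \<xi> g j \<omega> *v (W (g (Suc j)) \<omega> - W (g j) \<omega>)"
proof -
  show "simple_process m t \<xi> s \<omega> = grid_coeff m t \<xi> g j \<omega>" if s: "g j < s" "s \<le> g (Suc j)"
    unfolding simple_process_def grid_coeff_def
  proof (rule sum.cong[OF refl])
    fix k assume "k \<in> {..<m}"
    then have "t k \<le> g j \<or> g (Suc j) \<le> t k" "t (Suc k) \<le> g j \<or> g (Suc j) \<le> t (Suc k)"
      using fine[of k] fine[of "Suc k"] by auto
    then have "t k < s \<and> s \<le> t (Suc k) \<longleftrightarrow> t k \<le> g j \<and> g (Suc j) \<le> t (Suc k)"
      using s by auto
    then show "(if t k < s \<and> s \<le> t (Suc k) then \<xi> k \<omega> else 0) =
        (if t k \<le> g j \<and> g (Suc j) \<le> t (Suc k) then \<xi> k \<omega> else 0)" by simp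
  qed
  assume t: "\<And>k. k < m \<Longrightarrow> t k \<le> t (Suc k)"
  have mv_diff: "A *v x - A *v y = A *v (x - y)" for A :: "real^2^2" and x y :: "real^2"
    by (simp add: matrix_vector_mult_diff_distrib)
  have mv_sum: "(\<Sum>k<m. B k) *v x = (\<Sum>k<m. B k *v x)" for B :: "nat \<Rightarrow> real^2^2" and x :: "real^2"
    by (rule bounded_bilinear.sum_left[OF bounded_bilinear_matrix_vector_mult])
  show "simple_integral W m t \<xi> (g (Suc j)) \<omega> - simple_integral W m t \<xi> (g j) \<omega>
         = grid_coeff m t \<xi> g j \<omega> *v (W (g (Suc j)) \<omega> - W (g j) \<omega>)"
    unfolding simple_integral_def grid_coeff_def mv_sum sum_subtractf[symmetric] mv_diff
  proof (rule sum.cong[OF refl])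
    fix k assume "k \<in> {..<m}"
    then have *: "t k \<le> g j \<or> g (Suc j) \<le> t k" "t (Suc k) \<le> g j \<or> g (Suc j) \<le> t (Suc k)" "t k \<le> t (Suc k)"
      using fine[of k] fine[of "Suc k"] t by auto
    have "W (min (g (Suc j)) (t (Suc k))) \<omega> - W (min (g (Suc j)) (t k)) \<omega>
         - (W (min (g j) (t (Suc k))) \<omega> - W (min (g j) (t k)) \<omega>)
       = (if t k \<le> g j \<and> g (Suc j) \<le> t (Suc k) then W (g (Suc j)) \<omega> - W (g j) \<omega> else 0)"
      using * lt by (auto simp: min_def)
    then show "\<xi> k \<omega> *v (W (min (g (Suc j)) (t (Suc k))) \<omega> - W (min (g (Suc j)) (t k)) \<omega>
         - (W (min (g j) (t (Suc k))) \<omega> - W (min (g j) (t k)) \<omega>))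
       = (if t k \<le> g j \<and> g (Suc j) \<le> t (Suc k) then \<xi> k \<omega> else 0) *v (W (g (Suc j)) \<omega> - W (g j) \<omega>)"
      by simp
  qed
qed

section \<open>Simple integrands on grids, and measurability of the events in the definition of the
  Ito integral\<close>

context filtered_brownian_motion
begin

lemma simple_integrand_times_nonneg:
  assumes "simple_integrand M F m t \<xi>" "k \<le> m"
  shows "0 \<le> t k"
  using assms(2)
proof (induction k)
  case (Suc k)
  then show ?case using assms(1) by (auto simp: simple_integrand_def intro: order_trans)
qed (use assms(1) in \<open>auto simp: simple_integrand_def\<close>)

lemma grid_coeff_measurable:
  assumes "simple_integrand M F m t \<xi>"
  shows "grid_coeff m t \<xi> g j \<in> borel_measurable (F (ennreal (g j)))"
proof -
  have "(\<lambda>\<omega>. if t k \<le> g j \<and> g (Suc j) \<le> t (Suc k) then \<xi> k \<omega> else 0) \<in> borel_measurable (F (ennreal (g j)))"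
    if "k < m" for k
  proof (cases "t k \<le> g j \<and> g (Suc j) \<le> t (Suc k)")
    case True
    then have "\<xi> k \<in> borel_measurable (F (ennreal (g j)))"
      using assms that unfolding simple_integrand_def by (meson measurable_F_mono ennreal_leI)
    then show ?thesis using True by simp
  qed auto
  then show ?thesis
    unfolding grid_coeff_def[abs_def] by (intro borel_measurable_sum) auto
qed

lemma grid_coeff_bounded:
  assumes "simple_integrand M F m t \<xi>"
  shows "\<exists>B. \<forall>\<omega>\<in>space M. norm (grid_coeff m t \<xi> g j \<omega>) \<le> B"
proof -
  have "\<exists>B. \<forall>\<omega>\<in>space M. norm (\<xi> k \<omega>) \<le> B" if "k < m" for k
    using assms that by (auto simp: simple_integrand_def bounded_iff)
  then obtain B where B: "\<And>k \<omega>. k < m \<Longrightarrow> \<omega> \<in> space M \<Longrightarrow> norm (\<xi> k \<omega>) \<le> B k"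
    by metis
  show ?thesis
  proof (intro exI ballI)
    fix \<omega> assume \<omega>: "\<omega> \<in> space M"
    show "norm (grid_coeff m t \<xi> g j \<omega>) \<le> (\<Sum>k<m. B k)"
      unfolding grid_coeff_def
    proof (rule sum_norm_le)
      fix k assume "k \<in> {..<m}"
      then have "norm (\<xi> k \<omega>) \<le> B k" using B \<omega> by simp
      moreover from this have "0 \<le> B k" using norm_ge_zero order_trans by blast
      ultimately show "norm (if t k \<le> g j \<and> g (Suc j) \<le> t (Suc k) then \<xi> k \<omega> else 0) \<le> B k"
        by simp
    qed
  qed
qed

lemma progressive_measurable:
  fixes H :: "real \<Rightarrow> 'a \<Rightarrow> 'b::topological_space"
  assumes "progressive F H" "0 \<le> T"
  shows "(\<lambda>(s, \<omega>). H s \<omega>) \<in> borel_measurable (restrict_space borel {0..T} \<Otimes>\<^sub>M M)"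
proof -
  have id: "(\<lambda>\<omega>. \<omega>) \<in> measurable M (F (ennreal T))"
    by (rule measurable_F_M[of _ "ennreal T"]) (rule measurable_ident_sets[OF refl])
  have "(\<lambda>p. (fst p, snd p)) \<in> measurable (restrict_space borel {0..T} \<Otimes>\<^sub>M M) (restrict_space borel {0..T} \<Otimes>\<^sub>M F (ennreal T))"
    by (intro measurable_Pair measurable_fst measurable_compose[OF measurable_snd id])
  moreover have "(\<lambda>(s, \<omega>). H s \<omega>) \<in> borel_measurable (restrict_space borel {0..T} \<Otimes>\<^sub>M F (ennreal T))"
    using assms by (simp add: progressive_def)
  ultimately show ?thesis
    by (rule measurable_compose[THEN measurable_cong[THEN iffD1, rotated]]) (simp add: case_prod_beta)
qed

lemma simple_process_measurable:
  assumes "simple_integrand M F m t \<xi>"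
  shows "(\<lambda>(s, \<omega>). simple_process m t \<xi> s \<omega>) \<in> borel_measurable (borel \<Otimes>\<^sub>M M)"
proof -
  have [measurable]: "\<xi> k \<in> borel_measurable M" if "k < m" for k
    using assms that by (auto simp: simple_integrand_def intro: measurable_F_M)
  show ?thesis
    unfolding simple_process_def case_prod_beta
    by (intro borel_measurable_sum) measurable
qed

lemma sq_deviation_measurable:
  assumes H: "progressive F H" and S: "simple_integrand M F m t \<xi>" and T: "0 \<le> T"
  shows "(\<lambda>(s, \<omega>). ennreal ((norm (simple_process m t \<xi> s \<omega> - H s \<omega>))\<^sup>2))
     \<in> borel_measurable (restrict_space borel {0..T} \<Otimes>\<^sub>M M)"
proof -
  have [measurable]: "(\<lambda>(s, \<omega>). H s \<omega>) \<in> borel_measurable (restrict_space borel {0..T} \<Otimes>\<^sub>M M)"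
    by (rule progressive_measurable[OF H T])
  have "(\<lambda>p. (fst p, snd p)) \<in> measurable (restrict_space borel {0..T} \<Otimes>\<^sub>M M) (borel \<Otimes>\<^sub>M M)"
    by (intro measurable_Pair measurable_snd measurable_compose[OF measurable_fst] measurable_restrict_space1) auto
  from measurable_compose[OF this simple_process_measurable[OF S]]
  have [measurable]: "(\<lambda>(s, \<omega>). simple_process m t \<xi> s \<omega>) \<in> borel_measurable (restrict_space borel {0..T} \<Otimes>\<^sub>M M)"
    by (simp add: case_prod_beta)
  show ?thesis by measurable
qed

text \<open>A non-measurable set would have \<open>measure\<close> 0 by convention, so the limits in
  \<open>ito_integral\<close> are informative only together with this fact. Progressive
  measurability lives on {0..T}, hence Tonelli is applied to Lebesgue measure restricted to that
  interval.\<close>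

lemma sets_sq_deviation:
  assumes H: "progressive F H" and S: "simple_integrand M F m t \<xi>" and T: "0 \<le> T"
  shows "{\<omega> \<in> space M. (\<integral>\<^sup>+ s\<in>{0..T}. ennreal ((norm (simple_process m t \<xi> s \<omega> - H s \<omega>))\<^sup>2) \<partial>lborel) > e} \<in> sets M"
proof -
  let ?f = "\<lambda>s \<omega>. ennreal ((norm (simple_process m t \<xi> s \<omega> - H s \<omega>))\<^sup>2)"
  let ?R = "restrict_space lborel {0..T}"
  interpret R: sigma_finite_measure ?R
    by (rule sigma_finite_measure_restrict_space) (auto intro: lborel.sigma_finite_measure_axioms)
  have s: "sets (restrict_space borel {0..T} \<Otimes>\<^sub>M M) = sets (?R \<Otimes>\<^sub>M M)"
    by (intro sets_pair_measure_cong sets_restrict_space_cong) auto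
  have "(\<lambda>(s, \<omega>). ?f s \<omega>) \<in> borel_measurable (?R \<Otimes>\<^sub>M M)"
    using sq_deviation_measurable[OF H S T] by (simp add: measurable_cong_sets[OF s refl])
  then have "(\<lambda>(\<omega>, s). ?f s \<omega>) \<in> borel_measurable (M \<Otimes>\<^sub>M ?R)"
    by (subst (asm) measurable_pair_swap_iff) (simp add: case_prod_beta)
  then have "(\<lambda>\<omega>. \<integral>\<^sup>+ s. ?f s \<omega> \<partial>?R) \<in> borel_measurable M"
    by (rule R.borel_measurable_nn_integral)
  then have [measurable]: "(\<lambda>\<omega>. \<integral>\<^sup>+ s\<in>{0..T}. ?f s \<omega> \<partial>lborel) \<in> borel_measurable M"
    by (simp add: nn_integral_restrict_space)
  show ?thesis by measurable
qed

lemma sq_deviation_section_measurable: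
  assumes H: "progressive F H" and S: "simple_integrand M F m t \<xi>" and T: "0 \<le> T" and \<omega>: "\<omega> \<in> space M"
  shows "(\<lambda>s. ennreal ((norm (simple_process m t \<xi> s \<omega> - H s \<omega>))\<^sup>2) * indicator {0..T} s) \<in> borel_measurable borel"
proof -
  have "(\<lambda>s. (s, \<omega>)) \<in> measurable (restrict_space borel {0..T}) (restrict_space borel {0..T} \<Otimes>\<^sub>M M)"
    using \<omega> by (intro measurable_Pair) auto
  from measurable_compose[OF this sq_deviation_measurable[OF H S T]]
  have "(\<lambda>s. ennreal ((norm (simple_process m t \<xi> s \<omega> - H s \<omega>))\<^sup>2)) \<in> borel_measurable (restrict_space borel {0..T})"
    by simp
  then show ?thesis
    by (subst (asm) borel_measurable_restrict_space_iff_ennreal) auto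
qed

lemma continuous_paths_on: "continuous_paths M Y \<Longrightarrow> \<omega> \<in> space M \<Longrightarrow> S \<subseteq> {0..} \<Longrightarrow> continuous_on S (\<lambda>t. Y t \<omega>)"
  unfolding continuous_paths_def by (auto intro: continuous_on_subset)

lemma simple_integral_measurable:
  assumes S: "simple_integrand M F m t \<xi>" and u: "0 \<le> u"
  shows "simple_integral W m t \<xi> u \<in> borel_measurable M"
proof -
  note t0 = simple_integrand_times_nonneg[OF S]
  have [measurable]: "\<xi> k \<in> borel_measurable M" if "k < m" for k
    using S that by (auto simp: simple_integrand_def intro: measurable_F_M)
  have W: "W (min u (t k)) \<in> borel_measurable M" if "k \<le> m" for k
    using t0[OF that] u by (intro W_measurable) auto
  show ?thesis
    unfolding simple_integral_def[abs_def]
    by (intro borel_measurable_sum borel_measurable_matrix_vector_mult borel_measurable_diff W) auto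
qed

lemma simple_integral_continuous:
  assumes S: "simple_integrand M F m t \<xi>" and \<omega>: "\<omega> \<in> space M"
  shows "continuous_on {0..} (\<lambda>u. simple_integral W m t \<xi> u \<omega>)"
proof -
  note t0 = simple_integrand_times_nonneg[OF S]
  have W: "continuous_on {0..} (\<lambda>u. W (min u (t k)) \<omega>)" if "k \<le> m" for k
    using t0[OF that]
    by (intro continuous_on_compose2[OF continuous_paths_on[OF W_paths \<omega> order_refl]] continuous_intros) auto
  show ?thesis
    unfolding simple_integral_def
    by (intro continuous_on_sum continuous_on_diff W
        bounded_bilinear.continuous_on[OF bounded_bilinear_matrix_vector_mult] continuous_on_const) auto
qed

text \<open>The same purpose for the second limit in \<open>ito_integral\<close>: path continuity
  reduces the uncountable union over u to a countable one.\<close>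

lemma sets_sup_deviation:
  assumes S: "simple_integrand M F m t \<xi>" and I: "adapted F I" "continuous_paths M I"
  shows "{\<omega> \<in> space M. \<exists>u\<in>{0..T}. norm (simple_integral W m t \<xi> u \<omega> - I u \<omega>) > e} \<in> sets M"
proof (rule sets_path_exceeds)
  show "(\<lambda>\<omega>. norm (simple_integral W m t \<xi> u \<omega> - I u \<omega>)) \<in> borel_measurable M" if "u \<in> {0..T}" for u
    using that simple_integral_measurable[OF S, of u] adapted_measurable_M[OF I(1), of u] by auto
  show "continuous_on {0..T} (\<lambda>u. norm (simple_integral W m t \<xi> u \<omega> - I u \<omega>))" if "\<omega> \<in> space M" for \<omega>
    by (intro continuous_intros continuous_paths_on[OF I(2) that]
        continuous_on_subset[OF simple_integral_continuous[OF S that]]) auto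
qed


section \<open>Second moment of a localized Ito integral\<close>

text \<open>The integrand is truncated twice: at \<open>\<tau>\<close>, and as soon as the accumulated square of
  the coefficients would exceed the bound that \<open>H\<close> itself obeys up to \<open>\<tau>\<close>. Both truncations are
  predictable, and off a small event the second one is inactive before \<open>\<tau>\<close>; so the truncated sum
  is the untruncated integral at a grid point next to \<open>\<tau>\<close>, although \<open>H\<close> is uncontrolled
  after \<open>\<tau>\<close>.\<close>

lemma localized_simple_approximation:
  assumes ito: "ito_integral M F W H I" and h: "h > 0" and b: "b > 0" and \<delta>: "\<delta> > 0"
    and \<tau>: "\<And>\<omega>. \<omega> \<in> space M \<Longrightarrow> 0 \<le> \<tau> \<omega> \<and> \<tau> \<omega> \<le> h"
    and stop: "\<And>t. 0 \<le> t \<Longrightarrow> {\<omega> \<in> space M. \<tau> \<omega> \<le> t} \<in> sets (F (ennreal t))"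
    and bound: "\<And>\<omega> s. \<omega> \<in> space M \<Longrightarrow> 0 < s \<Longrightarrow> s \<le> \<tau> \<omega> \<Longrightarrow> norm (H s \<omega> - A) \<le> b"
  shows "\<exists>S E. S \<in> borel_measurable M \<and> integrable M (\<lambda>\<omega>. (norm (S \<omega> :: real^2))\<^sup>2) \<and>
     (\<integral>\<omega>. (norm (S \<omega>))\<^sup>2 \<partial>M) \<le> 8 * b\<^sup>2 * h \<and> E \<in> sets M \<and> prob E \<le> \<delta> \<and>
     (\<forall>\<omega>\<in>space M - E. \<exists>u\<in>{0..h}. \<bar>u - \<tau> \<omega>\<bar> \<le> \<delta> \<and> norm (S \<omega> - (I u \<omega> - A *v W u \<omega>)) \<le> \<delta>)"
proof -
  from ito obtain ms ts \<xi>s where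
    prog: "progressive F H" and I: "adapted F I" "continuous_paths M I"
    and simple: "\<And>n. simple_integrand M F (ms n) (ts n) (\<xi>s n)"
    and lim: "\<And>T e. T > 0 \<Longrightarrow> e > 0 \<Longrightarrow>
      (\<lambda>n. measure M {\<omega> \<in> space M.
         (\<integral>\<^sup>+ s\<in>{0..T}. ennreal ((norm (simple_process (ms n) (ts n) (\<xi>s n) s \<omega> - H s \<omega>))\<^sup>2) \<partial>lborel)
               > ennreal e}) \<longlonglongrightarrow> 0 \<and>
      (\<lambda>n. measure M {\<omega> \<in> space M. \<exists>u\<in>{0..T}.
             norm (simple_integral W (ms n) (ts n) (\<xi>s n) u \<omega> - I u \<omega>) > e}) \<longlonglongrightarrow> 0"
    unfolding ito_integral_def by blast
  \<comment> \<open>The tolerance is \<open>b\<^sup>2 * h\<close>, which also bounds the integral of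
    |H - A|^2 up to \<open>\<tau>\<close>; it need not be small. Smallness is asked only of the
    supremum in \<open>E2\<close>.\<close>
  define E1 where "E1 n = {\<omega> \<in> space M.
    (\<integral>\<^sup>+ s\<in>{0..h}. ennreal ((norm (simple_process (ms n) (ts n) (\<xi>s n) s \<omega> - H s \<omega>))\<^sup>2) \<partial>lborel)
               > ennreal (b\<^sup>2 * h)}" for n
  define E2 where "E2 n = {\<omega> \<in> space M. \<exists>u\<in>{0..h}.
             norm (simple_integral W (ms n) (ts n) (\<xi>s n) u \<omega> - I u \<omega>) > \<delta>}" for n
  have E1m[measurable]: "E1 n \<in> sets M" for n
    unfolding E1_def using h by (intro sets_sq_deviation[OF prog simple]) simp
  have E2m[measurable]: "E2 n \<in> sets M" for n
    unfolding E2_def by (intro sets_sup_deviation[OF simple I])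
  have "(\<lambda>n. prob (E1 n)) \<longlonglongrightarrow> 0"
    unfolding E1_def using lim[OF h, of "b\<^sup>2 * h"] h b by simp
  then have ev1: "\<forall>\<^sub>F n in sequentially. prob (E1 n) < \<delta> / 2"
    by (rule order_tendstoD(2)) (use \<delta> in simp)
  have "(\<lambda>n. prob (E2 n)) \<longlonglongrightarrow> 0"
    unfolding E2_def using lim[OF h \<delta>] by simp
  then have ev2: "\<forall>\<^sub>F n in sequentially. prob (E2 n) < \<delta> / 2"
    by (rule order_tendstoD(2)) (use \<delta> in simp)
  have "\<exists>n. prob (E1 n) < \<delta> / 2 \<and> prob (E2 n) < \<delta> / 2"
    using eventually_conj[OF ev1 ev2] by (rule eventually_happens'[OF sequentially_bot])
  then obtain n where n: "prob (E1 n) < \<delta> / 2" "prob (E2 n) < \<delta> / 2" by blast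
  define m t \<xi> E where "m = ms n" "t = ts n" "\<xi> = \<xi>s n" "E = E1 n \<union> E2 n"
  note [simp] = \<open>m = ms n\<close>[symmetric] \<open>t = ts n\<close>[symmetric] \<open>\<xi> = \<xi>s n\<close>[symmetric]
  have si: "simple_integrand M F m t \<xi>" using simple[of n] by simp
  then have t_mono: "\<And>k. k < m \<Longrightarrow> t k \<le> t (Suc k)"
    by (auto simp: simple_integrand_def)
  have E[measurable]: "E \<in> sets M" unfolding \<open>E = _\<close> by simp
  have PE: "prob E \<le> \<delta>"
    unfolding \<open>E = _\<close> using measure_Un_le[of "E1 n" M "E2 n"] n by simp
  obtain N g where g: "g 0 = 0" "g N = h" "\<And>j. j < N \<Longrightarrow> g j < g (Suc j)"
      "\<And>j. j < N \<Longrightarrow> g (Suc j) \<le> g j + \<delta>"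
    and fine: "\<And>j s. j < N \<Longrightarrow> s \<in> t ` {..m} \<Longrightarrow> s \<le> g j \<or> g (Suc j) \<le> s"
    using fine_grid[of "t ` {..m}" h \<delta>] h \<delta> by (metis finite_imageI finite_atMost)
  have g_mono: "g i \<le> g j" if "i \<le> j" "j \<le> N" for i j
    using that(1,2)
  proof (induction j rule: dec_induct)
    case (step k)
    then show ?case using g(3)[of k] by auto
  qed simp
  have g_range: "0 \<le> g j" "g j \<le> h" if "j \<le> N" for j
    using g_mono[of 0 j] g_mono[of j N] that g by auto
  define \<zeta> where "\<zeta> j \<omega> = grid_coeff m t \<xi> g j \<omega> - A" for j \<omega>
  define a where "a j \<omega> = (g (Suc j) - g j) * (norm (\<zeta> j \<omega>))\<^sup>2" for j \<omega>
  \<comment> \<open>By (x + y)^2 <= 2 x^2 + 2 y^2: \<open>2 * b\<^sup>2 * h\<close> for the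
    deviation of the simple process from \<open>H\<close> off \<open>E1 n\<close>, and as much for
    that of \<open>H\<close> from \<open>A\<close>.\<close>
  define c where "c = 4 * b\<^sup>2 * h"
  \<comment> \<open>Both tests are decided at the left end \<open>g j\<close>. The sum already
    includes cell \<open>j\<close>, whose coefficient is known by then, so accepting a cell never
    overruns \<open>c\<close>.\<close>
  define r where "r j \<omega> \<longleftrightarrow> g j < \<tau> \<omega> \<and> (\<Sum>l\<le>j. a l \<omega>) \<le> c" for j \<omega>
  define \<eta> where "\<eta> j \<omega> = (if r j \<omega> then \<zeta> j \<omega> else 0)" for j \<omega>
  define S where "S \<omega> = (\<Sum>j<N. \<eta> j \<omega> *v (W (g (Suc j)) \<omega> - W (g j) \<omega>))" for \<omega>
  define J where "J u \<omega> = simple_integral W m t \<xi> u \<omega> - A *v W u \<omega>" for u \<omega>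
  have c0: "0 \<le> c" using h by (simp add: c_def)
  have a0: "0 \<le> a j \<omega>" if "j < N" for j \<omega>
    unfolding a_def using g(3)[OF that] by simp
  have \<zeta>m: "\<zeta> l \<in> borel_measurable (F (ennreal (g j)))" if "l \<le> j" "j < N" for l j
    unfolding \<zeta>_def[abs_def] using g_mono[of l j] that
    by (intro borel_measurable_diff borel_measurable_const
        measurable_F_mono[OF _ grid_coeff_measurable[OF si]] ennreal_leI) auto
  have \<eta>m: "\<eta> j \<in> borel_measurable (F (ennreal (g j)))" if j: "j < N" for j
  proof -
    let ?Fj = "F (ennreal (g j))"
    have [measurable]: "\<zeta> l \<in> borel_measurable ?Fj" if "l \<le> j" for l
      using \<zeta>m that j by simp
    have sum_m: "(\<lambda>\<omega>. \<Sum>l\<le>j. a l \<omega>) \<in> borel_measurable ?Fj"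
      unfolding a_def by (intro borel_measurable_sum) auto
    have s1: "{\<omega> \<in> space ?Fj. (\<Sum>l\<le>j. a l \<omega>) \<le> c} \<in> sets ?Fj"
      using sum_m by simp
    have "{\<omega> \<in> space ?Fj. \<not> \<tau> \<omega> \<le> g j} \<in> sets ?Fj"
      using stop[of "g j"] g_range(1)[of j] j
      by (intro sets.sets_Collect_neg) (auto simp: space_F)
    then have "{\<omega> \<in> space ?Fj. \<not> \<tau> \<omega> \<le> g j} \<inter> {\<omega> \<in> space ?Fj. (\<Sum>l\<le>j. a l \<omega>) \<le> c} \<in> sets ?Fj"
      using s1 by (rule sets.Int)
    also have "{\<omega> \<in> space ?Fj. \<not> \<tau> \<omega> \<le> g j} \<inter> {\<omega> \<in> space ?Fj. (\<Sum>l\<le>j. a l \<omega>) \<le> c} = {\<omega> \<in> space ?Fj. r j \<omega>}"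
      by (auto simp: r_def not_le)
    finally have "{\<omega> \<in> space ?Fj. r j \<omega>} \<in> sets ?Fj" .
    then show ?thesis
      unfolding \<eta>_def[abs_def] using j by (intro measurable_If) auto
  qed
  have \<eta>b: "bounded (\<eta> j ` space M)" for j
  proof -
    obtain B where B: "\<forall>\<omega>\<in>space M. norm (grid_coeff m t \<xi> g j \<omega>) \<le> B"
      using grid_coeff_bounded[OF si] by blast
    show ?thesis
      unfolding bounded_iff
    proof (intro exI ballI)
      fix y assume "y \<in> \<eta> j ` space M"
      then obtain \<omega> where \<omega>: "\<omega> \<in> space M" "y = \<eta> j \<omega>" by blast
      have "norm (\<zeta> j \<omega>) \<le> B + norm A"
        unfolding \<zeta>_def using B \<omega> by (smt (verit) norm_triangle_ineq4)
      moreover have "norm (\<eta> j \<omega>) \<le> norm (\<zeta> j \<omega>)" by (simp add: \<eta>_def)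
      ultimately show "norm y \<le> B + norm A" using \<omega> by simp
    qed
  qed
  have \<eta>_sum: "(\<Sum>j<N. (g (Suc j) - g j) * (norm (\<eta> j \<omega>))\<^sup>2) \<le> c" for \<omega>
  proof -
    \<comment> \<open>Extended by 0 beyond \<open>N\<close>, where nothing is known about the grid,
      because \<open>sum_truncated_le\<close> wants nonnegative terms throughout.\<close>
    define a' where "a' j = (if j < N then a j \<omega> else 0)" for j
    have "(\<Sum>j<N. (g (Suc j) - g j) * (norm (\<eta> j \<omega>))\<^sup>2)
       = (\<Sum>j<N. if g j < \<tau> \<omega> \<and> (\<Sum>l\<le>j. a' l) \<le> c then a' j else 0)"
    proof (rule sum.cong[OF refl])
      fix j assume j: "j \<in> {..<N}"
      then have "(\<Sum>l\<le>j. a' l) = (\<Sum>l\<le>j. a l \<omega>)"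
        by (intro sum.cong) (auto simp: a'_def)
      then show "(g (Suc j) - g j) * (norm (\<eta> j \<omega>))\<^sup>2 = (if g j < \<tau> \<omega> \<and> (\<Sum>l\<le>j. a' l) \<le> c then a' j else 0)"
        using j by (simp add: \<eta>_def r_def a_def a'_def)
    qed
    also have "\<dots> \<le> c"
      by (rule sum_truncated_le) (use a0 c0 in \<open>auto simp: a'_def\<close>)
    finally show ?thesis .
  qed
  have tr: "S \<in> borel_measurable M" "integrable M (\<lambda>\<omega>. (norm (S \<omega>))\<^sup>2)"
    "(\<integral>\<omega>. (norm (S \<omega>))\<^sup>2 \<partial>M) \<le> 2 * c"
    using martingale_transform_second_moment[of g N \<eta> c] g(1,3) \<eta>m \<eta>b \<eta>_sum
    unfolding S_def[abs_def] by (auto simp: less_imp_le)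
  have path: "\<exists>u\<in>{0..h}. \<bar>u - \<tau> \<omega>\<bar> \<le> \<delta> \<and> norm (S \<omega> - (I u \<omega> - A *v W u \<omega>)) \<le> \<delta>"
    if "\<omega> \<in> space M - E" for \<omega>
  proof -
    have \<omega>: "\<omega> \<in> space M" "\<omega> \<notin> E1 n" "\<omega> \<notin> E2 n"
      using that by (auto simp: \<open>E = _\<close>)
    let ?d = "\<lambda>s. ennreal ((norm (simple_process m t \<xi> s \<omega> - H s \<omega>))\<^sup>2)"
    have dev: "(\<integral>\<^sup>+ s\<in>{0..h}. ?d s \<partial>lborel) \<le> ennreal (b\<^sup>2 * h)"
      using \<omega> by (simp add: E1_def not_less)
    have \<tau>\<omega>: "0 \<le> \<tau> \<omega>" "\<tau> \<omega> \<le> h" using \<tau> \<omega> by auto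
    have budget: "(\<Sum>l\<le>j. a l \<omega>) \<le> c" if j: "j < N" "g (Suc j) \<le> \<tau> \<omega>" for j
    proof -
      define \<phi> where "\<phi> s = 2 * (?d s * indicator {0..h} s) + ennreal (2 * b\<^sup>2) * indicator {0..h} s" for s
      \<comment> \<open>Cells are disjoint, so at each s at most one summand is nonzero. The
        indicator of (0, g i] on the right lets the induction see this: for s in the next cell it
        forces the earlier sum to vanish.\<close>
      have pw: "(\<Sum>l<i. ennreal ((norm (\<zeta> l \<omega>))\<^sup>2) * indicator {g l<..g (Suc l)} s) \<le> \<phi> s * indicator {0<..g i} s"
        if "i \<le> Suc j" for i s
        using that
      proof (induction i)
        case (Suc i)
        then have i: "i < N" using j by simp
        have gi: "0 \<le> g i" "g i < g (Suc i)" using g_range(1)[of i] g(3)[OF i] i by auto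
        show ?case
        proof (cases "s \<in> {g i<..g (Suc i)}")
          case False
          then have "(\<Sum>l<Suc i. ennreal ((norm (\<zeta> l \<omega>))\<^sup>2) * indicator {g l<..g (Suc l)} s)
             = (\<Sum>l<i. ennreal ((norm (\<zeta> l \<omega>))\<^sup>2) * indicator {g l<..g (Suc l)} s)"
            by simp
          also have "\<dots> \<le> \<phi> s * indicator {0<..g i} s" using Suc by simp
          also have "\<dots> \<le> \<phi> s * indicator {0<..g (Suc i)} s"
            using gi by (intro mult_left_mono) (auto simp: indicator_def)
          finally show ?thesis .
        next
          case True
          have "(\<Sum>l<i. ennreal ((norm (\<zeta> l \<omega>))\<^sup>2) * indicator {g l<..g (Suc l)} s) \<le> 0"
            using Suc True by simp
          then have z: "(\<Sum>l<i. ennreal ((norm (\<zeta> l \<omega>))\<^sup>2) * indicator {g l<..g (Suc l)} s) = 0"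
            by simp
          have "g (Suc i) \<le> \<tau> \<omega>" using g_mono[of "Suc i" "Suc j"] Suc j by auto
          then have s: "0 < s" "s \<le> \<tau> \<omega>" "s \<le> h" "s \<in> {0<..g (Suc i)}" using True gi \<tau>\<omega> by auto
          have sp: "simple_process m t \<xi> s \<omega> = grid_coeff m t \<xi> g i \<omega>"
            using True by (intro simple_process_on_grid g(3)[OF i] fine[OF i]) auto
          have "norm (\<zeta> i \<omega>) \<le> norm (simple_process m t \<xi> s \<omega> - H s \<omega>) + b"
            unfolding \<zeta>_def sp using bound[OF \<omega>(1) s(1,2)]
            by (smt (verit) norm_triangle_ineq diff_add_cancel add_diff_eq)
          then have "(norm (\<zeta> i \<omega>))\<^sup>2 \<le> (norm (simple_process m t \<xi> s \<omega> - H s \<omega>) + b)\<^sup>2"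
            by (intro power_mono) auto
          also have "\<dots> \<le> 2 * (norm (simple_process m t \<xi> s \<omega> - H s \<omega>))\<^sup>2 + 2 * b\<^sup>2"
            using zero_le_power2[of "norm (simple_process m t \<xi> s \<omega> - H s \<omega>) - b"]
            unfolding power2_sum power2_diff by simp
          finally have "ennreal ((norm (\<zeta> i \<omega>))\<^sup>2)
             \<le> ennreal (2 * (norm (simple_process m t \<xi> s \<omega> - H s \<omega>))\<^sup>2 + 2 * b\<^sup>2)"
            by (rule ennreal_leI)
          also have "\<dots> = \<phi> s"
            unfolding \<phi>_def using s by (simp add: ennreal_plus ennreal_mult')
          finally show ?thesis using True s z by simp
        qed
      qed simp
      have "ennreal (\<Sum>l\<le>j. a l \<omega>) = (\<Sum>l<Suc j. ennreal (a l \<omega>))"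
        using a0 j by (subst sum_ennreal[symmetric]) (auto simp: lessThan_Suc_atMost)
      also have "\<dots> = (\<Sum>l<Suc j. \<integral>\<^sup>+s. ennreal ((norm (\<zeta> l \<omega>))\<^sup>2) * indicator {g l<..g (Suc l)} s \<partial>lborel)"
      proof (rule sum.cong[OF refl])
        fix l assume "l \<in> {..<Suc j}"
        then have "g l < g (Suc l)" using g(3)[of l] j by auto
        then show "ennreal (a l \<omega>) = (\<integral>\<^sup>+s. ennreal ((norm (\<zeta> l \<omega>))\<^sup>2) * indicator {g l<..g (Suc l)} s \<partial>lborel)"
          by (subst nn_integral_cmult_indicator) (auto simp: a_def ennreal_mult'[symmetric] mult.commute)
      qed
      also have "\<dots> = (\<integral>\<^sup>+s. (\<Sum>l<Suc j. ennreal ((norm (\<zeta> l \<omega>))\<^sup>2) * indicator {g l<..g (Suc l)} s) \<partial>lborel)"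
        by (subst nn_integral_sum) auto
      also have "\<dots> \<le> (\<integral>\<^sup>+s. \<phi> s \<partial>lborel)"
      proof (rule nn_integral_mono)
        fix s
        have "(\<Sum>l<Suc j. ennreal ((norm (\<zeta> l \<omega>))\<^sup>2) * indicator {g l<..g (Suc l)} s) \<le> \<phi> s * indicator {0<..g (Suc j)} s"
          by (rule pw) simp
        also have "\<dots> \<le> \<phi> s" by (auto simp: indicator_def)
        finally show "(\<Sum>l<Suc j. ennreal ((norm (\<zeta> l \<omega>))\<^sup>2) * indicator {g l<..g (Suc l)} s) \<le> \<phi> s" .
      qed
      also have "\<dots> = 2 * (\<integral>\<^sup>+ s\<in>{0..h}. ?d s \<partial>lborel) + ennreal (2 * b\<^sup>2) * ennreal h"
      proof -
        have m: "(\<lambda>s. ?d s * indicator {0..h} s) \<in> borel_measurable lborel"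
          using sq_deviation_section_measurable[OF prog si _ \<omega>(1)] h by simp
        show ?thesis
          unfolding \<phi>_def using m h
          by (subst nn_integral_add) (auto simp: nn_integral_cmult nn_integral_cmult_indicator)
      qed
      also have "\<dots> \<le> 2 * ennreal (b\<^sup>2 * h) + ennreal (2 * b\<^sup>2) * ennreal h"
        by (intro add_mono mult_left_mono dev) auto
      also have "\<dots> = ennreal c"
        unfolding c_def using h by (simp add: ennreal_mult'[symmetric] ennreal_plus[symmetric] flip: ennreal_numeral)
      finally show ?thesis using c0 by simp
    qed
    have r_antimono: "r i \<omega>" if "r j \<omega>" "i \<le> j" "j < N" for i j
    proof -
      have "(\<Sum>l\<le>i. a l \<omega>) \<le> (\<Sum>l\<le>j. a l \<omega>)"
        using that a0 by (intro sum_mono2) auto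
      then show ?thesis using that g_mono[of i j] by (auto simp: r_def)
    qed
    \<comment> \<open>The first index at which the sum is cut. By \<open>r_antimono\<close> nothing
      is accepted afterwards, so \<open>S\<close> telescopes to the value of \<open>J\<close> at
      \<open>g k\<close>.\<close>
    define k where "k = (LEAST j. j = N \<or> \<not> r j \<omega>)"
    have k: "k = N \<or> \<not> r k \<omega>" unfolding k_def by (rule LeastI[of _ N]) simp
    have k_le: "k \<le> N" unfolding k_def by (rule Least_le) simp
    have k_min: "r j \<omega>" if "j < k" for j
      using not_less_Least[of j "\<lambda>j. j = N \<or> \<not> r j \<omega>"] that unfolding k_def by blast
    have k_after: "\<not> r j \<omega>" if "k \<le> j" "j < N" for j
      using k r_antimono[of j k] that by auto
    have "S \<omega> = (\<Sum>j<k. \<eta> j \<omega> *v (W (g (Suc j)) \<omega> - W (g j) \<omega>))"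
      unfolding S_def using k_le k_after
      by (intro sum.mono_neutral_right) (auto simp: \<eta>_def not_less)
    also have "\<dots> = (\<Sum>j<k. J (g (Suc j)) \<omega> - J (g j) \<omega>)"
    proof (rule sum.cong[OF refl])
      fix j assume "j \<in> {..<k}"
      then have j: "r j \<omega>" "j < N" using k_min k_le by auto
      show "\<eta> j \<omega> *v (W (g (Suc j)) \<omega> - W (g j) \<omega>) = J (g (Suc j)) \<omega> - J (g j) \<omega>"
        using simple_integral_on_grid[of g j m t W \<xi> \<omega>] g(3)[OF j(2)] fine[OF j(2)] t_mono j(1)
        by (simp add: J_def \<eta>_def \<zeta>_def matrix_vector_mult_diff_rdistrib matrix_vector_mult_diff_distrib algebra_simps)
    qed
    also have "\<dots> = J (g k) \<omega> - J (g 0) \<omega>"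
      by (rule sum_lessThan_telescope)
    also have "J (g 0) \<omega> = 0"
    proof -
      have "simple_integral W m t \<xi> 0 \<omega> = 0"
        unfolding simple_integral_def using simple_integrand_times_nonneg[OF si]
        by (intro sum.neutral) (auto simp: min_absorb1)
      then show ?thesis by (simp add: J_def g(1) W_0[OF \<omega>(1)])
    qed
    finally have S: "S \<omega> = J (g k) \<omega>" by simp
    have near: "\<bar>g k - \<tau> \<omega>\<bar> \<le> \<delta>"
    proof -
      have "g k \<le> \<tau> \<omega> + \<delta>"
      proof (cases k)
        case 0
        then show ?thesis using \<tau>\<omega> g(1) \<delta> by simp
      next
        case (Suc i)
        then have "g i < \<tau> \<omega>" using k_min[of i] by (simp add: r_def)
        then show ?thesis using Suc g(4)[of i] k_le by auto
      qed
      moreover have "\<tau> \<omega> \<le> g k + \<delta>"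
      proof (cases "k = N")
        case True
        then show ?thesis using \<tau>\<omega> g(2) \<delta> by simp
      next
        case False
        then have kN: "k < N" and nr: "\<not> r k \<omega>" using k k_le by auto
        \<comment> \<open>A cell that ends by \<open>\<tau>\<close> is within budget, so refusing
          cell \<open>k\<close> means that \<open>\<tau>\<close> lies before its right end.\<close>
        then have "\<not> g (Suc k) \<le> \<tau> \<omega> \<or> \<not> g k < \<tau> \<omega>"
          using budget[OF kN] by (auto simp: r_def)
        then show ?thesis using g(4)[OF kN] \<delta> by auto
      qed
      ultimately show ?thesis by linarith
    qed
    have "g k \<in> {0..h}" using g_range[OF k_le] by simp
    moreover from this have "norm (simple_integral W m t \<xi> (g k) \<omega> - I (g k) \<omega>) \<le> \<delta>"
      using \<omega> by (auto simp: E2_def not_less)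
    then have "norm (S \<omega> - (I (g k) \<omega> - A *v W (g k) \<omega>)) \<le> \<delta>"
      by (simp add: S J_def)
    ultimately show ?thesis using near by blast
  qed
  show ?thesis
    using tr E PE path by (intro exI[of _ S] exI[of _ E]) (auto simp: c_def)
qed

text \<open>Apply the approximation with \<open>\<delta> = (1/2)^k\<close>. Borel-Cantelli removes
  the bad events, path continuity at \<open>\<tau>\<close> gives almost sure convergence of the
  sums, and Fatou keeps their common bound. The constant is 8 = 2 * 4: 2 from the transform
  estimate, 4 from the budget.\<close>

lemma ito_integral_second_moment_le:
  assumes ito: "ito_integral M F W H I" and h: "h > 0" and b: "b > 0"
    and \<tau>: "\<And>\<omega>. \<omega> \<in> space M \<Longrightarrow> 0 \<le> \<tau> \<omega> \<and> \<tau> \<omega> \<le> h"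
    and stop: "\<And>t. 0 \<le> t \<Longrightarrow> {\<omega> \<in> space M. \<tau> \<omega> \<le> t} \<in> sets (F (ennreal t))"
    and bound: "\<And>\<omega> s. \<omega> \<in> space M \<Longrightarrow> 0 < s \<Longrightarrow> s \<le> \<tau> \<omega> \<Longrightarrow> norm (H s \<omega> - A) \<le> b"
  shows "(\<integral>\<^sup>+\<omega>. ennreal ((norm (I (\<tau> \<omega>) \<omega> - A *v W (\<tau> \<omega>) \<omega>))\<^sup>2) \<partial>M) \<le> ennreal (8 * b\<^sup>2 * h)"
proof -
  have I: "adapted F I" "continuous_paths M I"
    using ito by (auto simp: ito_integral_def)
  let ?Y = "\<lambda>u \<omega>. I u \<omega> - A *v W u \<omega>"
  have "\<forall>k. \<exists>S E. S \<in> borel_measurable M \<and> integrable M (\<lambda>\<omega>. (norm (S \<omega> :: real^2))\<^sup>2) \<and>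
     (\<integral>\<omega>. (norm (S \<omega>))\<^sup>2 \<partial>M) \<le> 8 * b\<^sup>2 * h \<and> E \<in> sets M \<and> prob E \<le> (1/2)^k \<and>
     (\<forall>\<omega>\<in>space M - E. \<exists>u\<in>{0..h}. \<bar>u - \<tau> \<omega>\<bar> \<le> (1/2)^k \<and> norm (S \<omega> - ?Y u \<omega>) \<le> (1/2)^k)"
    by (intro allI localized_simple_approximation[OF ito h b _ \<tau> stop bound]) auto
  then obtain S E where S: "\<And>k. S k \<in> borel_measurable M" "\<And>k. integrable M (\<lambda>\<omega>. (norm (S k \<omega> :: real^2))\<^sup>2)"
      "\<And>k. (\<integral>\<omega>. (norm (S k \<omega>))\<^sup>2 \<partial>M) \<le> 8 * b\<^sup>2 * h"
    and E: "\<And>k. E k \<in> sets M" "\<And>k. prob (E k) \<le> (1/2)^k"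
    and app: "\<And>k \<omega>. \<omega> \<in> space M - E k \<Longrightarrow> \<exists>u\<in>{0..h}. \<bar>u - \<tau> \<omega>\<bar> \<le> (1/2)^k \<and> norm (S k \<omega> - ?Y u \<omega>) \<le> (1/2)^k"
    by metis
  have [measurable]: "S k \<in> borel_measurable M" for k by (rule S)
  have "AE \<omega> in M. \<forall>\<^sub>F k in sequentially. \<omega> \<in> space M - E k"
  proof (rule borel_cantelli_AE1)
    show "summable (\<lambda>k. prob (E k))"
      by (rule summable_comparison_test'[of "\<lambda>k. (1/2)^k"]) (use E in auto)
  qed (use E in \<open>auto simp: emeasure_eq_measure\<close>)
  then have conv: "AE \<omega> in M. (\<lambda>k. S k \<omega>) \<longlonglongrightarrow> ?Y (\<tau> \<omega>) \<omega>"
  proof (rule AE_mp, intro AE_I2 impI)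
    fix \<omega> assume \<omega>: "\<omega> \<in> space M" and ev: "\<forall>\<^sub>F k in sequentially. \<omega> \<in> space M - E k"
    \<comment> \<open>The chosen time means something only off \<open>E k\<close>, hence for all
      large \<open>k\<close>, which suffices for the limit.\<close>
    define u where "u k = (SOME u. u \<in> {0..h} \<and> \<bar>u - \<tau> \<omega>\<bar> \<le> (1/2)^k \<and> norm (S k \<omega> - ?Y u \<omega>) \<le> (1/2)^k)" for k
    have u: "\<forall>\<^sub>F k in sequentially. u k \<in> {0..h} \<and> \<bar>u k - \<tau> \<omega>\<bar> \<le> (1/2)^k \<and> norm (S k \<omega> - ?Y (u k) \<omega>) \<le> (1/2)^k"
      using ev
    proof eventually_elim
      case (elim k)
      show ?case unfolding u_def by (rule someI_ex) (use app[OF elim] in blast)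
    qed
    have half: "(\<lambda>k. (1/2::real)^k) \<longlonglongrightarrow> 0"
      by (rule LIMSEQ_power_zero) simp
    have "(\<lambda>k. u k - \<tau> \<omega>) \<longlonglongrightarrow> 0"
      by (rule Lim_null_comparison[OF _ half]) (use u in \<open>auto elim: eventually_mono\<close>)
    then have "u \<longlonglongrightarrow> \<tau> \<omega>" by (simp add: LIM_zero_iff)
    moreover have "continuous_on {0..} (\<lambda>u. ?Y u \<omega>)"
      by (intro continuous_intros continuous_paths_on[OF I(2) \<omega>] continuous_paths_on[OF W_paths \<omega>]
          bounded_bilinear.continuous_on[OF bounded_bilinear_matrix_vector_mult]) auto
    ultimately have "(\<lambda>k. ?Y (u k) \<omega>) \<longlonglongrightarrow> ?Y (\<tau> \<omega>) \<omega>"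
      by (intro continuous_on_tendsto_compose[of "{0..}" "\<lambda>u. ?Y u \<omega>" u "\<tau> \<omega>"])
         (use u \<tau>[OF \<omega>] in \<open>auto elim: eventually_mono\<close>)
    moreover have "(\<lambda>k. S k \<omega> - ?Y (u k) \<omega>) \<longlonglongrightarrow> 0"
      by (rule Lim_null_comparison[OF _ half]) (use u in \<open>auto elim: eventually_mono\<close>)
    ultimately have "(\<lambda>k. (S k \<omega> - ?Y (u k) \<omega>) + ?Y (u k) \<omega>) \<longlonglongrightarrow> 0 + ?Y (\<tau> \<omega>) \<omega>"
      by (intro tendsto_add)
    then show "(\<lambda>k. S k \<omega>) \<longlonglongrightarrow> ?Y (\<tau> \<omega>) \<omega>" by simp
  qed
  have "(\<integral>\<^sup>+\<omega>. ennreal ((norm (?Y (\<tau> \<omega>) \<omega>))\<^sup>2) \<partial>M) = (\<integral>\<^sup>+\<omega>. liminf (\<lambda>k. ennreal ((norm (S k \<omega>))\<^sup>2)) \<partial>M)"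
  proof (rule nn_integral_cong_AE)
    show "AE \<omega> in M. ennreal ((norm (?Y (\<tau> \<omega>) \<omega>))\<^sup>2) = liminf (\<lambda>k. ennreal ((norm (S k \<omega>))\<^sup>2))"
      using conv
    proof eventually_elim
      case (elim \<omega>)
      then have "(\<lambda>k. ennreal ((norm (S k \<omega>))\<^sup>2)) \<longlonglongrightarrow> ennreal ((norm (?Y (\<tau> \<omega>) \<omega>))\<^sup>2)"
        by (intro tendsto_ennrealI tendsto_power tendsto_norm)
      then show ?case by (intro lim_imp_Liminf[symmetric]) simp_all
    qed
  qed
  also have "\<dots> \<le> liminf (\<lambda>k. \<integral>\<^sup>+\<omega>. ennreal ((norm (S k \<omega>))\<^sup>2) \<partial>M)"
    by (rule nn_integral_liminf) measurable
  also have "\<dots> \<le> liminf (\<lambda>k::nat. ennreal (8 * b\<^sup>2 * h))"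
  proof (intro Liminf_mono always_eventually allI)
    show "(\<integral>\<^sup>+\<omega>. ennreal ((norm (S k \<omega>))\<^sup>2) \<partial>M) \<le> ennreal (8 * b\<^sup>2 * h)" for k
      using S(2,3)[of k] by (subst nn_integral_eq_integral) (auto intro: ennreal_leI)
  qed
  also have "\<dots> = ennreal (8 * b\<^sup>2 * h)"
    by (simp add: Liminf_const)
  finally show ?thesis .
qed

end

section \<open>Exit times, reflection and the gain function\<close>

text \<open>Adjoining \<open>h\<close> caps the time and keeps the infimum over a nonempty set. By
  continuity the set is closed, so the infimum is attained and the level is reached there unless the
  cap acts. The bound up to \<open>T\<close> assumes \<open>0 < T\<close>, since a path that starts
  beyond the level has \<open>T = 0\<close>.\<close>

lemma
  fixes d :: "real \<Rightarrow> real" and h \<rho> :: real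
  assumes cont: "continuous_on {0..} d" and h: "0 \<le> h"
  defines "T \<equiv> Inf (insert h {t \<in> {0..h}. \<rho> \<le> d t})"
  shows exit_time_range: "0 \<le> T" "T \<le> h"
    and exit_time_upto: "0 < T \<Longrightarrow> 0 \<le> s \<Longrightarrow> s \<le> T \<Longrightarrow> d s \<le> \<rho>"
    and exit_time_at: "T < h \<Longrightarrow> \<rho> \<le> d T"
    and exit_time_le_iff: "t < h \<Longrightarrow> T \<le> t \<longleftrightarrow> (\<exists>u\<in>{0..t}. \<rho> \<le> d u)"
proof -
  let ?S = "insert h {t \<in> {0..h}. \<rho> \<le> d t}"
  have bdd: "bdd_below ?S" by (rule bdd_belowI[of _ 0]) (use h in auto)
  have "continuous_on {0..h} d"
    by (rule continuous_on_subset[OF cont]) auto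
  then have "closed {t \<in> {0..h}. \<rho> \<le> d t}"
    by (intro continuous_on_closed_Collect_le continuous_intros) auto
  then have "closed ?S" by (rule closed_insert)
  then have T_in: "T \<in> ?S"
    unfolding T_def using bdd by (intro closed_contains_Inf) auto
  have T_le: "T \<le> t" if "t \<in> ?S" for t
    unfolding T_def using that bdd by (rule cInf_lower)
  show range: "0 \<le> T" "T \<le> h" using T_in T_le[of h] h by auto
  have before: "d s < \<rho>" if "0 \<le> s" "s < T" for s
    using T_le[of s] that range by (force simp: not_le[symmetric])
  show at: "\<rho> \<le> d T" if "T < h"
    using T_in that by auto
  show "T \<le> t \<longleftrightarrow> (\<exists>u\<in>{0..t}. \<rho> \<le> d u)" if "t < h" for t
  proof
    assume "T \<le> t"
    then show "\<exists>u\<in>{0..t}. \<rho> \<le> d u" using at range that by (intro bexI[of _ T]) auto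
  next
    assume "\<exists>u\<in>{0..t}. \<rho> \<le> d u"
    then show "T \<le> t" using T_le that by fastforce
  qed
  \<comment> \<open>Strictly before \<open>T\<close> the level is not reached; the closure of [0, T)
    carries the weak inequality to \<open>T\<close>.\<close>
  show "d s \<le> \<rho>" if T: "0 < T" and s: "0 \<le> s" "s \<le> T" for s
  proof -
    have cl: "closure {0..<T} = {0..T}" using T by simp
    have "d ` closure {0..<T} \<subseteq> {..\<rho>}"
    proof (rule image_closure_subset)
      show "continuous_on (closure {0..<T}) d"
        unfolding cl by (rule continuous_on_subset[OF cont]) auto
    qed (auto simp: image_subset_iff less_imp_le[OF before])
    then show ?thesis using s unfolding cl by (auto simp: image_subset_iff)
  qed
qed

text \<open>The bound is assumed for \<open>0 < s\<close> only, because a path with exit time 0 may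
  be outside the ball at time 0; that single point is null.\<close>

lemma norm_set_integral_le:
  fixes f :: "real \<Rightarrow> 'b::{banach, second_countable_topology}"
  assumes "0 \<le> T" "0 \<le> K" and f: "\<And>s. 0 < s \<Longrightarrow> s \<le> T \<Longrightarrow> norm (f s) \<le> K"
  shows "norm (LINT s:{0..T}|lborel. f s) \<le> K * T"
proof (cases "set_integrable lborel {0..T} f")
  case True
  have "norm (LINT s:{0..T}|lborel. f s) \<le> (LINT s|lborel. norm (indicator {0..T} s *\<^sub>R f s))"
    unfolding set_lebesgue_integral_def by (rule integral_norm_bound)
  also have "\<dots> \<le> (LINT s|lborel. K * indicator {0..T} s)"
  proof (rule integral_mono_AE)
    show "integrable lborel (\<lambda>s. norm (indicator {0..T} s *\<^sub>R f s))"
      using True unfolding set_integrable_def by (rule integrable_norm)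
    show "integrable lborel (\<lambda>s. K * indicator {0..T} s)"
      by (simp add: emeasure_lborel_Icc_eq)
    show "AE s in lborel. norm (indicator {0..T} s *\<^sub>R f s) \<le> K * indicator {0..T} s"
      using AE_lborel_singleton[of "0::real"]
      by eventually_elim (auto simp: indicator_def intro!: f)
  qed
  also have "\<dots> = K * T" using assms by simp
  finally show ?thesis .
next
  case False
  \<comment> \<open>The integral of a non-integrable function is 0 by convention, so the estimate
    persists.\<close>
  then have "(LINT s:{0..T}|lborel. f s) = 0"
    unfolding set_lebesgue_integral_def set_integrable_def by (rule not_integrable_integral_eq)
  then show ?thesis using assms by simp
qed

text \<open>The measure dL^i does not charge times at which coordinate i is positive; if these fill
  (0, T], then L^i has not moved from 0. The exceptional null set does not depend on
  \<open>T\<close>, so a random time may be inserted.\<close>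

lemma reflection_term_eq_0:
  assumes "reflection_term M F Y L"
  shows "AE \<omega> in M. \<forall>T\<ge>0. (\<forall>t. 0 < t \<and> t \<le> T \<longrightarrow> (\<forall>i. Y t \<omega> $ i > 0)) \<longrightarrow> L T \<omega> = 0"
proof -
  from assms have cont: "\<And>\<omega>. \<omega> \<in> space M \<Longrightarrow> continuous_on {0..} (\<lambda>t. L t \<omega>)"
    and L0: "\<And>\<omega>. \<omega> \<in> space M \<Longrightarrow> L 0 \<omega> = 0"
    and mono: "\<And>\<omega> i. \<omega> \<in> space M \<Longrightarrow> mono_on {0..} (\<lambda>t. L t \<omega> $ i)"
    and int0: "AE \<omega> in M. \<forall>i. (\<integral>\<^sup>+ t\<in>{0..}. indicator {t. Y t \<omega> $ i > 0} t
                          \<partial>interval_measure (\<lambda>t. L (max 0 t) \<omega> $ i)) = 0"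
    by (auto simp: reflection_term_def continuous_paths_def)
  show ?thesis
    using int0
  proof (rule AE_mp, intro AE_I2 impI allI)
    fix \<omega> T
    assume \<omega>: "\<omega> \<in> space M" and T: "0 \<le> T" and pos: "\<forall>t. 0 < t \<and> t \<le> T \<longrightarrow> (\<forall>i. Y t \<omega> $ i > 0)"
      and z: "\<forall>i. (\<integral>\<^sup>+ t\<in>{0..}. indicator {t. Y t \<omega> $ i > 0} t \<partial>interval_measure (\<lambda>t. L (max 0 t) \<omega> $ i)) = 0"
    have "L T \<omega> $ i = 0" for i
    proof -
      \<comment> \<open>The extension to negative times is that of \<open>reflection_term\<close>;
        it is monotone and continuous on the whole line, as required for
        \<open>interval_measure\<close>.\<close>
      define f where "f t = L (max 0 t) \<omega> $ i" for t
      have f_mono: "f s \<le> f t" if "s \<le> t" for s t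
        unfolding f_def using that by (intro mono_onD[OF mono[OF \<omega>]]) auto
      have "continuous_on UNIV f"
        unfolding f_def
        by (intro continuous_intros continuous_on_compose2[OF cont[OF \<omega>]]) auto
      then have f_cont: "continuous (at_right a) f" for a
        by (meson continuous_on_eq_continuous_within continuous_within_subset UNIV_I subset_UNIV)
      have "ennreal (f T - f 0) = emeasure (interval_measure f) {0<..T}"
        by (rule emeasure_interval_measure_Ioc[OF T f_mono f_cont, symmetric])
      also have "\<dots> = (\<integral>\<^sup>+ t. indicator {0<..T} t \<partial>interval_measure f)"
        by simp
      also have "\<dots> \<le> (\<integral>\<^sup>+ t\<in>{0..}. indicator {t. Y t \<omega> $ i > 0} t \<partial>interval_measure f)"
        using pos by (intro nn_integral_mono) (auto simp: indicator_def)
      also have "\<dots> = 0"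
        using z[rule_format, of i] unfolding f_def .
      finally have "ennreal (f T - f 0) = 0" by (simp only: le_zero_eq)
      then have "f T \<le> f 0" by (simp add: ennreal_eq_0_iff)
      with f_mono[OF T] have "f T = f 0" by simp
      then show ?thesis using T L0[OF \<omega>] by (simp add: f_def)
    qed
    then show "L T \<omega> = 0" by (simp add: vec_eq_iff)
  qed
qed

text \<open>On the diagonal both arguments of the maximum have the same value at \<open>x\<close>,
  which can be pulled out as a constant.\<close>

lemma gain_add_diagonal: "x $ 1 = \<alpha> * x $ 2 \<Longrightarrow> gain \<alpha> (x + z) = gain \<alpha> x + gain \<alpha> z"
  by (simp add: gain_def algebra_simps max_add_distrib_right)

lemma gain_scaleR: "0 \<le> s \<Longrightarrow> gain \<alpha> (s *\<^sub>R z) = s * gain \<alpha> z"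
  by (simp add: gain_def max_mult_distrib_left mult.left_commute)

text \<open>max(a, b) + max(-a, -b) = |a - b|: averaging a displacement with its opposite cancels
  the linear part and leaves the kink.\<close>

lemma gain_add_gain_uminus: "gain \<alpha> z + gain \<alpha> (- z) = \<bar>vector [1, - \<alpha>] \<bullet> z\<bar>"
  by (simp add: gain_def inner_vec_def UNIV_2 max_def abs_if)

lemma gain_lipschitz:
  assumes "\<alpha> > 0"
  shows "\<bar>gain \<alpha> y - gain \<alpha> z\<bar> \<le> (1 + \<alpha>) * norm (y - z)"
proof -
  have 1: "\<bar>y $ 1 - z $ 1\<bar> \<le> norm (y - z)" "\<bar>y $ 2 - z $ 2\<bar> \<le> norm (y - z)"
    using component_le_norm_cart[of "y - z"] by auto
  have "\<bar>\<alpha> * y $ 2 - \<alpha> * z $ 2\<bar> = \<alpha> * \<bar>y $ 2 - z $ 2\<bar>"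
    using assms by (simp add: abs_mult right_diff_distrib[symmetric])
  also have "\<dots> \<le> \<alpha> * norm (y - z)" using 1 assms by simp
  finally have "\<bar>\<alpha> * y $ 2 - \<alpha> * z $ 2\<bar> \<le> \<alpha> * norm (y - z)" .
  moreover have "0 \<le> \<alpha> * norm (y - z)" using assms by simp
  ultimately show ?thesis
    using 1(1) norm_ge_zero[of "y - z"] unfolding gain_def distrib_right by (simp add: max_def abs_le_iff)
qed

lemma gain_le_norm: "\<alpha> > 0 \<Longrightarrow> \<bar>gain \<alpha> z\<bar> \<le> (1 + \<alpha>) * norm z"
  using gain_lipschitz[of \<alpha> z 0] by (simp add: gain_def)

lemma gain_nonneg: "z \<in> quadrant \<Longrightarrow> 0 \<le> gain \<alpha> z"
  by (simp add: gain_def quadrant_def le_max_iff_disj)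

lemma borel_measurable_gain [measurable]: "gain \<alpha> \<in> borel_measurable borel"
  unfolding gain_def[abs_def] by measurable

text \<open>By symmetry the mean is half the mean of gain (A z) + gain (- A z), that is, of |n . A
  z| / 2, and n . A z is the inner product of \<open>v\<close> with z.\<close>

lemma std_gaussian_integral_gain:
  fixes A :: "real^2^2"
  assumes "\<alpha> > 0"
  defines "v \<equiv> transpose A *v vector [1, - \<alpha>]"
  shows "has_bochner_integral std_gaussian (\<lambda>z. gain \<alpha> (A *v z)) ((\<integral>z. \<bar>v \<bullet> z\<bar> \<partial>std_gaussian) / 2)"
proof -
  have m[measurable]: "(\<lambda>z. gain \<alpha> (A *v z)) \<in> borel_measurable borel"
    by measurable
  interpret prob_space std_gaussian by (rule prob_space_std_gaussian)
  have int: "integrable std_gaussian (\<lambda>z. gain \<alpha> (A *v z))"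
  proof (rule Bochner_Integration.integrable_bound)
    show "integrable std_gaussian (\<lambda>z. (1 + \<alpha>) * norm A * (1 + (norm z)\<^sup>2))"
      using std_gaussian_norm_sq by (auto simp: has_bochner_integral_iff)
    show "AE z in std_gaussian. norm (gain \<alpha> (A *v z)) \<le> norm ((1 + \<alpha>) * norm A * (1 + (norm z)\<^sup>2))"
    proof (rule AE_I2)
      fix z :: "real^2"
      have "\<bar>gain \<alpha> (A *v z)\<bar> \<le> (1 + \<alpha>) * norm (A *v z)"
        using assms(1) by (rule gain_le_norm)
      also have "\<dots> \<le> (1 + \<alpha>) * (norm A * (1 + (norm z)\<^sup>2))"
        using assms
        by (intro mult_left_mono order_trans[OF norm_matrix_vector_mult_le] mult_left_mono le_one_plus_square) auto
      also have "\<dots> = (1 + \<alpha>) * norm A * (1 + (norm z)\<^sup>2)" by (simp only: mult.assoc)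
      finally show "norm (gain \<alpha> (A *v z)) \<le> norm ((1 + \<alpha>) * norm A * (1 + (norm z)\<^sup>2))"
        using abs_ge_self order_trans by simp
    qed
  qed simp
  have "integrable (distr std_gaussian borel uminus) (\<lambda>z. gain \<alpha> (A *v z))"
    using int by (simp add: distr_std_gaussian_uminus)
  then have int': "integrable std_gaussian (\<lambda>z. gain \<alpha> (A *v (- z)))"
    by (subst (asm) integrable_distr_eq) auto
  have "(\<integral>z. gain \<alpha> (A *v z) \<partial>std_gaussian) = (\<integral>z. gain \<alpha> (A *v z) \<partial>(distr std_gaussian borel uminus))"
    by (simp add: distr_std_gaussian_uminus)
  also have "\<dots> = (\<integral>z. gain \<alpha> (A *v (- z)) \<partial>std_gaussian)"
    by (subst integral_distr) auto
  finally have "2 * (\<integral>z. gain \<alpha> (A *v z) \<partial>std_gaussian)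
     = (\<integral>z. gain \<alpha> (A *v z) + gain \<alpha> (A *v (- z)) \<partial>std_gaussian)"
    using int int' by simp
  also have "(\<lambda>z. gain \<alpha> (A *v z) + gain \<alpha> (A *v (- z))) = (\<lambda>z. \<bar>v \<bullet> z\<bar>)"
  proof
    fix z
    have "A *v (- z) = - (A *v z)"
      using matrix_vector_mult_scaleR[of A "-1" z] by simp
    then show "gain \<alpha> (A *v z) + gain \<alpha> (A *v (- z)) = \<bar>v \<bullet> z\<bar>"
      unfolding v_def by (simp add: gain_add_gain_uminus dot_lmul_matrix)
  qed
  finally show ?thesis using int by (simp add: has_bochner_integral_iff)
qed

context filtered_brownian_motion
begin

text \<open>Brownian scaling and positive homogeneity of the gain pull out
  \<open>sqrt h\<close>.\<close>

lemma expectation_gain_brownian: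
  assumes "\<alpha> > 0" "h > 0"
  shows "has_bochner_integral M (\<lambda>\<omega>. gain \<alpha> (A *v W h \<omega>))
     (sqrt h * ((\<integral>z. \<bar>(transpose A *v vector [1, - \<alpha>]) \<bullet> z\<bar> \<partial>std_gaussian) / 2))"
proof -
  have [measurable]: "(\<lambda>z. gain \<alpha> (A *v z)) \<in> borel_measurable borel"
    by measurable
  have sc: "gain \<alpha> (A *v (sqrt h *\<^sub>R z)) = sqrt h * gain \<alpha> (A *v z)" for z
    using assms by (simp add: matrix_vector_mult_scaleR gain_scaleR)
  have "has_bochner_integral M (\<lambda>\<omega>. gain \<alpha> (A *v (W h \<omega> - W 0 \<omega>)))
     (sqrt h * ((\<integral>z. \<bar>(transpose A *v vector [1, - \<alpha>]) \<bullet> z\<bar> \<partial>std_gaussian) / 2))"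
    using integrable_increment_iff[of 0 h "\<lambda>z. gain \<alpha> (A *v z)"]
      integral_increment[of 0 h "\<lambda>z. gain \<alpha> (A *v z)"] assms
      std_gaussian_integral_gain[OF assms(1), of A]
    by (simp add: has_bochner_integral_iff sc)
  then show ?thesis
    by (subst (asm) has_bochner_integral_cong[OF refl _ refl, where g="\<lambda>\<omega>. gain \<alpha> (A *v W h \<omega>)"])
       (simp_all add: W_0)
qed

end

section \<open>Stopping at the exit time of a small ball\<close>

text \<open>Capped at \<open>h\<close> by adjoining it, so the infimum is never over the empty set
  and the time is a real number.\<close>

definition exit_time :: "(real \<Rightarrow> 'a \<Rightarrow> real^2) \<Rightarrow> real^2 \<Rightarrow> real \<Rightarrow> real \<Rightarrow> 'a \<Rightarrow> real" where
  "exit_time Y x \<rho> h \<omega> = Inf (insert h {t \<in> {0..h}. \<rho> \<le> dist (Y t \<omega>) x})"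

context filtered_brownian_motion
begin

lemma
  assumes Y: "adapted F Y" "continuous_paths M Y" and h: "0 \<le> h"
  shows exit_time_bounds: "\<omega> \<in> space M \<Longrightarrow> 0 \<le> exit_time Y x \<rho> h \<omega>" "\<omega> \<in> space M \<Longrightarrow> exit_time Y x \<rho> h \<omega> \<le> h"
    and exit_time_in_cball: "\<omega> \<in> space M \<Longrightarrow> 0 < exit_time Y x \<rho> h \<omega> \<Longrightarrow> 0 \<le> s \<Longrightarrow> s \<le> exit_time Y x \<rho> h \<omega> \<Longrightarrow>
        Y s \<omega> \<in> cball x \<rho>"
    and exit_time_early: "\<omega> \<in> space M \<Longrightarrow> exit_time Y x \<rho> h \<omega> < h \<Longrightarrow> \<rho> \<le> dist (Y (exit_time Y x \<rho> h \<omega>) \<omega>) x"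
    and exit_time_le_sets: "0 \<le> t \<Longrightarrow> {\<omega> \<in> space M. exit_time Y x \<rho> h \<omega> \<le> t} \<in> sets (F (ennreal t))"
proof -
  have cont: "continuous_on {0..} (\<lambda>t. dist (Y t \<omega>) x)" if "\<omega> \<in> space M" for \<omega>
    by (intro continuous_intros continuous_paths_on[OF Y(2) that]) auto
  show "\<omega> \<in> space M \<Longrightarrow> 0 \<le> exit_time Y x \<rho> h \<omega>" and le_h: "\<omega> \<in> space M \<Longrightarrow> exit_time Y x \<rho> h \<omega> \<le> h" for \<omega>
    unfolding exit_time_def using exit_time_range[OF cont h] by auto
  show "\<omega> \<in> space M \<Longrightarrow> 0 < exit_time Y x \<rho> h \<omega> \<Longrightarrow> 0 \<le> s \<Longrightarrow> s \<le> exit_time Y x \<rho> h \<omega> \<Longrightarrow> Y s \<omega> \<in> cball x \<rho>"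
    unfolding exit_time_def using exit_time_upto[OF cont h] by (simp add: dist_commute)
  show "\<omega> \<in> space M \<Longrightarrow> exit_time Y x \<rho> h \<omega> < h \<Longrightarrow> \<rho> \<le> dist (Y (exit_time Y x \<rho> h \<omega>) \<omega>) x"
    unfolding exit_time_def using exit_time_at[OF cont h] by simp
  assume t: "0 \<le> t"
  show "{\<omega> \<in> space M. exit_time Y x \<rho> h \<omega> \<le> t} \<in> sets (F (ennreal t))"
  \<comment> \<open>Before the cap, the time is at most t iff the closed condition has been met by
    t, an event of \<open>F t\<close>; from \<open>h\<close> on the event is the whole
    space.\<close>
  proof (cases "t < h")
    case True
    then have "{\<omega> \<in> space M. exit_time Y x \<rho> h \<omega> \<le> t} = {\<omega> \<in> space (F (ennreal t)). \<exists>u\<in>{0..t}. \<rho> \<le> dist (Y u \<omega>) x}"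
      unfolding exit_time_def space_F using exit_time_le_iff[OF cont h] by auto
    also have "\<dots> \<in> sets (F (ennreal t))"
    proof (rule sets_path_exceeds(2))
      show "(\<lambda>\<omega>. dist (Y u \<omega>) x) \<in> borel_measurable (F (ennreal t))" if "u \<in> {0..t}" for u
        using that by (intro borel_measurable_dist borel_measurable_const
            measurable_F_mono[OF _ adapted_measurable[OF Y(1)]] ennreal_leI) auto
      show "continuous_on {0..t} (\<lambda>t. dist (Y t \<omega>) x)" if "\<omega> \<in> space (F (ennreal t))" for \<omega>
        using that by (intro continuous_on_subset[OF cont]) (auto simp: space_F)
    qed
    finally show ?thesis .
  next
    case False
    then have "{\<omega> \<in> space M. exit_time Y x \<rho> h \<omega> \<le> t} = space (F (ennreal t))"
      using le_h by (fastforce simp: space_F)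
    then show ?thesis by simp
  qed
qed

lemma stopping_time_of_real:
  assumes "\<And>\<omega>. \<omega> \<in> space M \<Longrightarrow> 0 \<le> \<tau> \<omega>"
    and "\<And>t. 0 \<le> t \<Longrightarrow> {\<omega> \<in> space M. \<tau> \<omega> \<le> t} \<in> sets (F (ennreal t))"
  shows "stopping_time F (\<lambda>\<omega>. ennreal (\<tau> \<omega>))"
proof
  fix t :: ennreal
  show "Measurable.pred (F t) (\<lambda>\<omega>. ennreal (\<tau> \<omega>) \<le> t)"
  proof (cases t)
    case (real s)
    then have "{\<omega> \<in> space (F t). ennreal (\<tau> \<omega>) \<le> t} = {\<omega> \<in> space M. \<tau> \<omega> \<le> s}"
      by (auto simp: space_F ennreal_le_iff)
    then show ?thesis
      using assms(2)[of s] real by (simp add: pred_def)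
  qed simp
qed

lemma random_time_measurable:
  assumes "\<And>t. 0 \<le> t \<Longrightarrow> {\<omega> \<in> space M. \<tau> \<omega> \<le> t} \<in> sets (F (ennreal t))"
    and "\<And>\<omega>. \<omega> \<in> space M \<Longrightarrow> 0 \<le> \<tau> \<omega>"
  shows "\<tau> \<in> borel_measurable M"
proof (rule borel_measurableI_le)
  fix t
  show "{\<omega> \<in> space M. \<tau> \<omega> \<le> t} \<in> sets M"
  proof (cases "0 \<le> t")
    case True
    then show ?thesis using assms(1)[of t] subalgebra_F by (auto simp: subalgebra_def)
  next
    case False
    then have "{\<omega> \<in> space M. \<tau> \<omega> \<le> t} = {}" using assms(2) by fastforce
    then show ?thesis by (simp only: sets.empty_sets)
  qed
qed

text \<open>\<open>Z\<close> is the error of freezing the coefficient at \<open>x\<close>, so its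
  second moment involves only the oscillation \<open>\<epsilon>\<close>. For the exit probability:
  if the drift is at most \<open>\<rho> / 2\<close>, leaving the ball forces the stochastic integral
  beyond \<open>\<rho> / 2\<close>, and Chebyshev turns 8 into 32.\<close>

lemma exit_time_expansion:
  assumes sol: "reflected_solution M F W \<mu> \<sigma> x Y"
    and \<rho>: "\<rho> > 0" and sub: "cball x \<rho> \<subseteq> open_quadrant" and h: "h > 0" and \<epsilon>: "\<epsilon> > 0" and K: "0 \<le> K"
    and \<mu>: "\<And>y. y \<in> cball x \<rho> \<Longrightarrow> norm (\<mu> y) \<le> K"
    and \<sigma>: "\<And>y. y \<in> cball x \<rho> \<Longrightarrow> norm (\<sigma> y - \<sigma> x) \<le> \<epsilon>"
  defines "\<tau> \<equiv> exit_time Y x \<rho> h"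
  shows "\<exists>Z \<in> borel_measurable M.
    (\<integral>\<^sup>+\<omega>. ennreal ((norm (Z \<omega> :: real^2))\<^sup>2) \<partial>M) \<le> ennreal (8 * \<epsilon>\<^sup>2 * h) \<and>
    (AE \<omega> in M. norm (Y (\<tau> \<omega>) \<omega> - x - \<sigma> x *v W (\<tau> \<omega>) \<omega> - Z \<omega>) \<le> K * h) \<and>
    (K * h \<le> \<rho> / 2 \<longrightarrow>
      prob {\<omega> \<in> space M. \<rho> \<le> dist (Y (\<tau> \<omega>) \<omega>) x} \<le> 32 * (norm (\<sigma> x) + \<epsilon>)\<^sup>2 * h / \<rho>\<^sup>2)"
proof -
  from sol obtain I L where Y: "adapted F Y" "continuous_paths M Y"
    and ito: "ito_integral M F W (\<lambda>s \<omega>. \<sigma> (Y s \<omega>)) I" and L: "reflection_term M F Y L"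
    and eq: "AE \<omega> in M. \<forall>t\<ge>0. Y t \<omega> = x + (LINT s:{0..t}|lborel. \<mu> (Y s \<omega>)) + I t \<omega> + L t \<omega>"
    unfolding reflected_solution_def by blast
  have I: "adapted F I" "continuous_paths M I"
    using ito by (auto simp: ito_integral_def)
  have h0: "0 \<le> h" using h by simp
  note \<tau>_bounds = exit_time_bounds[OF Y h0, of _ x \<rho>, folded \<tau>_def]
  note \<tau>_cball = exit_time_in_cball[OF Y h0, of _ x \<rho>, folded \<tau>_def]
  note \<tau>_sets = exit_time_le_sets[OF Y h0, of _ x \<rho>, folded \<tau>_def]
  have \<tau>m: "\<tau> \<in> borel_measurable M"
    by (rule random_time_measurable[OF \<tau>_sets \<tau>_bounds(1)])
  have at_\<tau>: "(\<lambda>\<omega>. P (\<tau> \<omega>) \<omega>) \<in> borel_measurable M"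
    if "adapted F P" "continuous_paths M P" for P :: "real \<Rightarrow> 'a \<Rightarrow> real^2"
    by (rule borel_measurable_path_at_random_time[OF adapted_measurable_M[OF that(1)] continuous_paths_on[OF that(2)] \<tau>m \<tau>_bounds(1)])
       auto
  have [measurable]: "(\<lambda>\<omega>. Y (\<tau> \<omega>) \<omega>) \<in> borel_measurable M" "(\<lambda>\<omega>. I (\<tau> \<omega>) \<omega>) \<in> borel_measurable M"
      "(\<lambda>\<omega>. W (\<tau> \<omega>) \<omega>) \<in> borel_measurable M"
    by (intro at_\<tau> Y I W_adapted W_paths)+
  have in_cball: "Y s \<omega> \<in> cball x \<rho>" if "\<omega> \<in> space M" "0 < s" "s \<le> \<tau> \<omega>" for s \<omega>
    using \<tau>_cball[of \<omega> s] that by simp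
  define Z where "Z \<omega> = I (\<tau> \<omega>) \<omega> - \<sigma> x *v W (\<tau> \<omega>) \<omega>" for \<omega>
  have Zm: "Z \<in> borel_measurable M" unfolding Z_def[abs_def] by measurable
  have Z2: "(\<integral>\<^sup>+\<omega>. ennreal ((norm (Z \<omega>))\<^sup>2) \<partial>M) \<le> ennreal (8 * \<epsilon>\<^sup>2 * h)"
    unfolding Z_def using \<tau>_bounds \<sigma> in_cball
    by (intro ito_integral_second_moment_le[OF ito h \<epsilon> _ \<tau>_sets]) auto
  have b: "norm (\<sigma> x) + \<epsilon> > 0" using \<epsilon> norm_ge_zero[of "\<sigma> x"] by linarith
  have \<sigma>_le: "norm (\<sigma> y - 0) \<le> norm (\<sigma> x) + \<epsilon>" if "y \<in> cball x \<rho>" for y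
    using \<sigma>[OF that] norm_triangle_ineq2[of "\<sigma> y" "\<sigma> x"] by simp
  \<comment> \<open>The same moment bound with \<open>A = 0\<close>: on the ball
    \<open>\<sigma>\<close> itself is at most \<open>norm (\<sigma> x) + \<epsilon>\<close>.\<close>
  have "(\<integral>\<^sup>+\<omega>. ennreal ((norm (I (\<tau> \<omega>) \<omega> - 0 *v W (\<tau> \<omega>) \<omega>))\<^sup>2) \<partial>M) \<le> ennreal (8 * (norm (\<sigma> x) + \<epsilon>)\<^sup>2 * h)"
    using \<tau>_bounds \<sigma>_le in_cball
    by (intro ito_integral_second_moment_le[OF ito h b _ \<tau>_sets]) auto
  then have I2: "(\<integral>\<^sup>+\<omega>. ennreal ((norm (I (\<tau> \<omega>) \<omega>))\<^sup>2) \<partial>M) \<le> ennreal (8 * (norm (\<sigma> x) + \<epsilon>)\<^sup>2 * h)"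
    by simp
  have drift: "AE \<omega> in M. norm (Y (\<tau> \<omega>) \<omega> - x - I (\<tau> \<omega>) \<omega>) \<le> K * h"
    using eq reflection_term_eq_0[OF L] AE_space
  proof eventually_elim
    case (elim \<omega>)
    have "L (\<tau> \<omega>) \<omega> = 0"
    proof -
      have "Y t \<omega> $ i > 0" if "0 < t" "t \<le> \<tau> \<omega>" for t i
      proof -
        have "Y t \<omega> \<in> open_quadrant" using in_cball[OF elim(3) that] sub by blast
        then show ?thesis using exhaust_2[of i] by (auto simp: open_quadrant_def)
      qed
      then show ?thesis using elim(2) \<tau>_bounds(1)[OF elim(3)] by blast
    qed
    then have "Y (\<tau> \<omega>) \<omega> - x - I (\<tau> \<omega>) \<omega> = (LINT s:{0..\<tau> \<omega>}|lborel. \<mu> (Y s \<omega>))"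
      using elim(1)[rule_format, OF \<tau>_bounds(1)[OF elim(3)]] by (simp add: algebra_simps)
    also have "norm \<dots> \<le> K * \<tau> \<omega>"
      by (rule norm_set_integral_le[OF \<tau>_bounds(1)[OF elim(3)] K]) (intro \<mu> in_cball[OF elim(3)])
    also have "\<dots> \<le> K * h"
      using \<tau>_bounds(2)[OF elim(3)] K by (rule mult_left_mono)
    finally show ?case .
  qed
  have exp: "AE \<omega> in M. norm (Y (\<tau> \<omega>) \<omega> - x - \<sigma> x *v W (\<tau> \<omega>) \<omega> - Z \<omega>) \<le> K * h"
    using drift by eventually_elim (simp add: Z_def algebra_simps)
  have exit: "prob {\<omega> \<in> space M. \<rho> \<le> dist (Y (\<tau> \<omega>) \<omega>) x} \<le> 32 * (norm (\<sigma> x) + \<epsilon>)\<^sup>2 * h / \<rho>\<^sup>2"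
    if Kh: "K * h \<le> \<rho> / 2"
  proof -
    let ?B = "{\<omega> \<in> space M. \<rho> \<le> dist (Y (\<tau> \<omega>) \<omega>) x}"
    have "ennreal (\<rho>\<^sup>2 / 4) * emeasure M ?B = (\<integral>\<^sup>+\<omega>. ennreal (\<rho>\<^sup>2 / 4) * indicator ?B \<omega> \<partial>M)"
      by (subst nn_integral_cmult_indicator) auto
    also have "\<dots> \<le> (\<integral>\<^sup>+\<omega>. ennreal ((norm (I (\<tau> \<omega>) \<omega>))\<^sup>2) \<partial>M)"
    proof (rule nn_integral_mono_AE)
      show "AE \<omega> in M. ennreal (\<rho>\<^sup>2 / 4) * indicator ?B \<omega> \<le> ennreal ((norm (I (\<tau> \<omega>) \<omega>))\<^sup>2)"
        using drift
      proof eventually_elim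
        case (elim \<omega>)
        show ?case
        proof (cases "\<omega> \<in> ?B")
          case True
          then have "\<rho> \<le> norm (Y (\<tau> \<omega>) \<omega> - x)" by (simp add: dist_norm)
          then have "\<rho> / 2 \<le> norm (I (\<tau> \<omega>) \<omega>)"
            using elim Kh norm_triangle_ineq2[of "Y (\<tau> \<omega>) \<omega> - x" "I (\<tau> \<omega>) \<omega>"] by linarith
          then have "(\<rho> / 2)\<^sup>2 \<le> (norm (I (\<tau> \<omega>) \<omega>))\<^sup>2"
            using \<rho> by (intro power_mono) auto
          then show ?thesis using True by (simp add: power_divide ennreal_leI)
        qed simp
      qed
    qed
    also note I2
    finally have "ennreal (\<rho>\<^sup>2 / 4 * prob ?B) \<le> ennreal (8 * (norm (\<sigma> x) + \<epsilon>)\<^sup>2 * h)"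
      unfolding emeasure_eq_measure by (subst ennreal_mult) auto
    then have "\<rho>\<^sup>2 / 4 * prob ?B \<le> 8 * (norm (\<sigma> x) + \<epsilon>)\<^sup>2 * h"
      using h by (subst (asm) ennreal_le_iff) auto
    then show ?thesis using \<rho> by (simp add: field_simps)
  qed
  show ?thesis
    using Zm Z2 exp exit by (intro bexI[of _ Z]) auto
qed

text \<open>Origin of the terms: 9/2 = (1 + 8) / 2 is the error \<open>Z\<close> after AM-GM; the
  fraction with 32 is the exit probability, weighted by what is lost on exit;
  \<open>2 * C * norm (\<sigma> x)\<close> stems from the second moment \<open>2 * h\<close> of
  \<open>W h\<close>; then drift, discounting and running cost.\<close>

lemma expected_payoff_exit_time:
  assumes sol: "reflected_solution M F W \<mu> \<sigma> x Y"
    and \<rho>: "\<rho> > 0" and sub: "cball x \<rho> \<subseteq> open_quadrant" and h: "h > 0" and \<epsilon>: "\<epsilon> > 0" and K: "0 \<le> K"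
    and \<mu>: "\<And>y. y \<in> cball x \<rho> \<Longrightarrow> norm (\<mu> y) \<le> K"
    and \<sigma>: "\<And>y. y \<in> cball x \<rho> \<Longrightarrow> norm (\<sigma> y - \<sigma> x) \<le> \<epsilon>"
    and c: "\<And>y. y \<in> cball x \<rho> \<Longrightarrow> 0 \<le> c y \<and> c y \<le> k" and k: "0 \<le> k"
    and Kh: "K * h \<le> \<rho> / 2" and \<alpha>: "\<alpha> > 0" and r: "r > 0" and diag: "x $ 1 = \<alpha> * x $ 2"
    and payoff: "payoff_integrable M c \<alpha> r Y (\<lambda>\<omega>. ennreal (exit_time Y x \<rho> h \<omega>))"
  defines "C \<equiv> 1 + \<alpha>" and "v \<equiv> transpose (\<sigma> x) *v vector [1, - \<alpha>]"
  shows "gain \<alpha> x + sqrt h * ((\<integral>z. \<bar>v \<bullet> z\<bar> \<partial>std_gaussian) / 2 - 9 / 2 * C * \<epsilon>)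
    - (32 * (norm (\<sigma> x) + \<epsilon>)\<^sup>2 / \<rho>\<^sup>2 * (gain \<alpha> x + C * norm (\<sigma> x)) + 2 * C * norm (\<sigma> x)
        + C * K + r * (gain \<alpha> x + C * \<rho>) + k) * h
    \<le> expected_payoff M c \<alpha> r Y (\<lambda>\<omega>. ennreal (exit_time Y x \<rho> h \<omega>))"
proof -
  define \<tau> where "\<tau> = exit_time Y x \<rho> h"
  define A where "A = \<sigma> x"
  define G where "G = gain \<alpha> x"
  define m where "m = (\<integral>z. \<bar>v \<bullet> z\<bar> \<partial>std_gaussian) / 2"
  define R where "R = r * (G + C * \<rho>) + k"
  from sol have Y: "adapted F Y" "continuous_paths M Y"
    and quad: "\<And>\<omega> t. \<omega> \<in> space M \<Longrightarrow> 0 \<le> t \<Longrightarrow> Y t \<omega> \<in> quadrant"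
    unfolding reflected_solution_def by blast+
  have "\<exists>Z \<in> borel_measurable M.
    (\<integral>\<^sup>+\<omega>. ennreal ((norm (Z \<omega> :: real^2))\<^sup>2) \<partial>M) \<le> ennreal (8 * \<epsilon>\<^sup>2 * h) \<and>
    (AE \<omega> in M. norm (Y (\<tau> \<omega>) \<omega> - x - A *v W (\<tau> \<omega>) \<omega> - Z \<omega>) \<le> K * h) \<and>
    (K * h \<le> \<rho> / 2 \<longrightarrow>
      prob {\<omega> \<in> space M. \<rho> \<le> dist (Y (\<tau> \<omega>) \<omega>) x} \<le> 32 * (norm A + \<epsilon>)\<^sup>2 * h / \<rho>\<^sup>2)"
    unfolding \<tau>_def A_def by (rule exit_time_expansion[OF sol \<rho> sub h \<epsilon> K \<mu> \<sigma>])
  then obtain Z where Zm[measurable]: "Z \<in> borel_measurable M"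
    and Z2: "(\<integral>\<^sup>+\<omega>. ennreal ((norm (Z \<omega> :: real^2))\<^sup>2) \<partial>M) \<le> ennreal (8 * \<epsilon>\<^sup>2 * h)"
    and exp: "AE \<omega> in M. norm (Y (\<tau> \<omega>) \<omega> - x - A *v W (\<tau> \<omega>) \<omega> - Z \<omega>) \<le> K * h"
    and exit: "prob {\<omega> \<in> space M. \<rho> \<le> dist (Y (\<tau> \<omega>) \<omega>) x} \<le> 32 * (norm A + \<epsilon>)\<^sup>2 * h / \<rho>\<^sup>2"
    using Kh by (elim bexE conjE) simp
  have h0: "0 \<le> h" using h by simp
  note \<tau>_bounds = exit_time_bounds[OF Y h0, of _ x \<rho>, folded \<tau>_def]
  note \<tau>_cball = exit_time_in_cball[OF Y h0, of _ x \<rho>, folded \<tau>_def]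
  note \<tau>_early = exit_time_early[OF Y h0, of _ x \<rho>, folded \<tau>_def]
  note \<tau>_sets = exit_time_le_sets[OF Y h0, of _ x \<rho>, folded \<tau>_def]
  have \<tau>m: "\<tau> \<in> borel_measurable M"
    by (rule random_time_measurable[OF \<tau>_sets \<tau>_bounds(1)])
  have Ym[measurable]: "(\<lambda>\<omega>. Y (\<tau> \<omega>) \<omega>) \<in> borel_measurable M"
    by (rule borel_measurable_path_at_random_time[OF adapted_measurable_M[OF Y(1)] continuous_paths_on[OF Y(2)] \<tau>m \<tau>_bounds(1)]) auto
  define B where "B = {\<omega> \<in> space M. \<rho> \<le> dist (Y (\<tau> \<omega>) \<omega>) x}"
  have Bm[measurable]: "B \<in> sets M" unfolding B_def by measurable
  have x_quad: "x \<in> quadrant"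
    using subsetD[OF sub, of x] \<rho> by (simp add: open_quadrant_def quadrant_def)
  have C: "C > 0" using \<alpha> by (simp add: C_def)
  have G0: "0 \<le> G" unfolding G_def by (rule gain_nonneg[OF x_quad])
  have lip: "\<bar>gain \<alpha> y - gain \<alpha> z\<bar> \<le> C * norm (y - z)" for y z
    unfolding C_def by (rule gain_lipschitz[OF \<alpha>])
  \<comment> \<open>The AM-GM weight that makes both parts of the bound on \<open>norm Z\<close> of
    order \<open>\<epsilon> * sqrt h\<close>: the part \<open>\<beta>\<close>, and a quotient of
    mean at most \<open>8 * \<beta>\<close>.\<close>
  define \<beta> where "\<beta> = \<epsilon> * sqrt h"
  have \<beta>: "\<beta> > 0" using \<epsilon> h by (simp add: \<beta>_def)
  have payoff': "integrable M (terminal_payoff \<alpha> r Y (\<lambda>\<omega>. ennreal (\<tau> \<omega>)))"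
     "integrable M (\<lambda>\<omega>. enn2real (running_cost c r Y (\<lambda>\<omega>. ennreal (\<tau> \<omega>)) \<omega>))"
    using payoff by (auto simp: payoff_integrable_def \<tau>_def)
  have Z2int: "integrable M (\<lambda>\<omega>. (norm (Z \<omega>))\<^sup>2)"
    by (rule integrableI_bounded) (use Z2 in \<open>auto intro: le_less_trans\<close>)
  have Z2le: "(\<integral>\<omega>. (norm (Z \<omega>))\<^sup>2 \<partial>M) \<le> 8 * \<epsilon>\<^sup>2 * h"
    using Z2 h by (subst (asm) nn_integral_eq_integral[OF Z2int]) auto
  have W2: "has_bochner_integral M (\<lambda>\<omega>. (norm (W h \<omega>))\<^sup>2) (2 * h)"
  proof -
    have "has_bochner_integral M (\<lambda>\<omega>. (norm (W h \<omega> - W 0 \<omega>))\<^sup>2) (2 * h)"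
      using increment_norm_sq[of 0 h] h by simp
    then show ?thesis
      by (rule has_bochner_integral_cong[THEN iffD1, OF refl _ refl, rotated]) (simp add: W_0)
  qed
  have gW: "has_bochner_integral M (\<lambda>\<omega>. gain \<alpha> (A *v W h \<omega>)) (sqrt h * m)"
    using expectation_gain_brownian[OF \<alpha> h, of A] by (simp add: m_def v_def A_def)

  \<comment> \<open>Off \<open>B\<close> the time is \<open>h\<close>, since an earlier exit would
    place the path at distance \<open>\<rho>\<close>, and the expansion applies at
    \<open>W h\<close>. On \<open>B\<close> the indicator term cancels \<open>G\<close> and the gain
    of \<open>A *v W h\<close>, so the bound reduces to nonnegativity of the gain.\<close>
  have gain_le: "gain \<alpha> (Y (\<tau> \<omega>) \<omega>) \<ge>
      G + gain \<alpha> (A *v W h \<omega>) - C * norm (Z \<omega>) - C * K * h - indicator B \<omega> * (G + C * norm A * norm (W h \<omega>))"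
    if \<omega>: "\<omega> \<in> space M" and e: "norm (Y (\<tau> \<omega>) \<omega> - x - A *v W (\<tau> \<omega>) \<omega> - Z \<omega>) \<le> K * h" for \<omega>
  proof (cases "\<omega> \<in> B")
    case True
    have "gain \<alpha> (A *v W h \<omega>) \<le> C * norm (A *v W h \<omega>)"
      using gain_le_norm[OF \<alpha>, of "A *v W h \<omega>"] by (simp add: C_def)
    also have "\<dots> \<le> C * (norm A * norm (W h \<omega>))"
      using C by (intro mult_left_mono norm_matrix_vector_mult_le) auto
    finally have 1: "gain \<alpha> (A *v W h \<omega>) \<le> C * norm A * norm (W h \<omega>)" by (simp add: mult.assoc)
    have 2: "0 \<le> C * norm (Z \<omega>)" "0 \<le> C * K * h" using C K h by auto
    have 3: "0 \<le> gain \<alpha> (Y (\<tau> \<omega>) \<omega>)"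
      by (intro gain_nonneg quad \<omega> \<tau>_bounds)
    show ?thesis using True 1 2 3 by simp
  next
    case False
    then have \<tau>h: "\<tau> \<omega> = h"
      using \<tau>_early[OF \<omega>] \<tau>_bounds(2)[OF \<omega>] \<omega> by (force simp: B_def)
    have "gain \<alpha> (x + A *v W h \<omega>) - gain \<alpha> (Y (\<tau> \<omega>) \<omega>) \<le> C * norm (x + A *v W h \<omega> - Y (\<tau> \<omega>) \<omega>)"
      using lip[of "x + A *v W h \<omega>" "Y (\<tau> \<omega>) \<omega>"] by linarith
    also have "norm (x + A *v W h \<omega> - Y (\<tau> \<omega>) \<omega>) = norm ((Y (\<tau> \<omega>) \<omega> - x - A *v W h \<omega> - Z \<omega>) + Z \<omega>)"
      by (subst norm_minus_cancel[symmetric]) (simp add: algebra_simps)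
    also have "C * \<dots> \<le> C * (K * h + norm (Z \<omega>))"
      using C e by (intro mult_left_mono order_trans[OF norm_triangle_ineq] add_right_mono) (auto simp: \<tau>h)
    also have "gain \<alpha> (x + A *v W h \<omega>) = G + gain \<alpha> (A *v W h \<omega>)"
      unfolding G_def by (rule gain_add_diagonal[OF diag])
    finally show ?thesis using False by (simp add: algebra_simps)
  qed

  have terminal_ge: "terminal_payoff \<alpha> r Y (\<lambda>\<omega>. ennreal (\<tau> \<omega>)) \<omega> \<ge> gain \<alpha> (Y (\<tau> \<omega>) \<omega>) - r * (G + C * \<rho>) * h"
    if \<omega>: "\<omega> \<in> space M" for \<omega>
  proof -
    have tp: "terminal_payoff \<alpha> r Y (\<lambda>\<omega>. ennreal (\<tau> \<omega>)) \<omega> = exp (- r * \<tau> \<omega>) * gain \<alpha> (Y (\<tau> \<omega>) \<omega>)"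
      using \<tau>_bounds[OF \<omega>] by (simp add: terminal_payoff_def)
    have e: "1 - r * h \<le> exp (- r * \<tau> \<omega>)"
    proof -
      have "r * \<tau> \<omega> \<le> r * h"
        using \<tau>_bounds(2)[OF \<omega>] r by (intro mult_left_mono) auto
      moreover have "1 - r * \<tau> \<omega> \<le> exp (- r * \<tau> \<omega>)"
        using exp_ge_add_one_self[of "- r * \<tau> \<omega>"] by simp
      ultimately show ?thesis by linarith
    qed
    have rG: "0 \<le> r * (G + C * \<rho>) * h" using r G0 C \<rho> h by auto
    show ?thesis
    \<comment> \<open>The equation holds only almost surely, so a path that starts outside the ball
      is not excluded here. Its exit time is 0 and it is not discounted.\<close>
    proof (cases "\<tau> \<omega> = 0")
      case True
      then show ?thesis unfolding tp using rG by simp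
    next
      case False
      then have "Y (\<tau> \<omega>) \<omega> \<in> cball x \<rho>"
        using \<tau>_cball[OF \<omega>, of "\<tau> \<omega>"] \<tau>_bounds[OF \<omega>] by auto
      then have "C * norm (Y (\<tau> \<omega>) \<omega> - x) \<le> C * \<rho>"
        using C by (intro mult_left_mono) (auto simp: dist_norm norm_minus_commute)
      then have g: "gain \<alpha> (Y (\<tau> \<omega>) \<omega>) \<le> G + C * \<rho>"
        using lip[of "Y (\<tau> \<omega>) \<omega>" x] unfolding G_def by linarith
      have g0: "0 \<le> gain \<alpha> (Y (\<tau> \<omega>) \<omega>)"
        by (intro gain_nonneg quad \<omega> \<tau>_bounds)
      have "(1 - r * h) * gain \<alpha> (Y (\<tau> \<omega>) \<omega>) \<le> exp (- r * \<tau> \<omega>) * gain \<alpha> (Y (\<tau> \<omega>) \<omega>)"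
        using e g0 by (rule mult_right_mono)
      moreover have "r * h * gain \<alpha> (Y (\<tau> \<omega>) \<omega>) \<le> r * h * (G + C * \<rho>)"
        using g r h by (intro mult_left_mono) auto
      ultimately show ?thesis unfolding tp by (simp add: algebra_simps)
    qed
  qed

  have cost_le: "enn2real (running_cost c r Y (\<lambda>\<omega>. ennreal (\<tau> \<omega>)) \<omega>) \<le> k * h"
    if \<omega>: "\<omega> \<in> space M" for \<omega>
  proof -
    have eq: "{s. 0 \<le> s \<and> ennreal s \<le> ennreal (\<tau> \<omega>)} = {0..\<tau> \<omega>}"
      using \<tau>_bounds(1)[OF \<omega>] by auto
    have "running_cost c r Y (\<lambda>\<omega>. ennreal (\<tau> \<omega>)) \<omega> \<le> (\<integral>\<^sup>+s. ennreal k * indicator {0..\<tau> \<omega>} s \<partial>lborel)"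
      unfolding running_cost_def eq
    proof (rule nn_integral_mono_AE)
      \<comment> \<open>Time 0 is dropped as a null set, since ball membership is known only for
        paths with positive exit time.\<close>
      show "AE s in lborel. ennreal (exp (- r * s) * c (Y s \<omega>)) * indicator {0..\<tau> \<omega>} s \<le> ennreal k * indicator {0..\<tau> \<omega>} s"
        using AE_lborel_singleton[of "0::real"]
      proof eventually_elim
        case (elim s)
        show ?case
        proof (cases "s \<in> {0..\<tau> \<omega>}")
          case True
          with elim have s: "0 < s" "s \<le> \<tau> \<omega>" by auto
          then have "0 \<le> c (Y s \<omega>)" "c (Y s \<omega>) \<le> k"
            using c[OF \<tau>_cball[OF \<omega>, of s]] by auto
          moreover have "exp (- r * s) \<le> 1" using r s by simp
          ultimately have "exp (- r * s) * c (Y s \<omega>) \<le> 1 * k"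
            by (intro mult_mono) auto
          then show ?thesis by (auto simp: indicator_def intro!: ennreal_leI)
        qed simp
      qed
    qed
    also have "\<dots> = ennreal (k * \<tau> \<omega>)"
      using \<tau>_bounds(1)[OF \<omega>] k by (simp add: nn_integral_cmult_indicator ennreal_mult)
    also have "\<dots> \<le> ennreal (k * h)"
      using \<tau>_bounds(2)[OF \<omega>] k by (intro ennreal_leI mult_left_mono) auto
    finally have "enn2real (running_cost c r Y (\<lambda>\<omega>. ennreal (\<tau> \<omega>)) \<omega>) \<le> enn2real (ennreal (k * h))"
      by (intro enn2real_mono) (auto simp: less_top[symmetric])
    then show ?thesis using k h by simp
  qed

  \<comment> \<open>Each random term has a known or bounded mean. The product of the indicator of
    \<open>B\<close> with \<open>norm (W h)\<close> is split by x <= 1 + x^2 into the indicator and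
    a square, which avoids their joint law.\<close>
  define lower where "lower \<omega> = G + gain \<alpha> (A *v W h \<omega>) - C / 2 * (\<beta> + (norm (Z \<omega>))\<^sup>2 / \<beta>) - C * K * h
      - (G + C * norm A) * indicator B \<omega> - C * norm A * (norm (W h \<omega>))\<^sup>2 - R * h" for \<omega>
  have lower_int: "has_bochner_integral M lower (G + sqrt h * m - C / 2 * (\<beta> + (\<integral>\<omega>. (norm (Z \<omega>))\<^sup>2 \<partial>M) / \<beta>) - C * K * h
      - (G + C * norm A) * prob B - C * norm A * (2 * h) - R * h)"
  proof -
    have 1: "has_bochner_integral M (\<lambda>\<omega>. a) a" for a :: real
      by (simp add: has_bochner_integral_iff prob_space)
    have 2: "has_bochner_integral M (\<lambda>\<omega>. (norm (Z \<omega>))\<^sup>2) (\<integral>\<omega>. (norm (Z \<omega>))\<^sup>2 \<partial>M)"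
      using Z2int by (simp add: has_bochner_integral_iff)
    have 3: "has_bochner_integral M (indicator B) (prob B)"
      by (rule has_bochner_integral_real_indicator) (auto simp: less_top[symmetric])
    show ?thesis
      unfolding lower_def[abs_def]
      by (intro has_bochner_integral_add has_bochner_integral_diff has_bochner_integral_mult_right
          has_bochner_integral_divide 1 2 3 W2 gW)
  qed
  have AM_GM: "norm (Z \<omega>) \<le> (\<beta> + (norm (Z \<omega>))\<^sup>2 / \<beta>) / 2" for \<omega>
  proof -
    have "2 * norm (Z \<omega>) * \<beta> \<le> \<beta> * \<beta> + (norm (Z \<omega>))\<^sup>2"
      using zero_le_power2[of "norm (Z \<omega>) - \<beta>"] unfolding power2_diff unfolding power2_eq_square by linarith
    then show ?thesis using \<beta> by (simp add: field_simps)
  qed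
  have lower_le: "AE \<omega> in M. lower \<omega> \<le> terminal_payoff \<alpha> r Y (\<lambda>\<omega>. ennreal (\<tau> \<omega>)) \<omega>
       - enn2real (running_cost c r Y (\<lambda>\<omega>. ennreal (\<tau> \<omega>)) \<omega>)"
    using exp AE_space
  proof eventually_elim
    case (elim \<omega>)
    have 1: "C * norm (Z \<omega>) \<le> C / 2 * (\<beta> + (norm (Z \<omega>))\<^sup>2 / \<beta>)"
      using mult_left_mono[OF AM_GM[of \<omega>], of C] C by simp
    have "C * norm A * norm (W h \<omega>) \<le> C * norm A * (1 + (norm (W h \<omega>))\<^sup>2)"
      using C by (intro mult_left_mono le_one_plus_square) auto
    moreover have "0 \<le> C * norm A * (norm (W h \<omega>))\<^sup>2" using C by simp
    ultimately have 2: "indicator B \<omega> * (G + C * norm A * norm (W h \<omega>))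
        \<le> (G + C * norm A) * indicator B \<omega> + C * norm A * (norm (W h \<omega>))\<^sup>2"
      by (auto simp: indicator_def algebra_simps)
    have R: "R * h = r * (G + C * \<rho>) * h + k * h" by (simp add: R_def algebra_simps)
    show ?case
      using gain_le[OF elim(2,1)] terminal_ge[OF elim(2)] cost_le[OF elim(2)] 1 2
      unfolding lower_def R by linarith
  qed
  have "integral\<^sup>L M lower \<le> expected_payoff M c \<alpha> r Y (\<lambda>\<omega>. ennreal (\<tau> \<omega>))"
    unfolding expected_payoff_def
    using lower_int payoff' lower_le
    by (intro integral_mono_AE) (auto simp: has_bochner_integral_iff)
  also have "integral\<^sup>L M lower = G + sqrt h * m - C / 2 * (\<beta> + (\<integral>\<omega>. (norm (Z \<omega>))\<^sup>2 \<partial>M) / \<beta>) - C * K * h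
      - (G + C * norm A) * prob B - C * norm A * (2 * h) - R * h"
    by (rule has_bochner_integral_integral_eq[OF lower_int])
  finally have main: "G + sqrt h * m - C / 2 * (\<beta> + (\<integral>\<omega>. (norm (Z \<omega>))\<^sup>2 \<partial>M) / \<beta>) - C * K * h
      - (G + C * norm A) * prob B - C * norm A * (2 * h) - R * h
      \<le> expected_payoff M c \<alpha> r Y (\<lambda>\<omega>. ennreal (\<tau> \<omega>))" .
  have "(\<integral>\<omega>. (norm (Z \<omega>))\<^sup>2 \<partial>M) / \<beta> \<le> 8 * \<epsilon>\<^sup>2 * h / \<beta>"
    using Z2le \<beta> by (intro divide_right_mono) auto
  also have "\<dots> = 8 * \<beta>"
  proof -
    have "\<beta> * \<beta> = \<epsilon>\<^sup>2 * h" using h by (simp add: \<beta>_def power2_eq_square)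
    then show ?thesis using \<beta> by (simp add: field_simps)
  qed
  finally have "C / 2 * (\<beta> + (\<integral>\<omega>. (norm (Z \<omega>))\<^sup>2 \<partial>M) / \<beta>) \<le> C / 2 * (9 * \<beta>)"
    using C by (intro mult_left_mono) auto
  moreover have "(G + C * norm A) * prob B \<le> (G + C * norm A) * (32 * (norm A + \<epsilon>)\<^sup>2 * h / \<rho>\<^sup>2)"
    using exit G0 C unfolding B_def by (intro mult_left_mono) auto
  ultimately have "G + sqrt h * m - C / 2 * (9 * \<beta>) - C * K * h
      - (G + C * norm A) * (32 * (norm A + \<epsilon>)\<^sup>2 * h / \<rho>\<^sup>2) - C * norm A * (2 * h) - R * h
      \<le> expected_payoff M c \<alpha> r Y (\<lambda>\<omega>. ennreal (\<tau> \<omega>))"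
    using main by linarith
  moreover have "G + sqrt h * m - C / 2 * (9 * \<beta>) - C * K * h
      - (G + C * norm A) * (32 * (norm A + \<epsilon>)\<^sup>2 * h / \<rho>\<^sup>2) - C * norm A * (2 * h) - R * h
     = G + sqrt h * (m - 9 / 2 * C * \<epsilon>)
    - (32 * (norm A + \<epsilon>)\<^sup>2 / \<rho>\<^sup>2 * (G + C * norm A) + 2 * C * norm A
        + C * K + r * (G + C * \<rho>) + k) * h"
    by (simp add: \<beta>_def R_def algebra_simps)
  ultimately show ?thesis
    unfolding \<tau>_def A_def G_def m_def by simp
qed

end

section \<open>Choice of the oscillation, the radius and the time horizon at a given diagonal
  point\<close>

theorem theorem3p6:
  fixes M :: "'a measure" and F :: "ennreal \<Rightarrow> 'a measure"
    and W :: "real \<Rightarrow> 'a \<Rightarrow> real^2"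
    and \<mu> :: "real^2 \<Rightarrow> real^2" and \<sigma> :: "real^2 \<Rightarrow> real^2^2"
    and X :: "real^2 \<Rightarrow> real \<Rightarrow> 'a \<Rightarrow> real^2"
    and c :: "real^2 \<Rightarrow> real" and \<alpha> r :: real
  assumes "usual_conditions M F" and "brownian_motion M F W" and "r > 0"
    and A1: "locally_lipschitz_on_quadrant \<mu>" "linear_growth_on_quadrant \<mu>"
      "locally_lipschitz_on_quadrant \<sigma>" "linear_growth_on_quadrant \<sigma>"
    and A2: "locally_uniformly_elliptic (diffusion_matrix \<sigma>)"
    and A3: "\<forall>x\<in>quadrant. unique_strong_solution M F W \<mu> \<sigma> x (X x)" "strong_markov M F X"
    and A4: "locally_uniform_flow M X"
    and A5: "\<alpha> > 0" "continuous_on quadrant c" "\<forall>x\<in>quadrant. c x \<ge> 0"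
    and A6: "\<exists>C p. p \<ge> 0 \<and> (\<forall>x\<in>quadrant. 0 \<le> value_function M F c \<alpha> r X x \<and>
          value_function M F c \<alpha> r X x \<le> ereal (C * (1 + norm x powr p)))"
      "\<forall>x\<in>quadrant. \<forall>\<tau>. stopping_time F \<tau> \<longrightarrow> payoff_integrable M c \<alpha> r (X x) \<tau>"
    and nondegenerate: "\<forall>x\<in>diagonal \<alpha> \<inter> open_quadrant.
          invertible (diffusion_matrix \<sigma> x) \<and>
          vector [1, - \<alpha>] \<bullet> (diffusion_matrix \<sigma> x *v vector [1, - \<alpha>]) > 0"
  shows "diagonal \<alpha> \<inter> open_quadrant \<subseteq> continuation_set M F c \<alpha> r X"
proof
  fix x assume x: "x \<in> diagonal \<alpha> \<inter> open_quadrant"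
  interpret filtered_brownian_motion M F W
    by unfold_locales fact+
  let ?n = "vector [1, - \<alpha>] :: real^2"
  define v where "v = transpose (\<sigma> x) *v ?n"
  define C where "C = 1 + \<alpha>"
  have C: "C > 0" using A5(1) by (simp add: C_def)
  have xq: "x \<in> quadrant" and diag: "x $ 1 = \<alpha> * x $ 2" using x by (auto simp: diagonal_def)
  have sol: "reflected_solution M F W \<mu> \<sigma> x (X x)" and adapted: "adapted F (X x)" "continuous_paths M (X x)"
    using A3(1) xq by (auto simp: unique_strong_solution_def reflected_solution_def)
  \<comment> \<open>As a is \<open>\<sigma>\<close> times its transpose, the quadratic form q is the
    squared norm of \<open>v\<close>, the vector whose Gaussian pairing measures the kink.\<close>
  have "?n \<bullet> (diffusion_matrix \<sigma> x *v ?n) = v \<bullet> v"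
    by (simp add: diffusion_matrix_def v_def matrix_vector_mul_assoc[symmetric] dot_lmul_matrix[symmetric])
  moreover have "?n \<bullet> (diffusion_matrix \<sigma> x *v ?n) > 0"
    using nondegenerate x by blast
  ultimately have "v \<noteq> 0" by auto
  define m where "m = (\<integral>z. \<bar>v \<bullet> z\<bar> \<partial>std_gaussian)"
  have m: "m > 0" unfolding m_def by (rule std_gaussian_abs_inner(2)[OF \<open>v \<noteq> 0\<close>])
  \<comment> \<open>Chosen so that \<open>9 / 2 * C * \<epsilon> = m / 4\<close>, half of the
    expected kink \<open>m / 2\<close>.\<close>
  define \<epsilon> where "\<epsilon> = m / (18 * C)"
  have \<epsilon>: "\<epsilon> > 0" using m C by (simp add: \<epsilon>_def)

  have oq: "open_quadrant = {z::real^2. 0 < z $ 1} \<inter> {z. 0 < z $ 2}" by (auto simp: open_quadrant_def)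
  have "open open_quadrant"
    unfolding oq by (intro open_Int open_halfspace_component_gt_cart)
  then obtain \<rho>\<^sub>0 where \<rho>\<^sub>0: "\<rho>\<^sub>0 > 0" "cball x \<rho>\<^sub>0 \<subseteq> open_quadrant"
    using x open_contains_cball by blast
  then have comp: "compact (cball x \<rho>\<^sub>0)" "cball x \<rho>\<^sub>0 \<subseteq> quadrant"
    by (auto simp: open_quadrant_def quadrant_def)
  obtain l where l: "l-lipschitz_on (cball x \<rho>\<^sub>0) \<sigma>"
    using A1(3) comp unfolding locally_lipschitz_on_quadrant_def by blast
  then have l0: "l \<ge> 0" by (rule lipschitz_on_nonneg)
  obtain l' where l': "l'-lipschitz_on (cball x \<rho>\<^sub>0) \<mu>"
    using A1(1) comp unfolding locally_lipschitz_on_quadrant_def by blast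
  have "compact (\<mu> ` cball x \<rho>\<^sub>0)" "compact (c ` cball x \<rho>\<^sub>0)"
    using lipschitz_on_continuous_on[OF l'] continuous_on_subset[OF A5(2) comp(2)] comp(1)
    by (auto intro: compact_continuous_image)
  then have "bounded (\<mu> ` cball x \<rho>\<^sub>0)" "bounded (c ` cball x \<rho>\<^sub>0)"
    by (auto intro: compact_imp_bounded)
  then obtain K k where K: "\<And>y. y \<in> cball x \<rho>\<^sub>0 \<Longrightarrow> norm (\<mu> y) \<le> K"
    and k: "\<And>y. y \<in> cball x \<rho>\<^sub>0 \<Longrightarrow> norm (c y) \<le> k"
    unfolding bounded_iff by blast
  have x0: "x \<in> cball x \<rho>\<^sub>0" using \<rho>\<^sub>0 by simp
  have K0: "0 \<le> K" and k0: "0 \<le> k" using K[OF x0] k[OF x0] norm_ge_zero order_trans by blast+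

  \<comment> \<open>With Lipschitz constant \<open>l\<close>, this radius keeps the oscillation of
    \<open>\<sigma>\<close> below \<open>\<epsilon>\<close>; \<open>l + 1\<close> avoids division by
    0.\<close>
  define \<rho> where "\<rho> = min \<rho>\<^sub>0 (\<epsilon> / (l + 1))"
  have \<rho>: "\<rho> > 0" using \<rho>\<^sub>0 \<epsilon> l0 by (simp add: \<rho>_def)
  have sub: "cball x \<rho> \<subseteq> cball x \<rho>\<^sub>0" by (auto simp: \<rho>_def)
  have \<sigma>: "norm (\<sigma> y - \<sigma> x) \<le> \<epsilon>" if y: "y \<in> cball x \<rho>" for y
  proof -
    have "norm (\<sigma> y - \<sigma> x) \<le> l * dist y x"
      using lipschitz_onD[OF l, of y x] y sub x0 by (auto simp: dist_norm)
    also have "\<dots> \<le> (l + 1) * (\<epsilon> / (l + 1))"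
      using y l0 \<epsilon> by (intro mult_mono) (auto simp: \<rho>_def dist_commute)
    finally show ?thesis using l0 by simp
  qed
  define D where "D = 32 * (norm (\<sigma> x) + \<epsilon>)\<^sup>2 / \<rho>\<^sup>2 * (gain \<alpha> x + C * norm (\<sigma> x)) + 2 * C * norm (\<sigma> x)
        + C * K + r * (gain \<alpha> x + C * \<rho>) + k"
  have D0: "D \<ge> 0"
    unfolding D_def using gain_nonneg[OF xq, of \<alpha>] C K0 k0 \<rho> \<open>r > 0\<close> by (intro add_nonneg_nonneg mult_nonneg_nonneg divide_nonneg_nonneg) auto
  \<comment> \<open>The square root of the horizon. The bounds serve, in order, to have
    \<open>s\<^sup>2 \<le> s\<close>, to push the loss \<open>D * s\<^sup>2\<close> below
    \<open>s * (m / 4)\<close>, and to keep the drift within half the radius. \<open>D\<close> does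
    not depend on the horizon, so the choice is not circular.\<close>
  define s where "s = min 1 (min (m / (8 * (D + 1))) (\<rho> / (2 * (K + 1))))"
  have s: "0 < s" "s \<le> 1" using m D0 \<rho> K0 by (auto simp: s_def)
  have sD: "s * D < m / 4"
  proof -
    have "s * D \<le> m / (8 * (D + 1)) * (D + 1)"
      using D0 m s by (intro mult_mono) (auto simp: s_def)
    also have "\<dots> = m / 8"
    proof -
      have "8 * D + 8 \<noteq> 0" using D0 by linarith
      then show ?thesis by (simp add: field_simps)
    qed
    finally show ?thesis using m by simp
  qed
  have Ks: "K * s\<^sup>2 \<le> \<rho> / 2"
  proof -
    have "K * s\<^sup>2 \<le> (K + 1) * s"
      using s K0 by (intro mult_mono) (auto simp: power2_eq_square mult_le_one)
    also have "\<dots> \<le> (K + 1) * (\<rho> / (2 * (K + 1)))"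
      using K0 by (intro mult_left_mono) (auto simp: s_def)
    also have "\<dots> = \<rho> / 2"
    proof -
      have "2 * K + 2 \<noteq> 0" using K0 by linarith
      then show ?thesis by (simp add: field_simps)
    qed
    finally show ?thesis .
  qed
  define \<tau> where "\<tau> = exit_time (X x) x \<rho> (s\<^sup>2)"
  have stop: "stopping_time F (\<lambda>\<omega>. ennreal (\<tau> \<omega>))"
    unfolding \<tau>_def
    by (intro stopping_time_of_real exit_time_bounds exit_time_le_sets adapted) auto
  have "gain \<alpha> x + sqrt (s\<^sup>2) * (m / 2 - 9 / 2 * C * \<epsilon>) - D * s\<^sup>2
      \<le> expected_payoff M c \<alpha> r (X x) (\<lambda>\<omega>. ennreal (\<tau> \<omega>))"
    unfolding m_def v_def D_def C_def \<tau>_def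
  proof (rule expected_payoff_exit_time[OF sol \<rho> _ _ \<epsilon> K0 _ \<sigma> _ k0 Ks A5(1) \<open>r > 0\<close> diag])
    show "cball x \<rho> \<subseteq> open_quadrant" using sub \<rho>\<^sub>0 by blast
    show "0 < s\<^sup>2" using s by simp
    show "norm (\<mu> y) \<le> K" if "y \<in> cball x \<rho>" for y using K that sub by blast
    show "0 \<le> c y \<and> c y \<le> k" if "y \<in> cball x \<rho>" for y
    proof -
      have "y \<in> cball x \<rho>\<^sub>0" using that sub by blast
      then show ?thesis using k[of y] A5(3) comp(2) by auto
    qed
    show "payoff_integrable M c \<alpha> r (X x) (\<lambda>\<omega>. ennreal (exit_time (X x) x \<rho> (s\<^sup>2) \<omega>))"
      using A6(2) xq stop unfolding \<tau>_def by blast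
  qed
  moreover have "m / 2 - 9 / 2 * C * \<epsilon> = m / 4"
    using C by (simp add: \<epsilon>_def)
  moreover have "sqrt (s\<^sup>2) = s" using s by simp
  moreover have "D * s\<^sup>2 < s * (m / 4)"
    using mult_strict_left_mono[OF sD s(1)] by (simp add: power2_eq_square mult.commute mult.left_commute)
  ultimately have "gain \<alpha> x < expected_payoff M c \<alpha> r (X x) (\<lambda>\<omega>. ennreal (\<tau> \<omega>))"
    by simp
  then have "ereal (gain \<alpha> x) < ereal (expected_payoff M c \<alpha> r (X x) (\<lambda>\<omega>. ennreal (\<tau> \<omega>)))"
    by simp
  also have "\<dots> \<le> value_function M F c \<alpha> r X x"
    unfolding value_function_def using stop by (intro SUP_upper) simp
  finally show "x \<in> continuation_set M F c \<alpha> r X"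
    using xq by (simp add: continuation_set_def)
qed

end
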